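(* Let $k$ be an algebraically closed field, $n\ge2$, $G=\mathrm{GL}_n(k)$, $\mathfrak g=\mathfrak{gl}_n(k)$, and $k[\mathfrak g]=k[\xi_{ij}:1\le i,j\le n]$. Assume $t=1$, or $n\ge3$ and $t\in\{1,n-2,n-1\}$. Put $\lambda^t=(t,0,\dots,0,-1,\dots,-1)$ (with $t$ entries $-1$) and $\mu^t=(1,\dots,1,0,\dots,0,-t)$ (with $t$ entries $1$), and for $I\subseteq\{2,\dots,n\}$ with $|I|=t$ define $$u_{t,I}=\det\big((\partial_{1i}s_j)_{n-t+1\le i\le n,\ j\in I}\big),\qquad v_{t,I}=\det\big((\partial_{in}s_j)_{1\le i\le t,\ j\in I}\big),$$ with the indices in $I$ in increasing order. Then the $u_{t,I}$, $I\subseteq\{2,\dots,n\}$ with $|I|=t$, are algebraically independent over $k[\mathfrak g]^G$ and generate the $k[\mathfrak g]^G$-algebra $\bigoplus_{r\ge0}k[\mathfrak g]^U_{r\lambda^t}$. The same holds for the $v_{t,I}$ and $\bigoplus_{r\ge0}k[\mathfrak g]^U_{r\mu^t}$.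
   Context: $G$ acts on $\mathfrak g$ by conjugation and on $k[\mathfrak g]$ by $(g\cdot f)(x)=f(g^{-1}xg)$. $U$ is the subgroup of upper unitriangular matrices and $T$ the diagonal torus; $(\lambda_1,\dots,\lambda_n)\in\mathbb Z^n$ denotes the character $\mathrm{diag}(a_1,\dots,a_n)\mapsto\prod a_i^{\lambda_i}$ of $T$. $k[\mathfrak g]^U_\lambda$ is the space of $U$-invariant polynomials of $T$-weight $\lambda$. $s_i(x)=\mathrm{tr}(\wedge^i x)$ for $1\le i\le n$, and $\partial_{ij}=\partial/\partial\xi_{ij}$. *)

theory Defs
  imports "HOL-Library.Poly_Mapping" "HOL-Combinatorics.Permutations"
    "HOL-Computational_Algebra.Polynomial"
begin

text \<open>Polynomials in the variables xi_ij (indices i,j natural numbers, 1-based), represented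
  as finitely supported maps from monomials (finitely supported exponent maps) to coefficients.
  k[gl_n] is the subring of those polynomials involving only xi_ij with 1 <= i,j <= n.\<close>

type_synonym 'k mpoly = "((nat \<times> nat) \<Rightarrow>\<^sub>0 nat) \<Rightarrow>\<^sub>0 'k"

definition Var :: "nat \<Rightarrow> nat \<Rightarrow> 'k::comm_ring_1 mpoly" where
  "Var i j = Poly_Mapping.single (Poly_Mapping.single (i, j) 1) 1"

definition polys :: "nat \<Rightarrow> 'k::comm_ring_1 mpoly set" where
  "polys n = {p :: 'k mpoly. \<forall>m\<in>Poly_Mapping.keys p. Poly_Mapping.keys m \<subseteq> ({1..n} \<times> {1..n})}"

definition mpeval :: "(nat \<Rightarrow> nat \<Rightarrow> 'k::comm_ring_1) \<Rightarrow> 'k mpoly \<Rightarrow> 'k" where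
  "mpeval x p = (\<Sum>m\<in>Poly_Mapping.keys p. Poly_Mapping.lookup p m * (\<Prod>v\<in>Poly_Mapping.keys m. x (fst v) (snd v) ^ Poly_Mapping.lookup m v))"

definition pdiff :: "nat \<times> nat \<Rightarrow> 'k::comm_ring_1 mpoly \<Rightarrow> 'k mpoly" where
  "pdiff v p = (\<Sum>m\<in>Poly_Mapping.keys p.
      Poly_Mapping.single (m - Poly_Mapping.single v 1) (of_nat (Poly_Mapping.lookup m v) * Poly_Mapping.lookup p m))"

definition detm :: "nat list \<Rightarrow> nat list \<Rightarrow> (nat \<Rightarrow> nat \<Rightarrow> 'a::comm_ring_1) \<Rightarrow> 'a" where
  "detm rs cs A = (\<Sum>p | p permutes {..<length rs}.
      of_int (sign p) * (\<Prod>a<length rs. A (rs ! a) (cs ! p a)))"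

text \<open>s_j(x) = tr(wedge^j x) = sum of the principal j x j minors of the generic matrix.\<close>
definition s_inv :: "nat \<Rightarrow> nat \<Rightarrow> 'k::comm_ring_1 mpoly" where
  "s_inv n j = (\<Sum>S | S \<subseteq> {1..n} \<and> card S = j.
      detm (sorted_list_of_set S) (sorted_list_of_set S) Var)"

definition mmul :: "nat \<Rightarrow> (nat \<Rightarrow> nat \<Rightarrow> 'k::comm_ring_1) \<Rightarrow> (nat \<Rightarrow> nat \<Rightarrow> 'k) \<Rightarrow> nat \<Rightarrow> nat \<Rightarrow> 'k" where
  "mmul n A B = (\<lambda>i j. \<Sum>l=1..n. A i l * B l j)"

definition idm :: "nat \<Rightarrow> nat \<Rightarrow> 'k::comm_ring_1" where
  "idm i j = (if i = j then 1 else 0)"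

definition is_inverse :: "nat \<Rightarrow> (nat \<Rightarrow> nat \<Rightarrow> 'k::comm_ring_1) \<Rightarrow> (nat \<Rightarrow> nat \<Rightarrow> 'k) \<Rightarrow> bool" where
  "is_inverse n g h \<longleftrightarrow> (\<forall>i\<in>{1..n}. \<forall>j\<in>{1..n}. mmul n g h i j = idm i j \<and> mmul n h g i j = idm i j)"

definition unitriangular :: "nat \<Rightarrow> (nat \<Rightarrow> nat \<Rightarrow> 'k::comm_ring_1) \<Rightarrow> bool" where
  "unitriangular n g \<longleftrightarrow> (\<forall>i\<in>{1..n}. \<forall>j\<in>{1..n}. (j < i \<longrightarrow> g i j = 0) \<and> g i i = 1)"

definition diagm :: "(nat \<Rightarrow> 'k::comm_ring_1) \<Rightarrow> nat \<Rightarrow> nat \<Rightarrow> 'k" where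
  "diagm a = (\<lambda>i j. if i = j then a i else 0)"

definition invG :: "nat \<Rightarrow> 'k::field mpoly set" where
  "invG n = {f \<in> polys n. \<forall>g h x. is_inverse n g h \<longrightarrow>
      mpeval (mmul n (mmul n h x) g) f = mpeval x f}"

text \<open>k[g]^U_lambda: U-invariant polynomials of T-weight lambda, where
  (t.f)(x) = f(t^-1 x t) = lambda(t) f(x), lambda(diag a) = prod a_i^lambda_i.\<close>
definition invU_wt :: "nat \<Rightarrow> (nat \<Rightarrow> int) \<Rightarrow> 'k::field mpoly set" where
  "invU_wt n lam = {f \<in> polys n.
      (\<forall>g h x. unitriangular n g \<longrightarrow> is_inverse n g h \<longrightarrow>
          mpeval (mmul n (mmul n h x) g) f = mpeval x f) \<and>
      (\<forall>a x. (\<forall>i\<in>{1..n}. a i \<noteq> 0) \<longrightarrow>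
          mpeval (mmul n (mmul n (diagm (\<lambda>i. inverse (a i))) x) (diagm a)) f
            = (\<Prod>i=1..n. a i powi lam i) * mpeval x f)}"

definition wt_algebra :: "nat \<Rightarrow> (nat \<Rightarrow> int) \<Rightarrow> 'k::field mpoly set" where
  "wt_algebra n lam = {\<Sum>r\<in>F. f r | F f. finite F \<and>
      (\<forall>r\<in>F. f r \<in> invU_wt n (\<lambda>i. int r * lam i))}"

definition exps :: "'a set \<Rightarrow> ('a \<Rightarrow> nat) set" where
  "exps S = {\<alpha>. \<forall>x. x \<notin> S \<longrightarrow> \<alpha> x = 0}"

definition alg_indep_over :: "'b::comm_ring_1 set \<Rightarrow> 'a set \<Rightarrow> ('a \<Rightarrow> 'b) \<Rightarrow> bool" where
  "alg_indep_over R S u \<longleftrightarrow> (\<forall>E c. finite E \<and> E \<subseteq> exps S \<and> (\<forall>\<alpha>\<in>E. c \<alpha> \<in> R) \<and>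
      (\<Sum>\<alpha>\<in>E. c \<alpha> * (\<Prod>s\<in>S. u s ^ \<alpha> s)) = 0 \<longrightarrow> (\<forall>\<alpha>\<in>E. c \<alpha> = 0))"

text \<open>The R-subalgebra generated by the family (u s), s in S (S finite).\<close>
definition alg_generated :: "'b::comm_ring_1 set \<Rightarrow> 'a set \<Rightarrow> ('a \<Rightarrow> 'b) \<Rightarrow> 'b set" where
  "alg_generated R S u = {\<Sum>\<alpha>\<in>E. c \<alpha> * (\<Prod>s\<in>S. u s ^ \<alpha> s) | E c.
      finite E \<and> E \<subseteq> exps S \<and> (\<forall>\<alpha>\<in>E. c \<alpha> \<in> R)}"

definition lam_t :: "nat \<Rightarrow> nat \<Rightarrow> nat \<Rightarrow> int" where
  "lam_t n t i = (if i = 1 then int t else if n - t + 1 \<le> i \<and> i \<le> n then -1 else 0)"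

definition mu_t :: "nat \<Rightarrow> nat \<Rightarrow> nat \<Rightarrow> int" where
  "mu_t n t i = (if 1 \<le> i \<and> i \<le> t then 1 else if i = n then - int t else 0)"

definition u_tI :: "nat \<Rightarrow> nat \<Rightarrow> nat set \<Rightarrow> 'k::comm_ring_1 mpoly" where
  "u_tI n t I = detm [n - t + 1..<n + 1] (sorted_list_of_set I)
      (\<lambda>i j. pdiff (1, i) (s_inv n j))"

definition v_tI :: "nat \<Rightarrow> nat \<Rightarrow> nat set \<Rightarrow> 'k::comm_ring_1 mpoly" where
  "v_tI n t I = detm [1..<t + 1] (sorted_list_of_set I)
      (\<lambda>i j. pdiff (i, n) (s_inv n j))"

end

theory Submission
  imports Defs "Jordan_Normal_Form.Determinant"
begin

text \<open>Let M_j be the gradient of s_j, transposed. Comparing coefficients in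
  (l + x) adj(l + x) = det(l + x) gives M_1 = 1, M_{j+1} = s_j - x M_j and x M_n = s_n. So the
  matrix q(x) with columns M_j(x) e_1 conjugates x to a companion matrix C with entries in the
  invariants, and u_{t,I}(x) is the minor of q(x) in the last t rows and the columns I. If q(x) is
  invertible, f(x) = f(q C q^{-1}). For f of weight r lambda^t this depends on q only through the
  minors, since f is semi-invariant under a parabolic subgroup. Moreover these minors can be
  prescribed freely, since for t in {1, n-2, n-1} they satisfy no Pluecker relations, and f(q C q^{-1})
  is a form of degree r in them. The semi-invariance and the degree bound both come from SL_2: conjugating
  by a lower unipotent with parameter c gives a polynomial P(c) = c^d Q(1/c), where d is the value of
  the weight on the coroot, so P has degree at most d. The v_{t,I} are obtained by reflection in the
  antidiagonal.\<close>

section \<open>Evaluation of polynomials\<close>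

text \<open>The condition on t has a geometric source. The first column of q(x) is e_1, so the
  minors in question are the maximal minors of a t x (n-1) matrix, that is, Pluecker coordinates of
  Gr(t, n-1). This Grassmannian fills its projective space exactly for t = 1, n-2 and n-1, where it
  parametrises lines, hyperplanes or a single point. The obstacle to generation is denominators: f(q
  C q^{-1}) contains the inverse of q. Semi-invariance replaces q by a unipotent T(z), where z =
  w/w_p are the ratios of the minors to a fixed one, at the cost of a factor w_p^r. Both T(z) and
  its inverse are polynomial in z, so only powers of w_p remain in the denominators, and the degree
  bound says that w_p^r clears them. The field may have positive characteristic, so everything rests
  on polynomial identities over an infinite field instead of Lie algebra arguments. Even the
  gradients are handled as finite differences, which is exact because s_j has degree at most one in
  each variable.\<close>

definition monev :: "(nat \<Rightarrow> nat \<Rightarrow> 'k::comm_ring_1) \<Rightarrow> (nat \<times> nat \<Rightarrow>\<^sub>0 nat) \<Rightarrow> 'k" where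
  "monev x m = (\<Prod>v\<in>Poly_Mapping.keys m. x (fst v) (snd v) ^ Poly_Mapping.lookup m v)"

lemma monev_superset:
  assumes "finite V" "Poly_Mapping.keys m \<subseteq> V"
  shows "monev x m = (\<Prod>v\<in>V. x (fst v) (snd v) ^ Poly_Mapping.lookup m v)"
  unfolding monev_def using assms
  by (intro prod.mono_neutral_left) (auto simp: in_keys_iff)

lemma monev_0 [simp]: "monev x 0 = 1"
  by (simp add: monev_def)

lemma monev_add: "monev x (m + m') = monev x m * monev x m'"
proof -
  let ?V = "Poly_Mapping.keys m \<union> Poly_Mapping.keys m'"
  have "Poly_Mapping.keys (m + m') \<subseteq> ?V"
    by (rule Poly_Mapping.keys_add)
  then show ?thesis
    by (simp add: monev_superset [of ?V] lookup_add power_add prod.distrib)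
qed

lemma monev_single: "monev x (Poly_Mapping.single v e) = x (fst v) (snd v) ^ e"
  by (cases "e = 0") (simp_all add: monev_def)

lemma mpeval_superset:
  assumes "finite M" "Poly_Mapping.keys p \<subseteq> M"
  shows "mpeval x p = (\<Sum>m\<in>M. Poly_Mapping.lookup p m * monev x m)"
  unfolding mpeval_def monev_def using assms
  by (intro sum.mono_neutral_left) (auto simp: in_keys_iff)

lemma mpeval_monev:
  "mpeval x p = (\<Sum>m\<in>Poly_Mapping.keys p. Poly_Mapping.lookup p m * monev x m)"
  by (simp add: mpeval_def monev_def)

lemma mpeval_0 [simp]: "mpeval x 0 = 0"
  by (simp add: mpeval_def)

lemma mpeval_single: "mpeval x (Poly_Mapping.single m c) = c * monev x m"
  by (cases "c = 0") (simp_all add: mpeval_monev)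

lemma mpeval_1 [simp]: "mpeval x 1 = 1"
  by (metis mpeval_single monev_0 mult_1 single_one)

lemma mpeval_Var [simp]: "mpeval x (Var i j) = x i j"
  by (simp add: Var_def mpeval_single monev_single)

lemma mpeval_add [simp]: "mpeval x (p + q) = mpeval x p + mpeval x q"
proof -
  let ?M = "Poly_Mapping.keys p \<union> Poly_Mapping.keys q"
  have "Poly_Mapping.keys (p + q) \<subseteq> ?M"
    by (rule Poly_Mapping.keys_add)
  then show ?thesis
    by (simp add: mpeval_superset [of ?M] lookup_add distrib_right sum.distrib)
qed

lemma mpeval_sum [simp]: "mpeval x (sum f A) = (\<Sum>a\<in>A. mpeval x (f a))"
  by (induction A rule: infinite_finite_induct) auto

lemma mpeval_uminus [simp]: "mpeval x (- p) = - mpeval x p"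
  using mpeval_add [of x p "- p"] by (simp add: eq_neg_iff_add_eq_0 add.commute)

lemma mpeval_diff [simp]: "mpeval x (p - q) = mpeval x p - mpeval x q"
  using mpeval_add [of x p "- q"] by simp

lemma poly_mapping_sum_single:
  "(\<Sum>m\<in>Poly_Mapping.keys p. Poly_Mapping.single m (Poly_Mapping.lookup p m)) = p"
  by (rule poly_mapping_eqI)
    (simp add: lookup_sum lookup_single when_def in_keys_iff)

lemma mpeval_single_mult:
  "mpeval x (Poly_Mapping.single m c * q) = c * monev x m * mpeval x q"
proof -
  have "Poly_Mapping.single m c * q
      = (\<Sum>m'\<in>Poly_Mapping.keys q. Poly_Mapping.single (m + m') (c * Poly_Mapping.lookup q m'))"
    by (subst (1) poly_mapping_sum_single [of q, symmetric]) (simp add: sum_distrib_left mult_single)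
  then show ?thesis
    by (simp add: mpeval_single monev_add mpeval_monev [of x q] sum_distrib_left mult_ac)
qed

lemma mpeval_mult [simp]: "mpeval x (p * q) = mpeval x p * mpeval x q"
proof -
  have "p * q = (\<Sum>m\<in>Poly_Mapping.keys p. Poly_Mapping.single m (Poly_Mapping.lookup p m) * q)"
    by (subst (1) poly_mapping_sum_single [of p, symmetric]) (simp add: sum_distrib_right)
  then show ?thesis
    by (simp add: mpeval_single_mult mpeval_monev [of x p] sum_distrib_right)
qed

lemma mpeval_prod [simp]: "mpeval x (prod f A) = (\<Prod>a\<in>A. mpeval x (f a))"
  by (induction A rule: infinite_finite_induct) auto

lemma mpeval_power [simp]: "mpeval x (p ^ k) = mpeval x p ^ k"
  by (induction k) auto

lemma mpeval_of_nat [simp]: "mpeval x (of_nat k) = of_nat k"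
  by (induction k) auto

lemma mpeval_of_int [simp]: "mpeval x (of_int k) = of_int k"
  by (cases k) auto

abbreviation Cst :: "'k::comm_ring_1 \<Rightarrow> 'k mpoly" where
  "Cst c \<equiv> Poly_Mapping.single 0 c"

lemma mpeval_Cst [simp]: "mpeval x (Cst c) = c"
  by (simp add: mpeval_single)

lemma mpeval_cong:
  assumes "p \<in> polys n" "\<And>i j. i \<in> {1..n} \<Longrightarrow> j \<in> {1..n} \<Longrightarrow> x i j = y i j"
  shows "mpeval x p = mpeval y p"
proof -
  have "monev x m = monev y m" if "m \<in> Poly_Mapping.keys p" for m
    unfolding monev_def
  proof (rule prod.cong [OF refl])
    fix v assume "v \<in> Poly_Mapping.keys m"
    with that assms(1) have "v \<in> {1..n} \<times> {1..n}"
      by (auto simp: polys_def)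
    then show "x (fst v) (snd v) ^ Poly_Mapping.lookup m v = y (fst v) (snd v) ^ Poly_Mapping.lookup m v"
      using assms(2) by auto
  qed
  then show ?thesis
    by (simp add: mpeval_monev)
qed

section \<open>The subring of polynomials in the entries of a square matrix\<close>

lemma polys_0 [simp]: "0 \<in> polys n"
  by (simp add: polys_def)

lemma polys_single: "Poly_Mapping.keys m \<subseteq> {1..n} \<times> {1..n} \<Longrightarrow> Poly_Mapping.single m c \<in> polys n"
  by (auto simp: polys_def)

lemma polys_Cst [simp]: "Cst c \<in> polys n"
  by (simp add: polys_single)

lemma polys_1 [simp]: "1 \<in> polys n"
  by (metis polys_Cst single_one)

lemma polys_Var: "i \<in> {1..n} \<Longrightarrow> j \<in> {1..n} \<Longrightarrow> Var i j \<in> polys n"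
  unfolding Var_def by (rule polys_single) auto

lemma polys_add [intro]: "p \<in> polys n \<Longrightarrow> q \<in> polys n \<Longrightarrow> p + q \<in> polys n"
  unfolding polys_def using Poly_Mapping.keys_add [of p q] by blast

lemma polys_uminus [intro]: "p \<in> polys n \<Longrightarrow> - p \<in> polys n"
  by (auto simp: polys_def in_keys_iff)

lemma polys_diff [intro]: "p \<in> polys n \<Longrightarrow> q \<in> polys n \<Longrightarrow> p - q \<in> polys n"
  using polys_add [of p n "- q"] polys_uminus [of q n] by simp

lemma polys_mult [intro]: 
  assumes "p \<in> polys n" "q \<in> polys n" 
  shows "p * q \<in> polys n"
proof -
  have "Poly_Mapping.keys m \<subseteq> {1..n} \<times> {1..n}" if m: "m \<in> Poly_Mapping.keys (p * q)" for m
  proof -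
    obtain a b where "m = a + b" "a \<in> Poly_Mapping.keys p" "b \<in> Poly_Mapping.keys q"
      using m keys_mult [of p q] by blast
    then show ?thesis
      using assms Poly_Mapping.keys_add [of a b] unfolding polys_def by blast
  qed
  then show ?thesis by (simp add: polys_def)
qed

lemma polys_sum [intro]: "(\<And>a. a \<in> A \<Longrightarrow> f a \<in> polys n) \<Longrightarrow> sum f A \<in> polys n"
  by (induction A rule: infinite_finite_induct) auto

lemma polys_prod [intro]: "(\<And>a. a \<in> A \<Longrightarrow> f a \<in> polys n) \<Longrightarrow> prod f A \<in> polys n"
  by (induction A rule: infinite_finite_induct) auto

lemma polys_power [intro]: "p \<in> polys n \<Longrightarrow> p ^ k \<in> polys n"
  by (induction k) auto

lemma polys_of_int [simp]: "of_int k \<in> polys n"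
  by (metis polys_Cst single_of_int)

text \<open>Two substitutions are needed later: a companion matrix with invariant entries
  (\<open>companion_subst\<close>) and the reflection of the indices in the antidiagonal
  (\<open>mreflect\<close>).\<close>

definition mpsubst :: "(nat \<Rightarrow> nat \<Rightarrow> 'k::comm_ring_1 mpoly) \<Rightarrow> 'k mpoly \<Rightarrow> 'k mpoly" where
  "mpsubst \<sigma> p = (\<Sum>m\<in>Poly_Mapping.keys p. Cst (Poly_Mapping.lookup p m)
     * (\<Prod>v\<in>Poly_Mapping.keys m. \<sigma> (fst v) (snd v) ^ Poly_Mapping.lookup m v))"

lemma mpeval_mpsubst: "mpeval x (mpsubst \<sigma> p) = mpeval (\<lambda>i j. mpeval x (\<sigma> i j)) p"
  by (simp add: mpsubst_def mpeval_def [of _ p])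

lemma polys_vars:
  assumes "p \<in> polys n" "m \<in> Poly_Mapping.keys p" "v \<in> Poly_Mapping.keys m"
  shows "fst v \<in> {1..n}" "snd v \<in> {1..n}"
proof -
  have "v \<in> {1..n} \<times> {1..n}"
    using assms unfolding polys_def by blast
  then show "fst v \<in> {1..n}" "snd v \<in> {1..n}" by auto
qed

lemma polys_mpsubst:
  assumes "p \<in> polys n" "\<And>i j. i \<in> {1..n} \<Longrightarrow> j \<in> {1..n} \<Longrightarrow> \<sigma> i j \<in> polys n'"
  shows "mpsubst \<sigma> p \<in> polys n'"
  unfolding mpsubst_def using polys_vars [OF assms(1)]
  by (intro polys_sum polys_mult polys_prod polys_power polys_Cst assms(2))

text \<open>Along a polynomial curve of points every polynomial becomes a polynomial in the curve
  parameter. This reduces the density argument and the SL_2 degree bound to one variable.\<close>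

lemma mpeval_poly_entries:
  "\<exists>P. \<forall>\<tau>. mpeval (\<lambda>i j. poly (X i j) \<tau>) p = poly P \<tau>"
proof (intro exI allI)
  fix \<tau>
  show "mpeval (\<lambda>i j. poly (X i j) \<tau>) p = poly (\<Sum>m\<in>Poly_Mapping.keys p.
     Polynomial.smult (Poly_Mapping.lookup p m) (\<Prod>v\<in>Poly_Mapping.keys m. X (fst v) (snd v) ^ Poly_Mapping.lookup m v)) \<tau>"
    by (simp add: mpeval_def poly_sum poly_prod)
qed

section \<open>Polynomials over an infinite field\<close>

text \<open>Euclid's argument: over a finite field the product of all X - a, plus 1, would be a
  non-constant polynomial without a root.\<close>

lemma infinite_UNIV_alg_closed: "infinite (UNIV :: 'k::alg_closed_field set)"
proof
  assume fin: "finite (UNIV :: 'k set)"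
  define P :: "'k poly" where "P = (\<Prod>a\<in>UNIV. [:- a, 1:]) + 1"
  have "\<exists>x. poly (P) x = 0"
  proof (rule alg_closed_imp_poly_has_root)
    have "degree (\<Prod>a\<in>(UNIV::'k set). [:- a, 1:]) = card (UNIV::'k set)"
      by (subst degree_prod_eq_sum_degree) auto
    moreover have "card (UNIV::'k set) > 0"
      using fin by (simp add: card_gt_0_iff)
    ultimately show "degree P > 0"
      unfolding P_def by (subst degree_add_eq_left) auto
  qed
  then obtain x where "poly P x = 0" by blast
  moreover have "poly (\<Prod>a\<in>UNIV. [:- a, 1:]) x = 0"
    using fin by (auto simp: poly_prod prod_zero_iff)
  ultimately show False by (simp add: P_def)
qed

text \<open>The point 0 is left out because the identities below come from torus elements or inverse
  parameters and are known only for t \<noteq> 0.\<close>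

lemma poly_eq_0_if_zero_off_0:
  fixes P :: "'k::field poly"
  assumes "infinite (UNIV :: 'k set)" "\<And>t. t \<noteq> 0 \<Longrightarrow> poly P t = 0"
  shows "P = 0"
proof (rule ccontr)
  assume "P \<noteq> 0"
  then have "finite {t. poly P t = 0}" by (rule poly_roots_finite)
  moreover have "UNIV - {0} \<subseteq> {t. poly P t = 0}" using assms(2) by auto
  ultimately have "finite (UNIV - {0::'k})" by (rule finite_subset [rotated])
  then show False using assms(1) by simp
qed

text \<open>Induction on the variables: with the others fixed, the sum is a polynomial in the
  variable \<open>a\<close> that vanishes off 0, so each of its coefficients vanishes. Testing only
  at points without zero coordinates matters, because later the values w of the generators are
  realised by matrices only for such w.\<close>

lemma monomials_lin_indep:
  fixes c :: "('a \<Rightarrow> nat) \<Rightarrow> 'k::field"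
  assumes inf: "infinite (UNIV :: 'k set)"
    and "finite S" "finite E" "E \<subseteq> exps S"
    and "\<And>w. (\<forall>s\<in>S. w s \<noteq> 0) \<Longrightarrow> (\<Sum>\<alpha>\<in>E. c \<alpha> * (\<Prod>s\<in>S. w s ^ \<alpha> s)) = 0"
    and "\<alpha> \<in> E"
  shows "c \<alpha> = 0"
  using assms(2-)
proof (induction S arbitrary: E c \<alpha> rule: finite_induct)
  case empty
  then have "E \<subseteq> {\<lambda>_. 0}" "\<alpha> = (\<lambda>_. 0)" by (auto simp: exps_def)
  then have "E = {\<alpha>}" using empty.prems(4) by auto
  then show ?case using empty.prems(3) [of "\<lambda>_. 1"] by simp
next
  case (insert a S)
  \<comment> \<open>The coefficient of the power k of the variable \<open>a\<close> collects the
    exponents in \<open>E'\<close>. Erasing their \<open>a\<close>-component by \<open>r\<close> is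
    injective there and leaves a relation in the remaining variables.\<close>
  define k where "k = \<alpha> a"
  define E' where "E' = {\<beta>\<in>E. \<beta> a = k}"
  define r where "r \<beta> = \<beta>(a := 0)" for \<beta> :: "'a \<Rightarrow> nat"
  have inj: "inj_on r E'"
    by (rule inj_on_inverseI [where g = "\<lambda>\<beta>. \<beta>(a := k)"]) (auto simp: r_def E'_def)
  have "(\<Sum>\<beta>\<in>r ` E'. c (\<beta>(a := k)) * (\<Prod>s\<in>S. w s ^ \<beta> s)) = 0" if w: "\<forall>s\<in>S. w s \<noteq> 0" for w
  proof -
    define P where "P = (\<Sum>\<beta>\<in>E. monom (c \<beta> * (\<Prod>s\<in>S. w s ^ \<beta> s)) (\<beta> a))"
    have "P = 0"
    proof (rule poly_eq_0_if_zero_off_0 [OF inf])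
      fix t :: 'k assume t: "t \<noteq> 0"
      have "(\<Sum>\<beta>\<in>E. c \<beta> * (\<Prod>s\<in>insert a S. (w(a := t)) s ^ \<beta> s)) = 0"
        using w t by (intro insert.prems(3)) auto
      also have "(\<Sum>\<beta>\<in>E. c \<beta> * (\<Prod>s\<in>insert a S. (w(a := t)) s ^ \<beta> s)) = poly P t"
        unfolding P_def poly_sum
      proof (rule sum.cong [OF refl])
        fix \<beta>
        have "(\<Prod>s\<in>S. (w(a := t)) s ^ \<beta> s) = (\<Prod>s\<in>S. w s ^ \<beta> s)"
          using insert.hyps by (intro prod.cong) auto
        then show "c \<beta> * (\<Prod>s\<in>insert a S. (w(a := t)) s ^ \<beta> s)
            = poly (monom (c \<beta> * (\<Prod>s\<in>S. w s ^ \<beta> s)) (\<beta> a)) t"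
          using insert.hyps by (simp add: poly_monom mult_ac)
      qed
      finally show "poly P t = 0" .
    qed
    then have "0 = coeff P k" by simp
    also have "\<dots> = (\<Sum>\<beta>\<in>E. if \<beta> a = k then c \<beta> * (\<Prod>s\<in>S. w s ^ \<beta> s) else 0)"
      by (simp add: P_def coeff_sum)
    also have "\<dots> = (\<Sum>\<beta>\<in>E'. c \<beta> * (\<Prod>s\<in>S. w s ^ \<beta> s))"
      using insert.prems(1) by (simp add: E'_def sum.If_cases Int_def)
    also have "\<dots> = (\<Sum>\<beta>\<in>E'. c ((r \<beta>)(a := k)) * (\<Prod>s\<in>S. w s ^ r \<beta> s))"
    proof (rule sum.cong [OF refl])
      fix \<beta> assume "\<beta> \<in> E'"
      then have "(r \<beta>)(a := k) = \<beta>" by (auto simp: E'_def r_def)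
      moreover have "(\<Prod>s\<in>S. w s ^ r \<beta> s) = (\<Prod>s\<in>S. w s ^ \<beta> s)"
        using insert.hyps by (intro prod.cong) (auto simp: r_def)
      ultimately show "c \<beta> * (\<Prod>s\<in>S. w s ^ \<beta> s) = c ((r \<beta>)(a := k)) * (\<Prod>s\<in>S. w s ^ r \<beta> s)"
        by simp
    qed
    finally show ?thesis
      by (simp add: sum.reindex [OF inj])
  qed
  moreover have "finite (r ` E')" using insert.prems(1) by (simp add: E'_def)
  moreover have "r ` E' \<subseteq> exps S"
    using insert.prems(2) by (auto simp: E'_def r_def exps_def)
  moreover have "r \<alpha> \<in> r ` E'"
    using insert.prems(4) by (simp add: E'_def k_def)
  ultimately have "c ((r \<alpha>)(a := k)) = 0"
    by (intro insert.IH [where E = "r ` E'" and c = "\<lambda>\<beta>. c (\<beta>(a := k))"]) auto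
  moreover have "(r \<alpha>)(a := k) = \<alpha>" by (auto simp: r_def k_def)
  ultimately show ?case by simp
qed

lemma mpeval_eq_0_imp:
  fixes p :: "'k::field mpoly"
  assumes inf: "infinite (UNIV :: 'k set)" and "\<And>x. mpeval x p = 0"
  shows "p = 0"
proof -
  define V where "V = (\<Union>m\<in>Poly_Mapping.keys p. Poly_Mapping.keys m)"
  define E where "E = Poly_Mapping.lookup ` Poly_Mapping.keys p"
  define c where "c \<alpha> = Poly_Mapping.lookup p (Abs_poly_mapping \<alpha>)" for \<alpha>
  have inj: "inj_on Poly_Mapping.lookup (Poly_Mapping.keys p)"
    by (auto intro: inj_onI poly_mapping_eqI)
  have "c \<alpha> = 0" if "\<alpha> \<in> E" for \<alpha>
  proof (rule monomials_lin_indep [OF inf _ _ _ _ that])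
    show "finite V" "finite E" by (auto simp: V_def E_def)
    then show "E \<subseteq> exps V"
      by (auto simp: E_def V_def exps_def in_keys_iff) 
    fix w :: "nat \<times> nat \<Rightarrow> 'k"
    have "0 = (\<Sum>m\<in>Poly_Mapping.keys p. Poly_Mapping.lookup p m * monev (\<lambda>i j. w (i, j)) m)"
      using assms(2) [of "\<lambda>i j. w (i, j)"] by (simp add: mpeval_monev)
    also have "\<dots> = (\<Sum>m\<in>Poly_Mapping.keys p. c (Poly_Mapping.lookup m)
        * (\<Prod>s\<in>V. w s ^ Poly_Mapping.lookup m s))"
    proof (rule sum.cong [OF refl])
      fix m assume "m \<in> Poly_Mapping.keys p"
      then have "monev (\<lambda>i j. w (i, j)) m = (\<Prod>s\<in>V. w s ^ Poly_Mapping.lookup m s)"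
        by (subst monev_superset [where V = V]) (auto simp: V_def)
      then show "Poly_Mapping.lookup p m * monev (\<lambda>i j. w (i, j)) m
          = c (Poly_Mapping.lookup m) * (\<Prod>s\<in>V. w s ^ Poly_Mapping.lookup m s)"
        by (simp add: c_def lookup_inverse)
    qed
    finally show "(\<Sum>\<alpha>\<in>E. c \<alpha> * (\<Prod>s\<in>V. w s ^ \<alpha> s)) = 0"
      by (simp add: E_def sum.reindex [OF inj])
  qed
  then have "Poly_Mapping.lookup p m = 0" if "m \<in> Poly_Mapping.keys p" for m
    using that by (metis E_def c_def lookup_inverse imageI)
  then show ?thesis
    by (intro poly_mapping_eqI) (metis in_keys_iff lookup_zero)
qed

lemma mpeval_ext:
  fixes p q :: "'k::field mpoly"
  assumes "infinite (UNIV :: 'k set)" "\<And>x. mpeval x p = mpeval x q"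
  shows "p = q"
  using mpeval_eq_0_imp [of "p - q"] assms by simp

text \<open>Restricting both polynomials to the line through a non-zero of each reduces to one variable.\<close>

lemma mpeval_mult_eq_0_imp:
  fixes p q :: "'k::field mpoly"
  assumes inf: "infinite (UNIV :: 'k set)"
    and 0: "\<And>x. mpeval x q \<noteq> 0 \<Longrightarrow> mpeval x p = 0" and q: "mpeval y q \<noteq> 0"
  shows "p = 0"
proof (rule mpeval_eq_0_imp [OF inf], rule ccontr)
  fix x assume p: "mpeval x p \<noteq> 0"
  define X where "X i j = [:x i j, y i j - x i j:]" for i j
  obtain P Q where P: "\<And>\<tau>. mpeval (\<lambda>i j. poly (X i j) \<tau>) p = poly P \<tau>"
    and Q: "\<And>\<tau>. mpeval (\<lambda>i j. poly (X i j) \<tau>) q = poly Q \<tau>"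
    using mpeval_poly_entries by metis
  have "poly (P * Q) \<tau> = 0" for \<tau>
    using 0 [of "\<lambda>i j. poly (X i j) \<tau>"] by (auto simp: P Q)
  then have "P * Q = 0"
    using poly_eq_0_if_zero_off_0 [OF inf] by blast
  moreover have "poly P 0 \<noteq> 0" using p P [of 0] by (simp add: X_def)
  moreover have "poly Q 1 \<noteq> 0" using q Q [of 1] by (simp add: X_def)
  ultimately show False by auto
qed

text \<open>The locus d \<noteq> 0 is dense as soon as it is non-empty. Here d will be the product
  of \<open>krylov_det\<close> and all generators.\<close>

lemma mpeval_ext_generic:
  fixes p q :: "'k::field mpoly"
  assumes "infinite (UNIV :: 'k set)" "\<And>x. mpeval x d \<noteq> 0 \<Longrightarrow> mpeval x p = mpeval x q"
    and "mpeval y d \<noteq> 0"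
  shows "p = q"
  using mpeval_mult_eq_0_imp [of d "p - q"] assms by simp

section \<open>Polynomial functions with polynomial coefficients\<close>

text \<open>Polynomials in parameters z_s with coefficients in k[gl_n], kept as functions of (z, x)
  so that they can be assembled by closure rules. The coefficients \<open>c \<alpha>\<close>
  obtained from it are what later turns into invariants. They lie in \<open>polys n\<close> for
  every \<alpha>, including those outside \<open>E\<close>, which spares side conditions.\<close>

definition param_poly :: "'a set \<Rightarrow> nat \<Rightarrow> (('a \<Rightarrow> 'k) \<Rightarrow> (nat \<Rightarrow> nat \<Rightarrow> 'k) \<Rightarrow> 'k::comm_ring_1) \<Rightarrow> bool" where
  "param_poly S n \<Phi> \<longleftrightarrow> (\<exists>E c. finite E \<and> E \<subseteq> exps S \<and> (\<forall>\<alpha>. c \<alpha> \<in> polys n) \<and>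
     (\<forall>z x. \<Phi> z x = (\<Sum>\<alpha>\<in>E. mpeval x (c \<alpha>) * (\<Prod>s\<in>S. z s ^ \<alpha> s))))"

lemma param_poly_monomial:
  assumes "c \<in> polys n" "\<gamma> \<in> exps S"
  shows "param_poly S n (\<lambda>z x. mpeval x c * (\<Prod>s\<in>S. z s ^ \<gamma> s))"
  unfolding param_poly_def
  by (rule exI [of _ "{\<gamma>}"], rule exI [of _ "\<lambda>_. c"]) (use assms in auto)

lemma param_poly_polys: "c \<in> polys n \<Longrightarrow> param_poly S n (\<lambda>z x. mpeval x c)"
  using param_poly_monomial [of c n "\<lambda>_. 0" S] by (simp add: exps_def)

lemma param_poly_const: "param_poly S n (\<lambda>z x. k)"
  using param_poly_polys [of "Cst k" n S] by simp

lemma param_poly_coord: "i \<in> {1..n} \<Longrightarrow> j \<in> {1..n} \<Longrightarrow> param_poly S n (\<lambda>z x. x i j)"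
  using param_poly_polys [of "Var i j" n S] by (simp add: polys_Var)

lemma param_poly_param:
  assumes "finite S" "s \<in> S"
  shows "param_poly S n (\<lambda>z x. z s :: 'k::comm_ring_1)"
proof -
  have "(\<Prod>s'\<in>S. z s' ^ (if s' = s then 1 else 0)) = (\<Prod>s'\<in>S. if s' = s then z s' else 1)" 
    for z :: "'a \<Rightarrow> 'k"
    by (intro prod.cong) auto
  then have eq: "(\<Prod>s'\<in>S. z s' ^ (if s' = s then 1 else 0)) = z s" for z :: "'a \<Rightarrow> 'k"
    using assms by simp
  have "(\<lambda>s'. if s' = s then 1 else 0) \<in> exps S"
    using assms(2) by (auto simp: exps_def)
  from param_poly_monomial [OF polys_1 this]
  have "param_poly S n (\<lambda>z x. mpeval x (1 :: 'k mpoly) * (\<Prod>s'\<in>S. z s' ^ (if s' = s then 1 else 0)))" .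
  then show ?thesis
    unfolding eq by simp
qed

lemma param_poly_add:
  assumes "param_poly S n \<Phi>" "param_poly S n \<Psi>"
  shows "param_poly S n (\<lambda>z x. \<Phi> z x + \<Psi> z x)"
proof -
  obtain E c where E: "finite E" "E \<subseteq> exps S" "\<forall>\<alpha>. c \<alpha> \<in> polys n"
    "\<And>z x. \<Phi> z x = (\<Sum>\<alpha>\<in>E. mpeval x (c \<alpha>) * (\<Prod>s\<in>S. z s ^ \<alpha> s))"
    using assms(1) unfolding param_poly_def by blast
  obtain F d where F: "finite F" "F \<subseteq> exps S" "\<forall>\<alpha>. d \<alpha> \<in> polys n"
    "\<And>z x. \<Psi> z x = (\<Sum>\<alpha>\<in>F. mpeval x (d \<alpha>) * (\<Prod>s\<in>S. z s ^ \<alpha> s))"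
    using assms(2) unfolding param_poly_def by blast
  define c' where "c' \<alpha> = (if \<alpha> \<in> E then c \<alpha> else 0)" for \<alpha>
  define d' where "d' \<alpha> = (if \<alpha> \<in> F then d \<alpha> else 0)" for \<alpha>
  have "\<Phi> z x = (\<Sum>\<alpha>\<in>E \<union> F. mpeval x (c' \<alpha>) * (\<Prod>s\<in>S. z s ^ \<alpha> s))" for z x
    unfolding E(4) using E(1) F(1) by (intro sum.mono_neutral_cong_left) (auto simp: c'_def)
  moreover have "\<Psi> z x = (\<Sum>\<alpha>\<in>E \<union> F. mpeval x (d' \<alpha>) * (\<Prod>s\<in>S. z s ^ \<alpha> s))" for z x
    unfolding F(4) using E(1) F(1) by (intro sum.mono_neutral_cong_left) (auto simp: d'_def)
  ultimately show ?thesis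
    unfolding param_poly_def
    by (intro exI [of _ "E \<union> F"] exI [of _ "\<lambda>\<alpha>. c' \<alpha> + d' \<alpha>"])
      (use E F in \<open>auto simp: sum.distrib distrib_right c'_def d'_def\<close>)
qed

lemma param_poly_sum:
  "(\<And>a. a \<in> A \<Longrightarrow> param_poly S n (\<Phi> a)) \<Longrightarrow> param_poly S n (\<lambda>z x. \<Sum>a\<in>A. \<Phi> a z x)"
  by (induction A rule: infinite_finite_induct) (auto simp: param_poly_const intro: param_poly_add)

lemma param_poly_mult:
  assumes "param_poly S n \<Phi>" "param_poly S n \<Psi>"
  shows "param_poly S n (\<lambda>z x. \<Phi> z x * \<Psi> z x)"
proof -
  obtain E c where E: "finite E" "E \<subseteq> exps S" "\<forall>\<alpha>. c \<alpha> \<in> polys n"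
    "\<And>z x. \<Phi> z x = (\<Sum>\<alpha>\<in>E. mpeval x (c \<alpha>) * (\<Prod>s\<in>S. z s ^ \<alpha> s))"
    using assms(1) unfolding param_poly_def by blast
  obtain F d where F: "finite F" "F \<subseteq> exps S" "\<forall>\<alpha>. d \<alpha> \<in> polys n"
    "\<And>z x. \<Psi> z x = (\<Sum>\<alpha>\<in>F. mpeval x (d \<alpha>) * (\<Prod>s\<in>S. z s ^ \<alpha> s))"
    using assms(2) unfolding param_poly_def by blast
  have "\<Phi> z x * \<Psi> z x = (\<Sum>\<alpha>\<in>E. \<Sum>\<beta>\<in>F. mpeval x (c \<alpha> * d \<beta>) * (\<Prod>s\<in>S. z s ^ (\<alpha> s + \<beta> s)))" for z x
    by (simp add: E(4) F(4) sum_product power_add prod.distrib mult_ac)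
  moreover have "param_poly S n (\<lambda>z x. \<Sum>\<alpha>\<in>E. \<Sum>\<beta>\<in>F. mpeval x (c \<alpha> * d \<beta>) * (\<Prod>s\<in>S. z s ^ (\<alpha> s + \<beta> s)))"
    using E F by (intro param_poly_sum param_poly_monomial [of _ _ "\<lambda>s. _ s + _ s"] polys_mult)
      (auto simp: exps_def subset_iff)
  ultimately show ?thesis by simp
qed

lemma param_poly_prod:
  "(\<And>a. a \<in> A \<Longrightarrow> param_poly S n (\<Phi> a)) \<Longrightarrow> param_poly S n (\<lambda>z x. \<Prod>a\<in>A. \<Phi> a z x)"
  by (induction A rule: infinite_finite_induct) (auto simp: param_poly_const intro: param_poly_mult)

lemma param_poly_power: "param_poly S n \<Phi> \<Longrightarrow> param_poly S n (\<lambda>z x. \<Phi> z x ^ k)"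
  by (induction k) (auto simp: param_poly_const intro: param_poly_mult)

lemma param_poly_mpeval:
  assumes "p \<in> polys n" "\<And>i j. i \<in> {1..n} \<Longrightarrow> j \<in> {1..n} \<Longrightarrow> param_poly S n (\<Phi> i j)"
  shows "param_poly S n (\<lambda>z x. mpeval (\<lambda>i j. \<Phi> i j z x) p)"
  unfolding mpeval_def using polys_vars [OF assms(1)]
  by (intro param_poly_sum param_poly_mult param_poly_prod param_poly_power param_poly_const assms(2))

section \<open>The coefficients of the characteristic polynomial and their gradients\<close>

text \<open>Variables are 1-based and matrix indices 0-based. Outside \<open>{1..n}\<close> the
  values are meaningless (truncated subtraction sends index 0 to row or column 0). This does no
  harm, since by \<open>mpeval_cong\<close> a polynomial in \<open>polys n\<close> sees only the
  square.\<close>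

definition entries :: "'k mat \<Rightarrow> nat \<Rightarrow> nat \<Rightarrow> 'k" where
  "entries A = (\<lambda>i j. A $$ (i - 1, j - 1))"

definition to_mat :: "nat \<Rightarrow> (nat \<Rightarrow> nat \<Rightarrow> 'k) \<Rightarrow> 'k mat" where
  "to_mat n x = mat n n (\<lambda>(i, j). x (Suc i) (Suc j))"

lemma to_mat_carrier [simp]: "to_mat n x \<in> carrier_mat n n" "dim_row (to_mat n x) = n" "dim_col (to_mat n x) = n"
  by (simp_all add: to_mat_def)

lemma to_mat_index [simp]: "i < n \<Longrightarrow> j < n \<Longrightarrow> to_mat n x $$ (i, j) = x (Suc i) (Suc j)"
  by (simp add: to_mat_def)

lemma to_mat_entries [simp]: "A \<in> carrier_mat n n \<Longrightarrow> to_mat n (entries A) = A"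
  by (intro eq_matI) (auto simp: entries_def)

lemma mpeval_entries_to_mat: "p \<in> polys n \<Longrightarrow> mpeval (entries (to_mat n x)) p = mpeval x p"
  by (rule mpeval_cong) (auto simp: entries_def)

lemma detm_eq_det:
  "length rs = m \<Longrightarrow> detm rs cs A = det (mat m m (\<lambda>(i, j). A (rs ! i) (cs ! j)))"
  unfolding detm_def
  by (subst det_def' [of _ m]) (auto simp: atLeast0LessThan permutes_in_image intro!: sum.cong prod.cong)

text \<open>The enumeration of \<open>S\<close> transports permutations of positions to permutations
  of \<open>S\<close> and preserves signs. In this form minors of all sizes can be found inside a
  single sum over permutations of \<open>{1..n}\<close>.\<close>

lemma detm_sorted_list:
  assumes "finite S"
  shows "detm (sorted_list_of_set S) (sorted_list_of_set S) A
    = (\<Sum>p | p permutes S. of_int (sign p) * (\<Prod>i\<in>S. A i (p i)))"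
proof -
  define f where "f = (!) (sorted_list_of_set S)"
  define m where "m = card S"
  let ?T = "map_permutation {..<m} f"
  have f: "bij_betw f {..<m} S"
    unfolding f_def m_def using assms by (intro bij_betw_nth) auto
  then have inj: "inj_on f {..<m}" and img: "f ` {..<m} = S"
    by (auto simp: bij_betw_def)
  have "bij_betw ?T {p. p permutes {..<m}} {p. p permutes S}"
  proof -
    have "?T = (\<lambda>\<pi> x. if x \<in> S then f (\<pi> (inv_into {..<m} f x)) else x)"
      by (auto simp: map_permutation_def restrict_id_def img fun_eq_iff)
    then show ?thesis using bij_betw_permutations [OF f] by simp
  qed
  then have "(\<Sum>p | p permutes S. of_int (sign p) * (\<Prod>i\<in>S. A i (p i)))
      = (\<Sum>p | p permutes {..<m}. of_int (sign (?T p)) * (\<Prod>i\<in>S. A i (?T p i)))"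
    by (rule sum.reindex_bij_betw [symmetric])
  also have "\<dots> = (\<Sum>p | p permutes {..<m}. of_int (sign p) * (\<Prod>a<m. A (f a) (f (p a))))"
  proof (rule sum.cong [OF refl])
    fix p assume "p \<in> {p. p permutes {..<m}}"
    then have "sign (?T p) = sign p"
      using inj by (intro sign_map_permutation) auto
    moreover have "(\<Prod>i\<in>S. A i (?T p i)) = (\<Prod>a<m. A (f a) (?T p (f a)))"
      by (rule prod.reindex_bij_betw [OF f, symmetric])
    moreover have "\<dots> = (\<Prod>a<m. A (f a) (f (p a)))"
      using map_permutation_apply [OF inj] by (intro prod.cong) auto
    ultimately show "of_int (sign (?T p)) * (\<Prod>i\<in>S. A i (?T p i))
        = of_int (sign p) * (\<Prod>a<m. A (f a) (f (p a)))"
      by simp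
  qed
  finally show ?thesis
    using assms by (simp add: detm_def f_def m_def)
qed

lemma sorted_list_of_set_1n: "sorted_list_of_set {1..n} = [1..<n + 1]"
  by (metis Suc_eq_plus1 atLeastLessThanSuc_atLeastAtMost sorted_list_of_set_range)

lemma det_to_mat:
  "det (to_mat n x) = (\<Sum>p | p permutes {1..n}. of_int (sign p) * (\<Prod>i\<in>{1..n}. x i (p i)))"
proof -
  have "det (to_mat n x) = detm [1..<n + 1] [1..<n + 1] x"
    unfolding to_mat_def
    by (subst detm_eq_det [of _ n]) (auto intro!: arg_cong [where f = det] eq_matI simp del: upt_Suc)
  then show ?thesis
    using detm_sorted_list [of "{1..n}" x] by (simp only: sorted_list_of_set_1n finite_atLeastAtMost)
qed

abbreviation s_val :: "nat \<Rightarrow> (nat \<Rightarrow> nat \<Rightarrow> 'k::comm_ring_1) \<Rightarrow> nat \<Rightarrow> 'k" where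
  "s_val n x j \<equiv> mpeval x (s_inv n j)"

lemma s_val_eq:
  "s_val n x j = (\<Sum>S | S \<subseteq> {1..n} \<and> card S = j. \<Sum>p | p permutes S. of_int (sign p) * (\<Prod>i\<in>S. x i (p i)))"
proof -
  have "s_inv n j = (\<Sum>S | S \<subseteq> {1..n} \<and> card S = j.
      \<Sum>p | p permutes S. of_int (sign p) * (\<Prod>i\<in>S. Var i (p i) :: 'a mpoly))"
    unfolding s_inv_def
    by (intro sum.cong refl detm_sorted_list) (auto intro: finite_subset)
  then show ?thesis by simp
qed

lemma permutes_fixing:
  assumes "X \<subseteq> N"
  shows "{p. p permutes N \<and> (\<forall>i\<in>N - X. p i = i)} = {p. p permutes X}"
  using assms by (auto intro: permutes_superset permutes_subset simp: permutes_not_in)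

text \<open>Expanding each product amounts to choosing the set X of rows that contribute an entry of
  x; the remaining rows contribute l and force p to fix them. So p permutes X, and grouping the X by
  cardinality gives the principal minors.\<close>

lemma det_add_scalar:
  "det (to_mat n (\<lambda>i j. x i j + (if i = j then l else 0))) = (\<Sum>j\<le>n. l ^ (n - j) * s_val n x j)"
proof -
  let ?N = "{1..n}"
  have "det (to_mat n (\<lambda>i j. x i j + (if i = j then l else 0)))
     = (\<Sum>p | p permutes ?N. of_int (sign p) * (\<Sum>X\<in>Pow ?N. (\<Prod>i\<in>X. x i (p i))
          * (\<Prod>i\<in>?N - X. if i = p i then l else 0)))"
    by (simp add: det_to_mat prod_add)
  also have "\<dots> = (\<Sum>p | p permutes ?N. \<Sum>X\<in>Pow ?N. if \<forall>i\<in>?N - X. p i = i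
        then l ^ (n - card X) * (of_int (sign p) * (\<Prod>i\<in>X. x i (p i))) else 0)"
  proof (intro sum.cong refl, unfold sum_distrib_left, intro sum.cong refl)
    fix p X assume X: "X \<in> Pow ?N"
    show "of_int (sign p) * ((\<Prod>i\<in>X. x i (p i)) * (\<Prod>i\<in>?N - X. if i = p i then l else 0))
      = (if \<forall>i\<in>?N - X. p i = i then l ^ (n - card X) * (of_int (sign p) * (\<Prod>i\<in>X. x i (p i))) else 0)"
    proof (cases "\<forall>i\<in>?N - X. p i = i")
      case True
      then have "(\<Prod>i\<in>?N - X. if i = p i then l else 0) = (\<Prod>i\<in>?N - X. l)"
        by (intro prod.cong) auto
      also have "\<dots> = l ^ (n - card X)"
        using X by (simp add: card_Diff_subset finite_subset)
      finally show ?thesis using True by (simp add: mult_ac)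
    next
      case False
      then obtain i where "i \<in> ?N - X" "p i \<noteq> i" by blast
      then have "(\<Prod>i\<in>?N - X. if i = p i then l else 0) = 0"
        by (intro prod_zero bexI [of _ i]) auto
      then show ?thesis unfolding if_not_P [OF False] by simp
    qed
  qed
  also have "\<dots> = (\<Sum>X\<in>Pow ?N. \<Sum>p | p permutes ?N. if \<forall>i\<in>?N - X. p i = i
        then l ^ (n - card X) * (of_int (sign p) * (\<Prod>i\<in>X. x i (p i))) else 0)"
    by (rule sum.swap)
  also have "\<dots> = (\<Sum>X\<in>Pow ?N. l ^ (n - card X) *
      (\<Sum>p | p permutes X. of_int (sign p) * (\<Prod>i\<in>X. x i (p i))))"
  proof (rule sum.cong [OF refl])
    fix X assume X: "X \<in> Pow ?N"
    have "(\<Sum>p | p permutes ?N. if \<forall>i\<in>?N - X. p i = i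
        then l ^ (n - card X) * (of_int (sign p) * (\<Prod>i\<in>X. x i (p i))) else 0)
      = (\<Sum>p\<in>{p. p permutes ?N \<and> (\<forall>i\<in>?N - X. p i = i)}.
          l ^ (n - card X) * (of_int (sign p) * (\<Prod>i\<in>X. x i (p i))))"
      by (rule sum.mono_neutral_cong_right) (auto simp: finite_permutations)
    then show "(\<Sum>p | p permutes ?N. if \<forall>i\<in>?N - X. p i = i
        then l ^ (n - card X) * (of_int (sign p) * (\<Prod>i\<in>X. x i (p i))) else 0)
       = l ^ (n - card X) * (\<Sum>p | p permutes X. of_int (sign p) * (\<Prod>i\<in>X. x i (p i)))"
      using X by (simp add: permutes_fixing sum_distrib_left)
  qed
  also have "\<dots> = (\<Sum>j\<le>n. \<Sum>X | X \<in> Pow ?N \<and> card X = j. l ^ (n - card X) *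
      (\<Sum>p | p permutes X. of_int (sign p) * (\<Prod>i\<in>X. x i (p i))))"
  proof (rule sum.group [symmetric])
    show "card ` Pow ?N \<subseteq> {..n}"
      using card_mono [of ?N] by fastforce
  qed auto
  also have "\<dots> = (\<Sum>j\<le>n. l ^ (n - j) * s_val n x j)"
    by (intro sum.cong refl) (simp add: s_val_eq sum_distrib_left)
  finally show ?thesis .
qed

lemma s_inv_polys [simp]: "s_inv n j \<in> polys n"
  unfolding s_inv_def
proof (intro polys_sum)
  fix S assume "S \<in> {S. S \<subseteq> {1..n} \<and> card S = j}"
  then have S: "S \<subseteq> {1..n}" "finite S" by (auto intro: finite_subset)
  have "p i \<in> {1..n}" if "p permutes S" "i \<in> S" for p i
    using that S(1) permutes_in_image [of p S i] by blast
  then show "detm (sorted_list_of_set S) (sorted_list_of_set S) Var \<in> polys n"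
    unfolding detm_sorted_list [OF S(2)]
    using S(1) by (intro polys_sum polys_mult polys_of_int polys_prod polys_Var) auto
qed

lemma polys_pdiff:
  assumes "p \<in> polys n"
  shows "pdiff v p \<in> polys n"
  unfolding pdiff_def
proof (intro polys_sum polys_single)
  fix m assume "m \<in> Poly_Mapping.keys p"
  then have "Poly_Mapping.keys m \<subseteq> {1..n} \<times> {1..n}"
    using assms by (simp add: polys_def)
  moreover have "Poly_Mapping.keys (m - Poly_Mapping.single v 1) \<subseteq> Poly_Mapping.keys m"
    by (auto simp: in_keys_iff lookup_minus)
  ultimately show "Poly_Mapping.keys (m - Poly_Mapping.single v 1) \<subseteq> {1..n} \<times> {1..n}" by blast
qed

text \<open>When v occurs at most linearly, the first-order Taylor expansion in v is exact, in every
  characteristic.\<close>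

lemma mpeval_shift:
  assumes ml: "\<And>m. m \<in> Poly_Mapping.keys p \<Longrightarrow> Poly_Mapping.lookup m v \<le> 1"
  shows "mpeval (\<lambda>i j. x i j + (if (i, j) = v then e else 0)) p = mpeval x p + e * mpeval x (pdiff v p)"
proof -
  let ?x = "\<lambda>i j. x i j + (if (i, j) = v then e else 0)"
  let ?v = "Poly_Mapping.single v 1 :: nat \<times> nat \<Rightarrow>\<^sub>0 nat"
  have away: "monev ?x m = monev x m" if "Poly_Mapping.lookup m v = 0" for m
    unfolding monev_def
  proof (rule prod.cong [OF refl])
    fix u assume "u \<in> Poly_Mapping.keys m"
    then have "u \<noteq> v" using that by (auto simp: in_keys_iff)
    then show "?x (fst u) (snd u) ^ Poly_Mapping.lookup m u = x (fst u) (snd u) ^ Poly_Mapping.lookup m u"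
      by simp
  qed
  have "monev ?x m = monev x m + e * (of_nat (Poly_Mapping.lookup m v) * monev x (m - ?v))"
    if "m \<in> Poly_Mapping.keys p" for m
  proof (cases "Poly_Mapping.lookup m v = 0")
    case True
    then show ?thesis by (simp add: away)
  next
    case False
    then have 1: "Poly_Mapping.lookup m v = 1" using ml [OF that] by simp
    define m' where "m' = m - ?v"
    have m: "m = m' + ?v"
      by (rule poly_mapping_eqI) (use 1 in \<open>auto simp: m'_def lookup_add lookup_minus lookup_single when_def\<close>)
    have "monev ?x m' = monev x m'"
      by (rule away) (simp add: m'_def lookup_minus 1)
    then show ?thesis
      unfolding m'_def [symmetric] 1 by (simp add: m monev_add monev_single algebra_simps)
  qed
  then show ?thesis
    by (simp add: mpeval_monev [of _ p] pdiff_def mpeval_single distrib_left sum.distrib sum_distrib_left mult_ac)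
qed

text \<open>A term of a minor takes one entry from each row, hence contains no variable
  twice.\<close>

lemma keys_s_inv_le_1:
  assumes "m \<in> Poly_Mapping.keys (s_inv n j :: 'k::comm_ring_1 mpoly)"
  shows "Poly_Mapping.lookup m v \<le> 1"
proof -
  define ml where "ml p \<longleftrightarrow> (\<forall>m\<in>Poly_Mapping.keys p. Poly_Mapping.lookup m v \<le> 1)" for p :: "'k mpoly"
  have add: "ml (p + q)" if "ml p" "ml q" for p q
    using that Poly_Mapping.keys_add [of p q] unfolding ml_def by blast
  have zero: "ml 0" by (simp add: ml_def)
  have sum: "ml (sum f A)" if "\<And>a. a \<in> A \<Longrightarrow> ml (f a)" for f :: "'a \<Rightarrow> 'k mpoly" and A
    using that by (induction A rule: infinite_finite_induct) (auto intro: add zero)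
  have Var_prod: "(\<Prod>i\<in>S. Var i (q i)) = Poly_Mapping.single (\<Sum>i\<in>S. Poly_Mapping.single (i, q i) 1) (1::'k)"
    for S q
    by (induction S rule: infinite_finite_induct) (auto simp: Var_def mult_single)
  have "Poly_Mapping.lookup (\<Sum>i\<in>S. Poly_Mapping.single (i, q i) (1::nat)) v \<le> 1" if "finite S" for S q
  proof -
    have "Poly_Mapping.lookup (\<Sum>i\<in>S. Poly_Mapping.single (i, q i) (1::nat)) v
        = (\<Sum>i\<in>S. if (i, q i) = v then 1 else 0 :: nat)"
      unfolding lookup_sum lookup_single when_def by (rule refl)
    also have "\<dots> \<le> (\<Sum>i\<in>S. if i = fst v then 1 else 0)"
      by (intro sum_mono) auto
    also have "\<dots> \<le> 1" using that by simp
    finally show ?thesis .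
  qed
  then have "ml (of_int k * (\<Prod>i\<in>S. Var i (q i)))" if "finite S" for k S q
    using that unfolding Var_prod
    by (subst single_of_int [of k, symmetric]) (simp add: ml_def mult_single del: single_of_int)
  then have "ml (detm (sorted_list_of_set S) (sorted_list_of_set S) Var)" if "finite S" for S
    unfolding detm_sorted_list [OF that] using that by (intro sum)
  then have "ml (s_inv n j)"
    unfolding s_inv_def by (intro sum) (auto intro: finite_subset)
  then show ?thesis using assms by (simp add: ml_def)
qed

text \<open>From here on a derivative of s_j is just a difference of two values of s_j, which can be
  studied through determinants.\<close>

lemma s_val_shift:
  "mpeval x (pdiff v (s_inv n j)) = s_val n (\<lambda>i j. x i j + (if (i, j) = v then 1 else 0)) j - s_val n x j"
  by (subst mpeval_shift, erule keys_s_inv_le_1) simp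

section \<open>Gradients as coefficients of the adjugate\<close>

abbreviation s_mat :: "nat \<Rightarrow> 'k::comm_ring_1 mat \<Rightarrow> nat \<Rightarrow> 'k" where
  "s_mat n A j \<equiv> s_val n (entries A) j"

text \<open>With l + A in place of l - A, the coefficient of l^(n-j) in the determinant is s_j
  without a sign.\<close>

definition shifted :: "nat \<Rightarrow> 'k::comm_ring_1 mat \<Rightarrow> 'k \<Rightarrow> 'k mat" where
  "shifted n A l = l \<cdot>\<^sub>m 1\<^sub>m n + A"

lemma shifted_carrier [simp]:
  assumes "A \<in> carrier_mat n n"
  shows "shifted n A l \<in> carrier_mat n n" "dim_row (shifted n A l) = n" "dim_col (shifted n A l) = n"
  using assms by (simp_all add: shifted_def)

lemma shifted_index: "A \<in> carrier_mat n n \<Longrightarrow> i < n \<Longrightarrow> j < n \<Longrightarrow>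
   shifted n A l $$ (i, j) = A $$ (i, j) + (if i = j then l else 0)"
  by (auto simp: shifted_def)

lemma det_shifted:
  assumes "A \<in> carrier_mat n n"
  shows "det (shifted n A l) = (\<Sum>j\<le>n. l ^ (n - j) * s_mat n A j)"
proof -
  have "shifted n A l = to_mat n (\<lambda>i j. entries A i j + (if i = j then l else 0))"
    using assms by (intro eq_matI) (auto simp: shifted_def entries_def)
  then show ?thesis by (simp only: det_add_scalar)
qed

text \<open>The indices are transposed with respect to those of the derivative, so that conjugating the
  argument conjugates the gradient.\<close>

definition grad :: "nat \<Rightarrow> 'k::comm_ring_1 mat \<Rightarrow> nat \<Rightarrow> 'k mat" where
  "grad n A j = mat n n (\<lambda>(a, b). mpeval (entries A) (pdiff (b + 1, a + 1) (s_inv n j)))"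

lemma grad_carrier [simp]: "grad n A j \<in> carrier_mat n n"
  "dim_row (grad n A j) = n" "dim_col (grad n A j) = n"
  by (simp_all add: grad_def)

text \<open>Adding 1 to the entry (b, a) changes a determinant by the cofactor at (b, a). The
  matrices A and B differ only in row b, so their cofactors along that row agree and the two row
  expansions can be subtracted.\<close>

lemma cofactor_shifted:
  assumes A: "A \<in> carrier_mat n n" and ab: "a < n" "b < n"
  shows "cofactor (shifted n A l) b a = (\<Sum>j\<le>n. l ^ (n - j) * grad n A j $$ (a, b))"
proof -
  let ?x = "\<lambda>i j. entries A i j + (if (i, j) = (b + 1, a + 1) then 1 else 0)"
  define B where "B = to_mat n ?x"
  have B: "B \<in> carrier_mat n n" by (simp add: B_def)
  have "mpeval (entries B) (s_inv n j) = mpeval ?x (s_inv n j)" for j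
    unfolding B_def by (rule mpeval_entries_to_mat) simp
  then have "(\<Sum>j\<le>n. l ^ (n - j) * grad n A j $$ (a, b)) = det (shifted n B l) - det (shifted n A l)"
    using ab by (simp add: grad_def s_val_shift det_shifted [OF A] det_shifted [OF B] right_diff_distrib sum_subtractf)
  also have "\<dots> = (\<Sum>j<n. shifted n B l $$ (b, j) * cofactor (shifted n B l) b j)
      - (\<Sum>j<n. shifted n A l $$ (b, j) * cofactor (shifted n A l) b j)"
    using A B ab by (simp add: laplace_expansion_row [of _ n b])
  also have "\<dots> = (\<Sum>j<n. (shifted n B l $$ (b, j) - shifted n A l $$ (b, j)) * cofactor (shifted n A l) b j)"
  proof -
    have "mat_delete (shifted n B l) b j = mat_delete (shifted n A l) b j" for j
      using A B by (intro eq_matI) (auto simp: mat_delete_def shifted_def B_def entries_def)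
    then have "cofactor (shifted n B l) b j = cofactor (shifted n A l) b j" for j
      by (simp add: cofactor_def)
    then show ?thesis by (simp add: left_diff_distrib sum_subtractf)
  qed
  also have "\<dots> = (\<Sum>j<n. if j = a then cofactor (shifted n A l) b j else 0)"
    using A ab by (intro sum.cong refl) (auto simp: shifted_def B_def entries_def)
  finally show ?thesis using ab by simp
qed

lemma coeff_sum_monom_rev:
  assumes "k \<le> n"
  shows "coeff (\<Sum>j\<le>n. monom (f j) (n - j)) k = f (n - k)"
proof -
  have "coeff (\<Sum>j\<le>n. monom (f j) (n - j)) k = (\<Sum>j\<le>n. if j = n - k then f j else 0)"
    unfolding coeff_sum using assms by (intro sum.cong) auto
  then show ?thesis by simp
qed

lemma poly_eqI_infinite:
  fixes P Q :: "'k::field poly"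
  assumes "infinite (UNIV :: 'k set)" "\<And>l. poly P l = poly Q l"
  shows "P = Q"
  using poly_eq_0_if_zero_off_0 [of "P - Q"] assms by simp

text \<open>Compare coefficients of l in (l + A) adj(l + A) = det(l + A); by cofactor expansion the
  coefficients of adj(l + A) are the gradients. The last equation is Cayley-Hamilton.\<close>

lemma grad_rec:
  fixes A :: "'k::field mat"
  assumes inf: "infinite (UNIV :: 'k set)" and A: "A \<in> carrier_mat n n"
  shows "grad n A 0 = 0\<^sub>m n n"
    and "j < n \<Longrightarrow> grad n A (Suc j) = s_mat n A j \<cdot>\<^sub>m 1\<^sub>m n - A * grad n A j"
    and "A * grad n A n = s_mat n A n \<cdot>\<^sub>m 1\<^sub>m n"
proof -
  define P where "P a b = (\<Sum>j\<le>n. monom (grad n A j $$ (a, b)) (n - j))" for a b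
  define Q where "Q a b = (\<Sum>j\<le>n. monom ((A * grad n A j) $$ (a, b)) (n - j))" for a b
  define R where "R a b = (\<Sum>j\<le>n. monom (if a = b then s_mat n A j else 0) (n - j))" for a b :: nat
  have *: "pCons 0 (P a b) + Q a b = R a b" if ab: "a < n" "b < n" for a b
  proof (rule poly_eqI_infinite [OF inf])
    fix l
    have poly_P: "poly (P a b) l = adj_mat (shifted n A l) $$ (a, b)" if "a < n" "b < n" for a b
      using that A by (simp add: P_def poly_sum poly_monom adj_mat_def cofactor_shifted mult.commute)
    have adj: "adj_mat (shifted n A l) \<in> carrier_mat n n"
      using A adj_mat(1) shifted_carrier by blast
    have "poly (Q a b) l = (\<Sum>c<n. A $$ (a, c) * poly (P c b) l)"
      unfolding Q_def P_def poly_sum poly_monom sum_distrib_left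
      using A ab by (subst sum.swap) (auto simp: scalar_prod_def atLeast0LessThan sum_distrib_left mult_ac intro!: sum.cong)
    then have "poly (pCons 0 (P a b) + Q a b) l = l * adj_mat (shifted n A l) $$ (a, b)
        + (\<Sum>c<n. A $$ (a, c) * adj_mat (shifted n A l) $$ (c, b))"
      using ab by (simp add: poly_P)
    also have "\<dots> = (shifted n A l * adj_mat (shifted n A l)) $$ (a, b)"
    proof -
      have "(shifted n A l * adj_mat (shifted n A l)) $$ (a, b)
          = (\<Sum>c<n. (A $$ (a, c) + (if a = c then l else 0)) * adj_mat (shifted n A l) $$ (c, b))"
        using A ab adj by (auto simp: scalar_prod_def atLeast0LessThan shifted_def intro!: sum.cong)
      also have "\<dots> = (\<Sum>c<n. A $$ (a, c) * adj_mat (shifted n A l) $$ (c, b))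
          + (\<Sum>c<n. if a = c then l * adj_mat (shifted n A l) $$ (c, b) else 0)"
        by (simp add: distrib_right sum.distrib if_distrib [of "\<lambda>u. u * _"] cong: if_cong)
      finally show ?thesis using ab by simp
    qed
    also have "\<dots> = (if a = b then det (shifted n A l) else 0)"
      using A ab by (subst adj_mat(2) [of _ n]) auto
    also have "\<dots> = poly (R a b) l"
      by (simp add: R_def poly_sum poly_monom det_shifted [OF A] mult.commute)
    finally show "poly (pCons 0 (P a b) + Q a b) l = poly (R a b) l" .
  qed
  have Q: "coeff (Q a b) (n - j) = (A * grad n A j) $$ (a, b)"
    and R: "coeff (R a b) (n - j) = (if a = b then s_mat n A j else 0)"
    and P: "coeff (P a b) (n - j) = grad n A j $$ (a, b)" if "j \<le> n" for a b j
    using that by (simp_all add: Q_def R_def P_def coeff_sum_monom_rev)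
  show "grad n A 0 = 0\<^sub>m n n"
  proof (rule eq_matI)
    fix a b assume "a < dim_row (0\<^sub>m n n :: 'k mat)" "b < dim_col (0\<^sub>m n n :: 'k mat)"
    then have ab: "a < n" "b < n" by auto
    \<comment> \<open>\<open>R\<close> and \<open>Q\<close> have degree at most n, while
      \<open>pCons 0\<close> lifts the leading coefficient of \<open>P\<close> to degree n + 1;
      hence this coefficient, the entry of \<open>grad n A 0\<close>, is 0.\<close>
    have "coeff (R a b) (Suc n) = 0" "coeff (Q a b) (Suc n) = 0"
      unfolding R_def Q_def coeff_sum by (auto intro!: sum.neutral)
    then have "coeff (P a b) n = 0"
      using arg_cong [OF * [OF ab], of "\<lambda>p. coeff p (Suc n)"] by simp
    then show "grad n A 0 $$ (a, b) = 0\<^sub>m n n $$ (a, b)"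
      using P [of 0 a b] ab by simp
  qed auto
  show "grad n A (Suc j) = s_mat n A j \<cdot>\<^sub>m 1\<^sub>m n - A * grad n A j" if j: "j < n"
  proof (rule eq_matI)
    fix a b 
    assume "a < dim_row (s_mat n A j \<cdot>\<^sub>m 1\<^sub>m n - A * grad n A j)" "b < dim_col (s_mat n A j \<cdot>\<^sub>m 1\<^sub>m n - A * grad n A j)"
    then have ab: "a < n" "b < n" using A by auto
    have "n - j = Suc (n - Suc j)" using j by simp
    then have "coeff (P a b) (n - Suc j) + coeff (Q a b) (n - j) = coeff (R a b) (n - j)"
      using arg_cong [OF * [OF ab], of "\<lambda>p. coeff p (n - j)"] by simp
    then show "grad n A (Suc j) $$ (a, b) = (s_mat n A j \<cdot>\<^sub>m 1\<^sub>m n - A * grad n A j) $$ (a, b)"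
      using P [of "Suc j" a b] Q [of j a b] R [of j a b] j ab A
      by (simp add: eq_diff_eq del: index_mult_mat(1))
  qed (use A in auto)
  show "A * grad n A n = s_mat n A n \<cdot>\<^sub>m 1\<^sub>m n"
  proof (rule eq_matI)
    fix a b assume "a < dim_row (s_mat n A n \<cdot>\<^sub>m 1\<^sub>m n)" "b < dim_col (s_mat n A n \<cdot>\<^sub>m 1\<^sub>m n)"
    then have ab: "a < n" "b < n" by auto
    \<comment> \<open>In degree 0 the shifted polynomial \<open>pCons 0 (P a b)\<close> contributes
      nothing.\<close>
    have "coeff (Q a b) 0 = coeff (R a b) 0"
      using arg_cong [OF * [OF ab], of "\<lambda>p. coeff p 0"] by simp
    then show "(A * grad n A n) $$ (a, b) = (s_mat n A n \<cdot>\<^sub>m 1\<^sub>m n) $$ (a, b)"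
      using Q [of n a b] R [of n a b] ab A by (simp del: index_mult_mat(1))
  qed (use A in auto)
qed

declare assoc_mult_mat [simp del] index_mult_mat(1) [simp del]

section \<open>Behaviour under conjugation\<close>

lemma mult_square_carrier [simp, intro]:
  "A \<in> carrier_mat n n \<Longrightarrow> B \<in> carrier_mat n n \<Longrightarrow> A * B \<in> carrier_mat n n"
  by (rule mult_carrier_mat)

text \<open>The s_j are the coefficients of det(l + A) as a polynomial in l, so over an infinite
  field they are determined by its values. Invariance of s_j thus reduces to invariance of
  determinants.\<close>

lemma s_mat_eqI:
  fixes A B :: "'k::field mat"
  assumes inf: "infinite (UNIV :: 'k set)" and A: "A \<in> carrier_mat n n" and B: "B \<in> carrier_mat n n"
    and det: "\<And>l. det (shifted n A l) = det (shifted n B l)" and j: "j \<le> n"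
  shows "s_mat n A j = s_mat n B j"
proof -
  define P where "P A = (\<Sum>j\<le>n. monom (s_mat n A j) (n - j))" for A :: "'k mat"
  have "P A = P B"
    using det A B by (intro poly_eqI_infinite [OF inf])
      (simp add: P_def poly_sum poly_monom det_shifted mult.commute)
  then have "coeff (P A) (n - j) = coeff (P B) (n - j)" by simp
  then show ?thesis
    using j by (simp add: P_def coeff_sum_monom_rev)
qed

lemma mat_conj_cancel:
  fixes A B a b :: "'k::comm_ring_1 mat"
  assumes "A \<in> carrier_mat n n" "B \<in> carrier_mat n n" "a \<in> carrier_mat n n" "b \<in> carrier_mat n n" "b * a = 1\<^sub>m n"
  shows "(a * A * b) * (a * B * b) = a * (A * B) * b"
proof -
  have "(a * A * b) * (a * B * b) = a * A * (b * a) * B * b"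
    using assms(1-4) by (simp add: assoc_mult_mat [of _ n n _ n _ n])
  also have "\<dots> = a * (A * B) * b"
    using assms by (simp add: assoc_mult_mat [of _ n n _ n _ n])
  finally show ?thesis .
qed

lemma shifted_conj:
  assumes "A \<in> carrier_mat n n" "a \<in> carrier_mat n n" "b \<in> carrier_mat n n" "a * b = 1\<^sub>m n"
  shows "shifted n (a * A * b) l = a * shifted n A l * b"
proof -
  have "a * shifted n A l * b = a * (l \<cdot>\<^sub>m 1\<^sub>m n) * b + a * A * b"
    using assms(1-3) by (simp add: shifted_def mult_add_distrib_mat [of _ n n _ n] add_mult_distrib_mat [of _ n n _ _ n])
  also have "a * (l \<cdot>\<^sub>m 1\<^sub>m n) * b = l \<cdot>\<^sub>m (a * b)"
    using assms(2,3) by (simp add: mult_smult_distrib [of _ n n _ n] mult_smult_assoc_mat [of _ n n _ n])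
  finally show ?thesis using assms(4) by (simp add: shifted_def)
qed

lemma det_conj:
  fixes A a b :: "'k::comm_ring_1 mat"
  assumes "A \<in> carrier_mat n n" "a \<in> carrier_mat n n" "b \<in> carrier_mat n n" "a * b = 1\<^sub>m n"
  shows "det (a * A * b) = det A"
proof -
  have "det (a * A * b) = det a * det b * det A"
    using assms(1-3) by (simp add: det_mult [of _ n] mult_ac)
  also have "det a * det b = 1"
    using det_mult [OF assms(2,3)] assms(4) by simp
  finally show ?thesis by simp
qed

lemma s_mat_conj:
  fixes A :: "'k::field mat"
  assumes inf: "infinite (UNIV :: 'k set)"
    and "A \<in> carrier_mat n n" "a \<in> carrier_mat n n" "b \<in> carrier_mat n n" "a * b = 1\<^sub>m n" "j \<le> n"
  shows "s_mat n (a * A * b) j = s_mat n A j"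
  using assms by (intro s_mat_eqI [OF inf]) (simp_all add: shifted_conj det_conj [of _ n])

text \<open>Induction along the recursion of \<open>grad_rec\<close>, every ingredient of which is
  compatible with conjugation. This replaces the chain rule.\<close>

lemma grad_conj:
  fixes A :: "'k::field mat"
  assumes inf: "infinite (UNIV :: 'k set)"
    and A: "A \<in> carrier_mat n n" and a: "a \<in> carrier_mat n n" and b: "b \<in> carrier_mat n n"
    and ab: "a * b = 1\<^sub>m n" "b * a = 1\<^sub>m n" and j: "j \<le> n"
  shows "grad n (a * A * b) j = a * grad n A j * b"
  using j
proof (induction j)
  case 0
  then show ?case using A a b by (simp add: grad_rec(1) [OF inf])
next
  case (Suc j)
  then have j: "j < n" and IH: "grad n (a * A * b) j = a * grad n A j * b" by auto
  have C: "a * A * b \<in> carrier_mat n n" using A a b by auto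
  have "grad n (a * A * b) (Suc j) = s_mat n (a * A * b) j \<cdot>\<^sub>m 1\<^sub>m n - (a * A * b) * (a * grad n A j * b)"
    unfolding grad_rec(2) [OF inf C j] IH ..
  also have "(a * A * b) * (a * grad n A j * b) = a * (A * grad n A j) * b"
    using A a b ab by (intro mat_conj_cancel) auto
  also have "s_mat n (a * A * b) j = s_mat n A j"
    using A a b ab j by (intro s_mat_conj [OF inf]) auto
  also have "s_mat n A j \<cdot>\<^sub>m 1\<^sub>m n = a * (s_mat n A j \<cdot>\<^sub>m 1\<^sub>m n) * b"
    using a b ab by (simp add: mult_smult_distrib [of _ n n _ n] mult_smult_assoc_mat [of _ n n _ n])
  also have "a * (s_mat n A j \<cdot>\<^sub>m 1\<^sub>m n) * b - a * (A * grad n A j) * b = a * (s_mat n A j \<cdot>\<^sub>m 1\<^sub>m n - A * grad n A j) * b"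
    using A a b by (simp add: mult_minus_distrib_mat [of _ n n _ n] minus_mult_distrib_mat [of _ n n _ _ n])
  also have "\<dots> = a * grad n A (Suc j) * b"
    by (simp add: grad_rec(2) [OF inf A j])
  finally show ?case .
qed

section \<open>The cyclic basis attached to the first basis vector\<close>

text \<open>Column j is M_{j+1} e_1, which is (-A)^j e_1 plus a combination of lower powers of A
  applied to e_1: a basis exactly when e_1 is cyclic. Its entry (i, j) is the derivative of s_{j+1}
  by the variable with index (1, i+1), so that its minors in the last rows are the u_{t,I}.\<close>

definition krylov :: "nat \<Rightarrow> 'k::comm_ring_1 mat \<Rightarrow> 'k mat" where
  "krylov n A = mat n n (\<lambda>(i, j). grad n A (Suc j) $$ (i, 0))"

lemma krylov_carrier [simp]: "krylov n A \<in> carrier_mat n n" "dim_row (krylov n A) = n" "dim_col (krylov n A) = n"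
  by (simp_all add: krylov_def)

definition fixes_e1 :: "nat \<Rightarrow> 'k::comm_ring_1 mat \<Rightarrow> bool" where
  "fixes_e1 n a \<longleftrightarrow> a \<in> carrier_mat n n \<and> (\<forall>i<n. a $$ (i, 0) = (if i = 0 then 1 else 0))"

lemma fixes_e1_carrier: "fixes_e1 n a \<Longrightarrow> a \<in> carrier_mat n n"
  by (simp add: fixes_e1_def)

lemma mult_mat_index:
  "A \<in> carrier_mat n n \<Longrightarrow> B \<in> carrier_mat n n \<Longrightarrow> i < n \<Longrightarrow> j < n \<Longrightarrow>
    (A * B) $$ (i, j) = (\<Sum>k<n. A $$ (i, k) * B $$ (k, j))"
  by (auto simp: index_mult_mat(1) scalar_prod_def atLeast0LessThan intro!: sum.cong)

lemma mult_fixes_e1_index: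
  assumes "A \<in> carrier_mat n n" "fixes_e1 n b" "i < n"
  shows "(A * b) $$ (i, 0) = A $$ (i, 0)"
proof -
  have "(A * b) $$ (i, 0) = (\<Sum>k<n. A $$ (i, k) * b $$ (k, 0))"
    using assms by (intro mult_mat_index) (auto simp: fixes_e1_def)
  also have "\<dots> = (\<Sum>k<n. if k = 0 then A $$ (i, 0) else 0)"
    using assms by (intro sum.cong) (auto simp: fixes_e1_def)
  finally show ?thesis using assms(3) by simp
qed

lemma fixes_e1_mult: "fixes_e1 n a \<Longrightarrow> fixes_e1 n b \<Longrightarrow> fixes_e1 n (a * b)"
  unfolding fixes_e1_def by (metis fixes_e1_def mult_carrier_mat mult_fixes_e1_index)

lemma fixes_e1_1 [simp]: "fixes_e1 n (1\<^sub>m n)"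
  by (auto simp: fixes_e1_def)

lemma fixes_e1_inverse:
  assumes "fixes_e1 n a" "b \<in> carrier_mat n n" "b * a = 1\<^sub>m n"
  shows "fixes_e1 n b"
proof -
  have "b $$ (i, 0) = (1\<^sub>m n :: 'a mat) $$ (i, 0)" if "i < n" for i
    using mult_fixes_e1_index [OF assms(2,1) that] assms(3) by simp
  then show ?thesis using assms(2) by (auto simp: fixes_e1_def)
qed

lemma fixes_e1_krylov:
  fixes A :: "'k::field mat"
  assumes "infinite (UNIV :: 'k set)" "A \<in> carrier_mat n n" "n > 0" 
  shows "fixes_e1 n (krylov n A)"
proof -
  \<comment> \<open>The empty minor gives s_0 = 1; hence M_1 = 1, and column 0 of the cyclic basis
    is e_1.\<close>
  have "{S. S \<subseteq> {1..n} \<and> card S = 0} = {{}}" 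
    by (auto simp: card_eq_0_iff dest: finite_subset)
  then have "s_mat n A 0 = 1"
    by (simp add: s_val_eq)
  then show ?thesis using grad_rec(2) [OF assms(1,2), of 0] assms
    by (auto simp: fixes_e1_def krylov_def grad_rec(1))
qed

text \<open>M_j(a A a^{-1}) e_1 = a M_j(A) a^{-1} e_1, and a^{-1} fixes e_1 along with a. By this
  equivariance the cyclic basis can be moved to any prescribed matrix with first column e_1.\<close>

lemma krylov_conj:
  fixes A :: "'k::field mat"
  assumes inf: "infinite (UNIV :: 'k set)" and A: "A \<in> carrier_mat n n"
    and a: "fixes_e1 n a" and b: "b \<in> carrier_mat n n" and ab: "a * b = 1\<^sub>m n" "b * a = 1\<^sub>m n"
  shows "krylov n (a * A * b) = a * krylov n A"
proof (rule eq_matI)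
  fix i j assume "i < dim_row (a * krylov n A)" "j < dim_col (a * krylov n A)"
  then have ij: "i < n" "j < n" using a by (auto simp: fixes_e1_def)
  have a': "a \<in> carrier_mat n n" using a by (rule fixes_e1_carrier)
  have "fixes_e1 n b" using a b ab(2) by (rule fixes_e1_inverse)
  then have "(a * grad n A (Suc j) * b) $$ (i, 0) = (a * grad n A (Suc j)) $$ (i, 0)"
    using a' ij by (intro mult_fixes_e1_index) auto
  also have "\<dots> = (\<Sum>k<n. a $$ (i, k) * krylov n A $$ (k, j))"
    using ij a' by (subst mult_mat_index [of _ n]) (auto simp: krylov_def)
  also have "\<dots> = (a * krylov n A) $$ (i, j)"
    using ij a' by (subst mult_mat_index [of _ n]) auto
  finally show "krylov n (a * A * b) $$ (i, j) = (a * krylov n A) $$ (i, j)"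
    using ij a' b A ab by (subst krylov_def) (simp add: grad_conj [OF inf])
qed (use a in \<open>auto simp: fixes_e1_def\<close>)

text \<open>The matrix of A in its cyclic basis, read off from A M_{j+1} e_1 = s_{j+1} e_1 - M_{j+2}
  e_1; in the last column the second term is missing.\<close>

definition companion :: "nat \<Rightarrow> (nat \<Rightarrow> 'k::comm_ring_1) \<Rightarrow> 'k mat" where
  "companion n s = mat n n (\<lambda>(i, j). (if i = 0 then s (Suc j) else 0) - (if i = Suc j then 1 else 0))"

lemma companion_carrier [simp]: "companion n s \<in> carrier_mat n n" "dim_row (companion n s) = n" "dim_col (companion n s) = n"
  by (simp_all add: companion_def)

lemma krylov_companion:
  fixes A :: "'k::field mat"
  assumes inf: "infinite (UNIV :: 'k set)" and A: "A \<in> carrier_mat n n" and n: "n > 0"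
  shows "A * krylov n A = krylov n A * companion n (s_mat n A)"
proof (rule eq_matI)
  fix i j assume "i < dim_row (krylov n A * companion n (s_mat n A))" "j < dim_col (krylov n A * companion n (s_mat n A))"
  then have ij: "i < n" "j < n" by auto
  have e: "krylov n A $$ (i, 0) = (if i = 0 then 1 else 0)"
    using fixes_e1_krylov [OF inf A n] ij by (simp add: fixes_e1_def)
  have "(krylov n A * companion n (s_mat n A)) $$ (i, j) = (\<Sum>k<n. krylov n A $$ (i, k) *
      ((if k = 0 then s_mat n A (Suc j) else 0) - (if k = Suc j then 1 else 0)))"
    using ij by (subst mult_mat_index [of _ n]) (auto simp: companion_def)
  also have "\<dots> = (\<Sum>k<n. (if k = 0 then krylov n A $$ (i, k) * s_mat n A (Suc j) else 0))
      - (\<Sum>k<n. if k = Suc j then krylov n A $$ (i, k) else 0)"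
    unfolding sum_subtractf [symmetric] by (intro sum.cong refl) (auto simp: right_diff_distrib)
  also have "\<dots> = (if i = 0 then s_mat n A (Suc j) else 0) - (if Suc j < n then krylov n A $$ (i, Suc j) else 0)"
    using n e by simp
  also have "\<dots> = (A * grad n A (Suc j)) $$ (i, 0)"
  proof (cases "Suc j < n")
    case True
    then have "grad n A (Suc (Suc j)) $$ (i, 0) = (s_mat n A (Suc j) \<cdot>\<^sub>m 1\<^sub>m n - A * grad n A (Suc j)) $$ (i, 0)"
      using grad_rec(2) [OF inf A True] by simp
    also have "\<dots> = (if i = 0 then s_mat n A (Suc j) else 0) - (A * grad n A (Suc j)) $$ (i, 0)"
      using A ij n by (subst index_minus_mat) (auto simp del: index_mult_mat(1))
    finally show ?thesis using True ij by (simp add: krylov_def)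
  next
    \<comment> \<open>For the last column Cayley-Hamilton, A M_n = s_n, takes the place of the
      recursion.\<close>
    case False
    then have "Suc j = n" using ij by simp
    then show ?thesis using grad_rec(3) [OF inf A] ij by simp
  qed
  also have "\<dots> = (\<Sum>k<n. A $$ (i, k) * krylov n A $$ (k, j))"
    using ij A by (subst mult_mat_index [of _ n]) (auto simp: krylov_def)
  also have "\<dots> = (A * krylov n A) $$ (i, j)"
    using ij A by (subst mult_mat_index [of _ n]) auto
  finally show "(A * krylov n A) $$ (i, j) = (krylov n A * companion n (s_mat n A)) $$ (i, j)" ..
qed (use A in auto)

text \<open>For this nilpotent matrix all s_j with j > 0 vanish, and the recursion just shifts basis
  vectors. It is the base point at which \<open>krylov_det\<close> is non-zero; together with
  \<open>krylov_conj\<close> it yields matrices with prescribed cyclic basis.\<close>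

lemma krylov_shift:
  fixes A :: "'k::field mat"
  assumes inf: "infinite (UNIV :: 'k set)" and n: "n > 0"
  defines "A \<equiv> companion n (\<lambda>_. 0) :: 'k mat"
  shows "krylov n A = 1\<^sub>m n"
proof -
  have A: "A \<in> carrier_mat n n" by (simp add: A_def)
  have det: "det (shifted n A l) = l ^ n" for l
  proof -
    have "det (shifted n A l) = prod_list (diag_mat (shifted n A l))"
      by (rule det_lower_triangular [of n]) (auto simp: shifted_index A_def companion_def)
    also have "diag_mat (shifted n A l) = map (\<lambda>_. l) [0..<n]"
      unfolding diag_mat_def by (rule map_cong) (auto simp: shifted_index A_def companion_def)
    finally show ?thesis by (simp add: map_replicate_const)
  qed
  have s: "s_mat n A j = (if j = 0 then 1 else 0)" if "j \<le> n" for j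
  proof -
    have "(\<Sum>j\<le>n. monom (s_mat n A j) (n - j)) = monom 1 n"
      by (rule poly_eqI_infinite [OF inf])
        (simp add: poly_sum poly_monom mult.commute flip: det_shifted [OF A], simp add: det)
    then have "coeff (\<Sum>j\<le>n. monom (s_mat n A j) (n - j)) (n - j) = coeff (monom 1 n) (n - j)" by simp
    then show ?thesis using that n by (subst (asm) coeff_sum_monom_rev) (auto split: if_splits)
  qed
  have "krylov n A $$ (i, j) = (if i = j then 1 else 0)" if "j < n" "i < n" for i j
    using that
  proof (induction j arbitrary: i)
    case 0
    then show ?case using fixes_e1_krylov [OF inf A n] by (simp add: fixes_e1_def)
  next
    case (Suc j)
    then have j: "Suc j < n" "i < n" by auto
    have "krylov n A $$ (i, Suc j) = (s_mat n A (Suc j) \<cdot>\<^sub>m 1\<^sub>m n - A * grad n A (Suc j)) $$ (i, 0)"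
      using grad_rec(2) [OF inf A j(1)] j by (simp add: krylov_def)
    also have "\<dots> = - (A * grad n A (Suc j)) $$ (i, 0)"
      using A j s [of "Suc j"] by (subst index_minus_mat) (auto simp del: index_mult_mat(1))
    also have "\<dots> = - (\<Sum>k<n. A $$ (i, k) * krylov n A $$ (k, j))"
      using j A by (subst mult_mat_index [of _ n]) (auto simp: krylov_def)
    also have "(\<Sum>k<n. A $$ (i, k) * krylov n A $$ (k, j)) = (\<Sum>k<n. if k = j then A $$ (i, k) else 0)"
      using Suc by (intro sum.cong) auto
    also have "\<dots> = (if i = Suc j then - 1 else 0)"
      using j by (simp add: A_def companion_def)
    finally show ?case by simp
  qed
  then show ?thesis by (intro eq_matI) auto
qed

section \<open>Invariants as functions on matrices\<close>

lemma to_mat_index_1: "i \<in> {1..n} \<Longrightarrow> j \<in> {1..n} \<Longrightarrow> to_mat n x $$ (i - 1, j - 1) = x i j"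
  by (cases i; cases j) auto

abbreviation mev :: "'k::comm_ring_1 mat \<Rightarrow> 'k mpoly \<Rightarrow> 'k" where
  "mev A p \<equiv> mpeval (entries A) p"

lemma to_mat_mmul: "to_mat n (mmul n x y) = to_mat n x * to_mat n y"
proof (rule eq_matI)
  fix i j assume "i < dim_row (to_mat n x * to_mat n y)" "j < dim_col (to_mat n x * to_mat n y)"
  then have ij: "i < n" "j < n" by auto
  have "(to_mat n x * to_mat n y) $$ (i, j) = (\<Sum>k<n. x (Suc i) (Suc k) * y (Suc k) (Suc j))"
    using ij by (subst mult_mat_index [of _ n]) auto
  also have "\<dots> = (\<Sum>l=1..n. x (Suc i) l * y l (Suc j))"
    by (rule sum.reindex_bij_witness [of _ "\<lambda>l. l - 1" Suc]) auto
  finally show "to_mat n (mmul n x y) $$ (i, j) = (to_mat n x * to_mat n y) $$ (i, j)"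
    using ij by (simp add: mmul_def)
qed auto

lemma mpeval_mmul:
  assumes "f \<in> polys n"
  shows "mpeval (mmul n (mmul n h x) g) f = mev (to_mat n h * to_mat n x * to_mat n g) f"
  using mpeval_entries_to_mat [OF assms, of "mmul n (mmul n h x) g"] by (simp add: to_mat_mmul)

lemma to_mat_idm: "to_mat n idm = 1\<^sub>m n"
  by (intro eq_matI) (auto simp: idm_def)

lemma is_inverse_to_mat: "is_inverse n g h \<longleftrightarrow> to_mat n g * to_mat n h = 1\<^sub>m n \<and> to_mat n h * to_mat n g = 1\<^sub>m n"
proof -
  have eq: "to_mat n x = to_mat n y \<longleftrightarrow> (\<forall>i\<in>{1..n}. \<forall>j\<in>{1..n}. x i j = y i j)" for x y :: "nat \<Rightarrow> nat \<Rightarrow> 'a"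
  proof
    assume e: "to_mat n x = to_mat n y"
    show "\<forall>i\<in>{1..n}. \<forall>j\<in>{1..n}. x i j = y i j"
    proof (intro ballI)
      fix i j assume "i \<in> {1..n}" "j \<in> {1..n}"
      then show "x i j = y i j"
        using e to_mat_index_1 by metis
    qed
  qed (auto intro!: eq_matI)
  show ?thesis
    unfolding is_inverse_def to_mat_idm [symmetric] to_mat_mmul [symmetric] eq by blast
qed

lemma invG_iff:
  "f \<in> invG n \<longleftrightarrow> f \<in> polys n \<and> (\<forall>a b A. a \<in> carrier_mat n n \<longrightarrow> b \<in> carrier_mat n n \<longrightarrow> A \<in> carrier_mat n n \<longrightarrow>
     a * b = 1\<^sub>m n \<longrightarrow> b * a = 1\<^sub>m n \<longrightarrow> mev (a * A * b) f = mev A f)" (is "_ \<longleftrightarrow> _ \<and> ?R")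
proof (cases "f \<in> polys n")
  case True
  have "(\<forall>g h x. is_inverse n g h \<longrightarrow> mpeval (mmul n (mmul n h x) g) f = mpeval x f) \<longleftrightarrow> ?R"
  proof (intro iffI allI impI)
    fix a b A :: "'a mat"
    assume *: "\<forall>g h x. is_inverse n g h \<longrightarrow> mpeval (mmul n (mmul n h x) g) f = mpeval x f"
      and "a \<in> carrier_mat n n" "b \<in> carrier_mat n n" "A \<in> carrier_mat n n" "a * b = 1\<^sub>m n" "b * a = 1\<^sub>m n"
    then show "mev (a * A * b) f = mev A f"
      using * [rule_format, of "entries b" "entries a" "entries A"] by (simp add: mpeval_mmul [OF True] is_inverse_to_mat)
  next
    fix g h x :: "nat \<Rightarrow> nat \<Rightarrow> 'a" assume "?R" "is_inverse n g h"
    then show "mpeval (mmul n (mmul n h x) g) f = mpeval x f"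
      unfolding mpeval_mmul [OF True] by (simp add: is_inverse_to_mat mpeval_entries_to_mat True)
  qed
  with True show ?thesis by (simp add: invG_def)
qed (simp add: invG_def)

definition unitri :: "nat \<Rightarrow> 'k::comm_ring_1 mat \<Rightarrow> bool" where
  "unitri n a \<longleftrightarrow> a \<in> carrier_mat n n \<and> (\<forall>i<n. \<forall>j<n. j \<le> i \<longrightarrow> a $$ (i, j) = (if i = j then 1 else 0))"

lemma unitriangular_to_mat: "unitriangular n g \<longleftrightarrow> unitri n (to_mat n g)"
proof
  show "unitri n (to_mat n g)" if "unitriangular n g"
    unfolding unitri_def
  proof (intro conjI allI impI)
    fix i j assume "i < n" "j < n" "j \<le> i"
    then show "to_mat n g $$ (i, j) = (if i = j then 1 else 0)"
      using that [unfolded unitriangular_def, rule_format, of "Suc i" "Suc j"] by auto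
  qed simp
  show "unitriangular n g" if u: "unitri n (to_mat n g)"
    unfolding unitriangular_def
  proof (intro ballI conjI impI)
    fix i j assume ij: "i \<in> {1..n}" "j \<in> {1..n}"
    have *: "to_mat n g $$ (i - 1, j - 1) = (if i - 1 = j - 1 then 1 else 0)" if "j \<le> i"
    proof -
      have "i - 1 < n" "j - 1 < n" "j - 1 \<le> i - 1" using ij that by auto
      then show ?thesis using u unfolding unitri_def by blast
    qed
    show "g i j = 0" if "j < i"
    proof -
      have "i - 1 \<noteq> j - 1" using that ij by auto
      then show ?thesis using * that to_mat_index_1 [OF ij, of g] by simp
    qed
    have "i - 1 < n" using ij by auto
    then have "to_mat n g $$ (i - 1, i - 1) = 1" using u unfolding unitri_def by auto
    then show "g i i = 1" using to_mat_index_1 [OF ij(1) ij(1), of g] by simp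
  qed
qed

definition diag_fun :: "nat \<Rightarrow> (nat \<Rightarrow> 'k::comm_ring_1) \<Rightarrow> 'k mat" where
  "diag_fun n d = mat n n (\<lambda>(i, j). if i = j then d i else 0)"

lemma diag_fun_carrier [simp]: "diag_fun n d \<in> carrier_mat n n" "dim_row (diag_fun n d) = n" "dim_col (diag_fun n d) = n"
  by (simp_all add: diag_fun_def)

lemma diag_fun_mult_index: "A \<in> carrier_mat n n \<Longrightarrow> i < n \<Longrightarrow> j < n \<Longrightarrow> (diag_fun n d * A) $$ (i, j) = d i * A $$ (i, j)"
  and mult_diag_fun_index: "A \<in> carrier_mat n n \<Longrightarrow> i < n \<Longrightarrow> j < n \<Longrightarrow> (A * diag_fun n d) $$ (i, j) = A $$ (i, j) * d j"
  by (subst mult_mat_index [of _ n]; simp add: diag_fun_def if_distrib [of "\<lambda>u. u * _"] if_distrib [of "\<lambda>u. _ * u"] cong: if_cong)+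

lemma diag_fun_mult: "diag_fun n d * diag_fun n e = diag_fun n (\<lambda>i. d i * e i)"
  by (intro eq_matI) (auto simp: diag_fun_mult_index, auto simp: diag_fun_def)

lemma to_mat_diagm: "to_mat n (diagm a) = diag_fun n (\<lambda>i. a (Suc i))"
  by (intro eq_matI) (auto simp: diagm_def diag_fun_def)

text \<open>Weights keep their 1-based indices while the entries d are 0-based; hence the many
  \<open>Suc\<close>, and \<open>nu 2\<close> for the weight at matrix index 1.\<close>

definition torus_char :: "nat \<Rightarrow> (nat \<Rightarrow> int) \<Rightarrow> (nat \<Rightarrow> 'k::field) \<Rightarrow> 'k" where
  "torus_char n nu d = (\<Prod>i<n. d i powi nu (Suc i))"

lemma invU_wt_iff:
  "f \<in> invU_wt n nu \<longleftrightarrow> f \<in> polys n \<and>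
     (\<forall>a b A. unitri n a \<longrightarrow> b \<in> carrier_mat n n \<longrightarrow> A \<in> carrier_mat n n \<longrightarrow>
     a * b = 1\<^sub>m n \<longrightarrow> b * a = 1\<^sub>m n \<longrightarrow> mev (a * A * b) f = mev A f) \<and>
     (\<forall>d A. (\<forall>i<n. d i \<noteq> 0) \<longrightarrow> A \<in> carrier_mat n n \<longrightarrow>
      mev (diag_fun n (\<lambda>i. inverse (d i)) * A * diag_fun n d) f = torus_char n nu d * mev A f)" (is "_ \<longleftrightarrow> _ \<and> ?R \<and> ?T")
proof (cases "f \<in> polys n")
  case True
  have "(\<forall>g h x. unitriangular n g \<longrightarrow> is_inverse n g h \<longrightarrow> mpeval (mmul n (mmul n h x) g) f = mpeval x f) \<longleftrightarrow> ?R"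
  proof (intro iffI allI impI)
    fix a b A :: "'a mat"
    assume *: "\<forall>g h x. unitriangular n g \<longrightarrow> is_inverse n g h \<longrightarrow> mpeval (mmul n (mmul n h x) g) f = mpeval x f"
      and a: "unitri n a" and b: "b \<in> carrier_mat n n" and A: "A \<in> carrier_mat n n" and ab: "a * b = 1\<^sub>m n" "b * a = 1\<^sub>m n"
    have a': "a \<in> carrier_mat n n" using a by (simp add: unitri_def)
    \<comment> \<open>The definition conjugates by the inverse of a unitriangular matrix. Applying
      it at a A b instead of A reverses the direction without showing that the inverse b is
      unitriangular.\<close>
    have "mev (b * (a * A * b) * a) f = mev (a * A * b) f"
      using * [rule_format, of "entries a" "entries b" "entries (a * A * b)"] a a' b A ab
      by (simp add: mpeval_mmul [OF True] is_inverse_to_mat unitriangular_to_mat)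
    also have "b * (a * A * b) * a = (b * a) * A * (b * a)"
      using a' b A by (simp add: assoc_mult_mat [of _ n n _ n _ n])
    finally show "mev (a * A * b) f = mev A f" using A ab by simp
  next
    fix g h x :: "nat \<Rightarrow> nat \<Rightarrow> 'a" assume R: "?R" and g: "unitriangular n g" "is_inverse n g h"
    have "mev (to_mat n g * (to_mat n h * to_mat n x * to_mat n g) * to_mat n h) f = mev (to_mat n h * to_mat n x * to_mat n g) f"
      using R g by (simp add: unitriangular_to_mat is_inverse_to_mat)
    also have "to_mat n g * (to_mat n h * to_mat n x * to_mat n g) * to_mat n h = (to_mat n g * to_mat n h) * to_mat n x * (to_mat n g * to_mat n h)"
      by (simp add: assoc_mult_mat [of _ n n _ n _ n])
    finally show "mpeval (mmul n (mmul n h x) g) f = mpeval x f"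
      unfolding mpeval_mmul [OF True] using g by (simp add: is_inverse_to_mat mpeval_entries_to_mat True)
  qed
  moreover have "(\<forall>a x. (\<forall>i\<in>{1..n}. a i \<noteq> 0) \<longrightarrow>
          mpeval (mmul n (mmul n (diagm (\<lambda>i. inverse (a i))) x) (diagm a)) f
            = (\<Prod>i=1..n. a i powi nu i) * mpeval x f) \<longleftrightarrow> ?T"
  proof (intro iffI allI impI)
    fix d :: "nat \<Rightarrow> 'a" and A :: "'a mat"
    assume *: "\<forall>a x. (\<forall>i\<in>{1..n}. a i \<noteq> 0) \<longrightarrow>
          mpeval (mmul n (mmul n (diagm (\<lambda>i. inverse (a i))) x) (diagm a)) f
            = (\<Prod>i=1..n. a i powi nu i) * mpeval x f"
      and d: "\<forall>i<n. d i \<noteq> 0" and A: "A \<in> carrier_mat n n"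
    have "(\<Prod>i=1..n. d (i - 1) powi nu i) = torus_char n nu d"
      unfolding torus_char_def by (rule prod.reindex_bij_witness [of _ Suc "\<lambda>l. l - 1"]) auto
    moreover have "\<forall>i\<in>{1..n}. d (i - 1) \<noteq> 0" using d by auto
    ultimately show "mev (diag_fun n (\<lambda>i. inverse (d i)) * A * diag_fun n d) f = torus_char n nu d * mev A f"
      using * [rule_format, of "\<lambda>i. d (i - 1)" "entries A"] A
      by (simp add: mpeval_mmul [OF True] to_mat_diagm)
  next
    fix a :: "nat \<Rightarrow> 'a" and x assume T: ?T and a: "\<forall>i\<in>{1..n}. a i \<noteq> 0"
    have "(\<Prod>i=1..n. a i powi nu i) = torus_char n nu (\<lambda>i. a (Suc i))"
      unfolding torus_char_def by (rule prod.reindex_bij_witness [of _ Suc "\<lambda>l. l - 1"]) auto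
    then show "mpeval (mmul n (mmul n (diagm (\<lambda>i. inverse (a i))) x) (diagm a)) f
            = (\<Prod>i=1..n. a i powi nu i) * mpeval x f"
      using T [rule_format, of "\<lambda>i. a (Suc i)" "to_mat n x"] a
      by (simp add: mpeval_mmul [OF True] to_mat_diagm mpeval_entries_to_mat True)
  qed
  ultimately show ?thesis using True by (simp add: invU_wt_def)
qed (simp add: invU_wt_def)

section \<open>Semi-invariance under elementary matrices\<close>

text \<open>f is semi-invariant under conjugation by a with multiplier c. Invertibility of a is part
  of the notion, so that the pairs (a, c) are closed under products.\<close>

definition stab :: "nat \<Rightarrow> 'k::field mpoly \<Rightarrow> 'k mat \<Rightarrow> 'k \<Rightarrow> bool" where
  "stab n f a c \<longleftrightarrow> a \<in> carrier_mat n n \<and> (\<exists>b. b \<in> carrier_mat n n \<and> a * b = 1\<^sub>m n \<and> b * a = 1\<^sub>m n \<and>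
     (\<forall>A. A \<in> carrier_mat n n \<longrightarrow> mev (a * A * b) f = c * mev A f))"

lemma stab_carrier: "stab n f a c \<Longrightarrow> a \<in> carrier_mat n n"
  by (simp add: stab_def)

lemma inverse_mat_unique:
  fixes a b b' :: "'k::comm_ring_1 mat"
  assumes "a \<in> carrier_mat n n" "b \<in> carrier_mat n n" "b' \<in> carrier_mat n n" "b * a = 1\<^sub>m n" "a * b' = 1\<^sub>m n"
  shows "b = b'"
proof -
  have "b * (a * b') = (b * a) * b'"
    using assms(1-3) by (simp add: assoc_mult_mat [of _ n n _ n _ n])
  moreover have "b * 1\<^sub>m n = b" using assms(2) by simp
  moreover have "1\<^sub>m n * b' = b'" using assms(3) by simp
  ultimately show ?thesis using assms(4,5) by simp
qed

lemma stabD: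
  assumes "stab n f a c" "b \<in> carrier_mat n n" "a * b = 1\<^sub>m n" "A \<in> carrier_mat n n"
  shows "mev (a * A * b) f = c * mev A f"
  using assms inverse_mat_unique unfolding stab_def by metis

lemma stab_one: "stab n f (1\<^sub>m n) 1"
  unfolding stab_def by (auto intro!: exI [of _ "1\<^sub>m n"])

lemma inverse_mult:
  assumes "a \<in> carrier_mat n n" "b \<in> carrier_mat n n" "a' \<in> carrier_mat n n" "b' \<in> carrier_mat n n"
    and "a * b = 1\<^sub>m n" "a' * b' = 1\<^sub>m n"
  shows "(a * a') * (b' * b) = (1\<^sub>m n :: 'k::comm_ring_1 mat)"
proof -
  have "(a * a') * (b' * b) = a * (a' * b') * b"
    using assms(1-4) by (simp add: assoc_mult_mat [of _ n n _ n _ n])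
  then show ?thesis using assms by simp
qed

lemma stab_mult:
  assumes "stab n f a c" "stab n f a' c'"
  shows "stab n f (a * a') (c * c')"
proof -
  obtain b where a: "a \<in> carrier_mat n n" and b: "b \<in> carrier_mat n n" "a * b = 1\<^sub>m n" "b * a = 1\<^sub>m n"
    and 1: "\<And>A. A \<in> carrier_mat n n \<Longrightarrow> mev (a * A * b) f = c * mev A f"
    using assms(1) unfolding stab_def by blast
  obtain b' where a': "a' \<in> carrier_mat n n" and b': "b' \<in> carrier_mat n n" "a' * b' = 1\<^sub>m n" "b' * a' = 1\<^sub>m n"
    and 2: "\<And>A. A \<in> carrier_mat n n \<Longrightarrow> mev (a' * A * b') f = c' * mev A f"
    using assms(2) unfolding stab_def by blast
  have "mev ((a * a') * A * (b' * b)) f = (c * c') * mev A f" if A: "A \<in> carrier_mat n n" for A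
  proof -
    have "(a * a') * A * (b' * b) = a * (a' * A * b') * b"
      using a a' b(1) b'(1) A by (simp add: assoc_mult_mat [of _ n n _ n _ n])
    then show ?thesis using a' b' A by (simp add: 1 2)
  qed
  then show ?thesis
    unfolding stab_def using a a' b b'
    by (intro conjI exI [of _ "b' * b"]) (auto intro: inverse_mult)
qed

text \<open>The torus acts through t^{-1} A t but \<open>stab\<close> uses a A a^{-1}; hence the
  inverted entries in the character.\<close>

lemma stab_diag_fun:
  assumes f: "f \<in> invU_wt n nu" and d: "\<And>i. i < n \<Longrightarrow> d i \<noteq> 0"
  shows "stab n f (diag_fun n d) (torus_char n nu (\<lambda>i. inverse (d i)))"
proof -
  have 1: "diag_fun n (\<lambda>i. d i * inverse (d i)) = 1\<^sub>m n" 
    using d by (intro eq_matI) (auto simp: diag_fun_def)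
  have "mev (diag_fun n (\<lambda>i. inverse (inverse (d i))) * A * diag_fun n (\<lambda>i. inverse (d i))) f
      = torus_char n nu (\<lambda>i. inverse (d i)) * mev A f" if "A \<in> carrier_mat n n" for A
    using f [unfolded invU_wt_iff, THEN conjunct2, THEN conjunct2, rule_format, of "\<lambda>i. inverse (d i)" A] that d
    by auto
  then show ?thesis
    unfolding stab_def using 1
    by (intro conjI exI [of _ "diag_fun n (\<lambda>i. inverse (d i))"]) (simp_all add: diag_fun_mult mult.commute)
qed

text \<open>The rank one perturbation 1 + v \<rho>^T. It covers elementary matrices as well as whole
  rows or columns of a unipotent radical, and is unipotent when \<rho>^T v = 0.\<close>

definition transvec :: "nat \<Rightarrow> (nat \<Rightarrow> 'k::comm_ring_1) \<Rightarrow> (nat \<Rightarrow> 'k) \<Rightarrow> 'k mat" where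
  "transvec n v \<rho> = mat n n (\<lambda>(i, j). (if i = j then 1 else 0) + v i * \<rho> j)"

abbreviation unit_fun :: "nat \<Rightarrow> nat \<Rightarrow> 'k::comm_ring_1" where
  "unit_fun i \<equiv> (\<lambda>j. if j = i then 1 else 0)"

lemma transvec_carrier [simp]: "transvec n v \<rho> \<in> carrier_mat n n" "dim_row (transvec n v \<rho>) = n" "dim_col (transvec n v \<rho>) = n"
  by (simp_all add: transvec_def)

lemma transvec_index: "i < n \<Longrightarrow> j < n \<Longrightarrow> transvec n v \<rho> $$ (i, j) = (if i = j then 1 else 0) + v i * \<rho> j"
  by (simp add: transvec_def)

lemma transvec_mult_index:
  assumes "A \<in> carrier_mat n n" "i < n" "j < n"
  shows "(transvec n v \<rho> * A) $$ (i, j) = A $$ (i, j) + v i * (\<Sum>k<n. \<rho> k * A $$ (k, j))"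
proof -
  have "(transvec n v \<rho> * A) $$ (i, j) = (\<Sum>k<n. (if k = i then A $$ (i, j) else 0) + v i * (\<rho> k * A $$ (k, j)))"
    using assms by (subst mult_mat_index [of _ n]) (auto simp: transvec_index algebra_simps intro!: sum.cong)
  then show ?thesis using assms by (simp add: sum.distrib sum_distrib_left)
qed

lemma mult_transvec_index:
  assumes "A \<in> carrier_mat n n" "i < n" "j < n"
  shows "(A * transvec n v \<rho>) $$ (i, j) = A $$ (i, j) + (\<Sum>k<n. A $$ (i, k) * v k) * \<rho> j"
proof -
  have "(A * transvec n v \<rho>) $$ (i, j) = (\<Sum>k<n. (if k = j then A $$ (i, j) else 0) + (A $$ (i, k) * v k) * \<rho> j)"
    using assms by (subst mult_mat_index [of _ n]) (auto simp: transvec_index algebra_simps intro!: sum.cong)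
  then show ?thesis using assms by (simp add: sum.distrib sum_distrib_right)
qed

lemma sum_unit_fun_left [simp]: "i < n \<Longrightarrow> (\<Sum>k<n. unit_fun i k * g k) = (g i :: 'k::comm_ring_1)"
  and sum_unit_fun_right [simp]: "i < n \<Longrightarrow> (\<Sum>k<n. g k * unit_fun i k) = (g i :: 'k::comm_ring_1)"
  by (simp_all add: if_distrib [of "\<lambda>u. u * _"] if_distrib [of "\<lambda>u. _ * u"] cong: if_cong)

lemma transvec_mult_transvec:
  assumes "(\<Sum>k<n. \<rho> k * v k) = 0"
  shows "transvec n v \<rho> * transvec n v \<sigma> = transvec n v (\<lambda>k. \<rho> k + \<sigma> k)"
proof (rule eq_matI)
  fix i j assume "i < dim_row (transvec n v (\<lambda>k. \<rho> k + \<sigma> k))" "j < dim_col (transvec n v (\<lambda>k. \<rho> k + \<sigma> k))"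
  then have ij: "i < n" "j < n" by auto
  have "(\<Sum>k<n. transvec n v \<rho> $$ (i, k) * v k) = v i"
  proof -
    have "(\<Sum>k<n. transvec n v \<rho> $$ (i, k) * v k) = (\<Sum>k<n. (if k = i then v k else 0) + v i * (\<rho> k * v k))"
      using ij by (intro sum.cong) (auto simp: transvec_index algebra_simps)
    then show ?thesis using ij assms by (simp add: sum.distrib flip: sum_distrib_left)
  qed
  then show "(transvec n v \<rho> * transvec n v \<sigma>) $$ (i, j) = transvec n v (\<lambda>k. \<rho> k + \<sigma> k) $$ (i, j)"
    using ij by (simp add: mult_transvec_index transvec_index algebra_simps)
qed auto

lemma transvec_0: "transvec n v (\<lambda>_. 0) = 1\<^sub>m n" "transvec n (\<lambda>_. 0) \<rho> = 1\<^sub>m n"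
  by (auto intro!: eq_matI simp: transvec_index)

lemma transvec_inverse:
  assumes "(\<Sum>k<n. \<rho> k * v k) = 0"
  shows "transvec n v \<rho> * transvec n v (\<lambda>k. - \<rho> k) = 1\<^sub>m n" "transvec n v (\<lambda>k. - \<rho> k) * transvec n v \<rho> = 1\<^sub>m n"
  using assms by (subst transvec_mult_transvec; simp add: transvec_0 sum_negf)+

lemma stab_transvec_upper:
  assumes f: "f \<in> invU_wt n nu" and up: "\<And>i j. i < n \<Longrightarrow> j \<le> i \<Longrightarrow> v i * \<rho> j = 0"
  shows "stab n f (transvec n v \<rho>) 1"
proof -
  have "(\<Sum>k<n. \<rho> k * v k) = 0"
    using up by (intro sum.neutral) (simp add: mult.commute)
  note inv = transvec_inverse [OF this]
  have "unitri n (transvec n v \<rho>)"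
    using up by (auto simp: unitri_def transvec_index)
  then show ?thesis
    using f inv unfolding stab_def invU_wt_iff
    by (intro conjI exI [of _ "transvec n v (\<lambda>k. - \<rho> k)"]) auto
qed

section \<open>The degree bound from SL_2\<close>

definition poly_fun :: "('k::comm_ring_1 \<Rightarrow> 'k) \<Rightarrow> bool" where
  "poly_fun \<phi> \<longleftrightarrow> (\<exists>P. \<forall>\<tau>. \<phi> \<tau> = poly P \<tau>)"

lemma poly_fun_const [intro]: "poly_fun (\<lambda>\<tau>. c)"
  unfolding poly_fun_def by (rule exI [of _ "[:c:]"]) simp

lemma poly_fun_id [intro]: "poly_fun (\<lambda>\<tau>. \<tau>)"
  unfolding poly_fun_def by (rule exI [of _ "[:0, 1:]"]) simp

lemma poly_fun_add [intro]: "poly_fun \<phi> \<Longrightarrow> poly_fun \<psi> \<Longrightarrow> poly_fun (\<lambda>\<tau>. \<phi> \<tau> + \<psi> \<tau>)"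
  unfolding poly_fun_def by (metis poly_add)

lemma poly_fun_mult [intro]: "poly_fun \<phi> \<Longrightarrow> poly_fun \<psi> \<Longrightarrow> poly_fun (\<lambda>\<tau>. \<phi> \<tau> * \<psi> \<tau>)"
  unfolding poly_fun_def by (metis poly_mult)

lemma poly_fun_uminus [intro]: "poly_fun \<phi> \<Longrightarrow> poly_fun (\<lambda>\<tau>. - \<phi> \<tau>)"
  unfolding poly_fun_def by (metis poly_minus)

lemma poly_fun_sum [intro]: "(\<And>a. a \<in> A \<Longrightarrow> poly_fun (\<phi> a)) \<Longrightarrow> poly_fun (\<lambda>\<tau>. \<Sum>a\<in>A. \<phi> a \<tau>)"
  by (induction A rule: infinite_finite_induct) auto

lemma poly_fun_if [intro]: "poly_fun \<phi> \<Longrightarrow> poly_fun \<psi> \<Longrightarrow> poly_fun (\<lambda>\<tau>. if b then \<phi> \<tau> else \<psi> \<tau>)"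
  by (cases b) simp_all

lemma poly_fun_mult_mat:
  assumes "\<And>\<tau>. M \<tau> \<in> carrier_mat n n" "\<And>\<tau>. N \<tau> \<in> carrier_mat n n"
    and "\<And>i j. i < n \<Longrightarrow> j < n \<Longrightarrow> poly_fun (\<lambda>\<tau>. M \<tau> $$ (i, j))"
    and "\<And>i j. i < n \<Longrightarrow> j < n \<Longrightarrow> poly_fun (\<lambda>\<tau>. N \<tau> $$ (i, j))" "i < n" "j < n"
  shows "poly_fun (\<lambda>\<tau>. (M \<tau> * N \<tau>) $$ (i, j))"
  unfolding mult_mat_index [OF assms(1,2,5,6)] using assms(3-)
  by (intro poly_fun_sum poly_fun_mult) auto

lemma poly_fun_mev:
  assumes f: "f \<in> polys n"
    and M: "\<And>i j. i < n \<Longrightarrow> j < n \<Longrightarrow> poly_fun (\<lambda>\<tau>. M \<tau> $$ (i, j))"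
  shows "poly_fun (\<lambda>\<tau>. mev (M \<tau>) f)"
proof -
  obtain X where X: "\<And>i j \<tau>. i < n \<Longrightarrow> j < n \<Longrightarrow> M \<tau> $$ (i, j) = poly (X i j) \<tau>"
    using M unfolding poly_fun_def by metis
  obtain P where P: "\<And>\<tau>. mpeval (\<lambda>i j. poly (X (i - 1) (j - 1)) \<tau>) f = poly P \<tau>"
    using mpeval_poly_entries [of "\<lambda>i j. X (i - 1) (j - 1)" f] by blast
  have "mev (M \<tau>) f = poly P \<tau>" for \<tau>
    unfolding P [symmetric] by (rule mpeval_cong [OF f]) (auto simp: entries_def X)
  then show ?thesis unfolding poly_fun_def by blast
qed

text \<open>The 2 x 2 matrix with rows (a, b) and (c, d) placed at the indices j, i in this order.
  For j < i the parameter c is below the diagonal and b above it.\<close>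

definition sl2_mat :: "nat \<Rightarrow> nat \<Rightarrow> nat \<Rightarrow> 'k::comm_ring_1 \<Rightarrow> 'k \<Rightarrow> 'k \<Rightarrow> 'k \<Rightarrow> 'k mat" where
  "sl2_mat n j i a b c d = mat n n (\<lambda>(x, y).
     if x = j then (if y = j then a else if y = i then b else 0)
     else if x = i then (if y = j then c else if y = i then d else 0)
     else if x = y then 1 else 0)"

lemma sl2_mat_carrier [simp]: "sl2_mat n j i a b c d \<in> carrier_mat n n"
  "dim_row (sl2_mat n j i a b c d) = n" "dim_col (sl2_mat n j i a b c d) = n"
  by (simp_all add: sl2_mat_def)

lemma sl2_mat_mult:
  assumes "i \<noteq> j" "i < n" "j < n"
  shows "sl2_mat n j i a b c d * sl2_mat n j i a' b' c' d'
    = sl2_mat n j i (a * a' + b * c') (a * b' + b * d') (c * a' + d * c') (c * b' + d * d')"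
proof (rule eq_matI)
  have two: "(\<Sum>k<n. (if k = j then p else if k = i then q else 0) * g k) = p * g j + q * g i" for p q :: 'a and g
  proof -
    have "(\<Sum>k<n. (if k = j then p else if k = i then q else 0) * g k)
        = (\<Sum>k<n. if k = j then p * g k else 0) + (\<Sum>k<n. if k = i then q * g k else 0)"
      unfolding sum.distrib [symmetric] using assms by (intro sum.cong) auto
    then show ?thesis using assms by simp
  qed
  have one: "(\<Sum>k<n. (if x = k then 1 else 0) * g k) = g x" if "x < n" for x and g :: "nat \<Rightarrow> 'a"
    using that by (simp add: if_distrib [of "\<lambda>u. u * _"] cong: if_cong)
  fix x y
  assume "x < dim_row (sl2_mat n j i (a * a' + b * c') (a * b' + b * d') (c * a' + d * c') (c * b' + d * d'))"
    "y < dim_col (sl2_mat n j i (a * a' + b * c') (a * b' + b * d') (c * a' + d * c') (c * b' + d * d'))"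
  then have xy: "x < n" "y < n" by auto
  have "(sl2_mat n j i a b c d * sl2_mat n j i a' b' c' d') $$ (x, y) = (\<Sum>k<n. (if x = j then (if k = j then a else if k = i then b else 0)
     else if x = i then (if k = j then c else if k = i then d else 0)
     else if x = k then 1 else 0) * sl2_mat n j i a' b' c' d' $$ (k, y))"
    using xy by (subst mult_mat_index [of _ n]) (auto simp: sl2_mat_def intro!: sum.cong)
  also have "\<dots> = (if x = j then a * sl2_mat n j i a' b' c' d' $$ (j, y) + b * sl2_mat n j i a' b' c' d' $$ (i, y)
     else if x = i then c * sl2_mat n j i a' b' c' d' $$ (j, y) + d * sl2_mat n j i a' b' c' d' $$ (i, y)
     else sl2_mat n j i a' b' c' d' $$ (x, y))"
    by (cases "x = j"; cases "x = i") (use assms(1) in \<open>simp_all only: if_True if_False simp_thms two one [OF xy(1)]\<close>)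
  finally show "(sl2_mat n j i a b c d * sl2_mat n j i a' b' c' d') $$ (x, y)
    = sl2_mat n j i (a * a' + b * c') (a * b' + b * d') (c * a' + d * c') (c * b' + d * d') $$ (x, y)"
    using xy assms by (simp add: sl2_mat_def)
qed auto

lemma sl2_mat_1: "i \<noteq> j \<Longrightarrow> sl2_mat n j i 1 0 0 1 = 1\<^sub>m n"
  by (intro eq_matI) (auto simp: sl2_mat_def)

lemma poly_fun_sl2_mat:
  assumes "poly_fun a" "poly_fun b" "poly_fun c" "poly_fun d" "x < n" "y < n"
  shows "poly_fun (\<lambda>\<tau>. sl2_mat n j i (a \<tau>) (b \<tau>) (c \<tau>) (d \<tau>) $$ (x, y))"
  using assms(1-4) unfolding sl2_mat_def index_mat(1) [OF assms(5,6)] split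
  by (intro poly_fun_if poly_fun_const)

text \<open>Multiplication by t^(deg Q) gives the polynomial identity t^(deg Q) P = t^d Q*, where
  the reversed polynomial Q* has degree at most deg Q; compare degrees.\<close>

lemma degree_le_if_reciprocal:
  fixes P Q :: "'k::field poly"
  assumes inf: "infinite (UNIV :: 'k set)"
    and PQ: "\<And>t. t \<noteq> 0 \<Longrightarrow> poly P t = t ^ d * poly Q (1 / t)"
  shows "degree P \<le> d"
proof (cases "P = 0")
  case False
  have "monom 1 (degree Q) * P - monom 1 d * reflect_poly Q = 0"
  proof (rule poly_eq_0_if_zero_off_0 [OF inf])
    fix t :: 'k assume "t \<noteq> 0"
    then show "poly (monom 1 (degree Q) * P - monom 1 d * reflect_poly Q) t = 0"
      by (simp add: poly_monom poly_reflect_poly_nz PQ inverse_eq_divide)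
  qed
  then have "degree (monom 1 (degree Q) * P) = degree (monom 1 d * reflect_poly Q)" by simp
  moreover have "degree (monom 1 (degree Q) * P) = degree Q + degree P"
    using False by (simp add: degree_mult_eq degree_monom_eq)
  moreover have "degree (monom 1 d * reflect_poly Q) \<le> d + degree Q"
    by (rule order_trans [OF degree_mult_le]) (simp add: degree_monom_eq degree_reflect_poly_le)
  ultimately show ?thesis by simp
qed simp

text \<open>On the big cell of SL_2, a lower unipotent t is an upper triangular matrix times a
  matrix polynomial in 1/t.\<close>

lemma sl2_degree:
  fixes f :: "'k::field mpoly"
  assumes inf: "infinite (UNIV :: 'k set)" and f: "f \<in> invU_wt n nu"
    and ij: "j < i" "i < n" and d: "nu (Suc j) - nu (Suc i) = int d" and A: "A \<in> carrier_mat n n"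
  shows "\<exists>P. degree P \<le> d \<and> (\<forall>\<tau>. mev (sl2_mat n j i 1 0 \<tau> 1 * A * sl2_mat n j i 1 0 (- \<tau>) 1) f = poly P \<tau>)"
proof -
  have fp: "f \<in> polys n" using f by (simp add: invU_wt_iff)
  have "poly_fun (\<lambda>\<tau>. mev (sl2_mat n j i 1 0 \<tau> 1 * A * sl2_mat n j i 1 0 (- \<tau>) 1) f)"
    using A by (intro poly_fun_mev [OF fp] poly_fun_mult_mat [where n = n] poly_fun_sl2_mat) auto
  then obtain P where P: "\<And>\<tau>. mev (sl2_mat n j i 1 0 \<tau> 1 * A * sl2_mat n j i 1 0 (- \<tau>) 1) f = poly P \<tau>"
    unfolding poly_fun_def by blast
  have "poly_fun (\<lambda>\<tau>. mev (sl2_mat n j i 0 (-1) 1 \<tau> * A * sl2_mat n j i \<tau> 1 (-1) 0) f)"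
    using A by (intro poly_fun_mev [OF fp] poly_fun_mult_mat [where n = n] poly_fun_sl2_mat) auto
  then obtain Q where Q: "\<And>\<tau>. mev (sl2_mat n j i 0 (-1) 1 \<tau> * A * sl2_mat n j i \<tau> 1 (-1) 0) f = poly Q \<tau>"
    unfolding poly_fun_def by blast
  have ne: "i \<noteq> j" "j < n" using ij by auto
  note mult = sl2_mat_mult [OF ne(1) ij(2) ne(2)]
  have "poly P \<tau> = \<tau> ^ d * poly Q (1 / \<tau>)" if \<tau>: "\<tau> \<noteq> 0" for \<tau>
  proof -
    \<comment> \<open>The value of the coroot of (j, i) at 1/\<tau>. The character at its inverse is
      \<tau> to the power nu_j - nu_i, which is where the exponent d comes from.\<close>
    let ?d = "\<lambda>k. if k = j then 1 / \<tau> else if k = i then \<tau> else 1"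
    have "sl2_mat n j i 1 (1 / \<tau>) 0 1 = transvec n (unit_fun j) (\<lambda>k. 1 / \<tau> * unit_fun i k)"
      using ij by (intro eq_matI) (auto simp: sl2_mat_def transvec_index)
    moreover have "stab n f (transvec n (unit_fun j) (\<lambda>k. 1 / \<tau> * unit_fun i k)) 1"
      using ij by (intro stab_transvec_upper [OF f]) auto
    ultimately have 1: "stab n f (sl2_mat n j i 1 (1 / \<tau>) 0 1) 1" by simp
    have "torus_char n nu (\<lambda>k. inverse (?d k))
        = (\<Prod>k<n. (if k = j then \<tau> powi nu (Suc j) else 1) * (if k = i then (1 / \<tau>) powi nu (Suc i) else 1))"
      unfolding torus_char_def using ne by (intro prod.cong) (auto simp: inverse_eq_divide)
    also have "\<dots> = \<tau> powi (nu (Suc j) - nu (Suc i))"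
      using ij \<tau> by (simp add: prod.distrib power_int_diff power_int_divide_distrib)
    also have "\<dots> = \<tau> ^ d" by (simp add: d)
    finally have "stab n f (diag_fun n ?d) (\<tau> ^ d)"
      using stab_diag_fun [OF f, of ?d] \<tau> by simp
    moreover have "diag_fun n ?d = sl2_mat n j i (1 / \<tau>) 0 0 \<tau>"
      using ij by (intro eq_matI) (auto simp: sl2_mat_def diag_fun_def)
    ultimately have "stab n f (sl2_mat n j i 1 (1 / \<tau>) 0 1 * sl2_mat n j i (1 / \<tau>) 0 0 \<tau>) (1 * \<tau> ^ d)"
      using 1 by (intro stab_mult) auto
    moreover have "sl2_mat n j i 1 (1 / \<tau>) 0 1 * sl2_mat n j i (1 / \<tau>) 0 0 \<tau> = sl2_mat n j i (1 / \<tau>) 1 0 \<tau>"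
      using \<tau> by (simp add: mult)
    ultimately have W: "stab n f (sl2_mat n j i (1 / \<tau>) 1 0 \<tau>) (\<tau> ^ d)" by simp
    have W': "sl2_mat n j i (1 / \<tau>) 1 0 \<tau> * sl2_mat n j i \<tau> (-1) 0 (1 / \<tau>) = 1\<^sub>m n"
      using \<tau> sl2_mat_1 [OF ne(1), of n] by (simp add: mult)
    \<comment> \<open>In 2 x 2 blocks, written row by row: (1, 0; \<tau>, 1) = (1/\<tau>, 1; 0,
      \<tau>) (0, -1; 1, 1/\<tau>). The first factor has multiplier \<tau>^d, and \<open>K\<close>,
      \<open>K'\<close> are the second factor and its inverse.\<close>
    define K where "K = sl2_mat n j i 0 (-1) 1 (1 / \<tau>)"
    define K' where "K' = sl2_mat n j i (1 / \<tau>) 1 (-1) 0"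
    have KK: "K \<in> carrier_mat n n" "K' \<in> carrier_mat n n" by (simp_all add: K_def K'_def)
    have "sl2_mat n j i 1 0 \<tau> 1 = sl2_mat n j i (1 / \<tau>) 1 0 \<tau> * K"
      using \<tau> by (simp add: mult K_def)
    moreover have "sl2_mat n j i 1 0 (- \<tau>) 1 = K' * sl2_mat n j i \<tau> (-1) 0 (1 / \<tau>)"
      using \<tau> by (simp add: mult K'_def)
    ultimately have "sl2_mat n j i 1 0 \<tau> 1 * A * sl2_mat n j i 1 0 (- \<tau>) 1
        = sl2_mat n j i (1 / \<tau>) 1 0 \<tau> * (K * A * K') * sl2_mat n j i \<tau> (-1) 0 (1 / \<tau>)"
      using A KK by (simp add: assoc_mult_mat [of _ n n _ n _ n])
    then have "poly P \<tau> = \<tau> ^ d * mev (K * A * K') f"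
      using stabD [OF W _ W', of "K * A * K'"] A KK by (simp add: P [symmetric])
    then show ?thesis by (simp add: K_def K'_def Q)
  qed
  then have "degree P \<le> d" by (rule degree_le_if_reciprocal [OF inf])
  with P show ?thesis by blast
qed

text \<open>If the weight agrees at the two indices, the degree bound is 0, so the value along the
  lower unipotents is constant and equals the one at parameter 0. This enlarges the stabiliser from
  the Borel subgroup to a parabolic one.\<close>

lemma stab_transvection:
  fixes f :: "'k::field mpoly"
  assumes inf: "infinite (UNIV :: 'k set)" and f: "f \<in> invU_wt n nu"
    and ij: "i \<noteq> j" "i < n" "j < n" and nu: "nu (Suc i) = nu (Suc j)"
  shows "stab n f (transvec n (unit_fun i) (\<lambda>k. c * unit_fun j k)) 1"
proof (cases "i < j")
  case True
  then show ?thesis by (intro stab_transvec_upper [OF f]) auto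
next
  case False
  then have ji: "j < i" using ij by simp
  have eq: "transvec n (unit_fun i) (\<lambda>k. c * unit_fun j k) = sl2_mat n j i 1 0 c 1" for c :: 'k
    using ij by (intro eq_matI) (auto simp: sl2_mat_def transvec_index)
  note mult = sl2_mat_mult [OF ij]
  have "mev (sl2_mat n j i 1 0 c 1 * A * sl2_mat n j i 1 0 (- c) 1) f = mev A f" if A: "A \<in> carrier_mat n n" for A
  proof -
    obtain P where P: "degree P \<le> 0" "\<And>\<tau>. mev (sl2_mat n j i 1 0 \<tau> 1 * A * sl2_mat n j i 1 0 (- \<tau>) 1) f = poly P \<tau>"
      using sl2_degree [OF inf f ji ij(2) _ A, of 0] nu by auto
    have "poly P c = poly P 0"
      using P(1) by (auto elim!: degree_eq_zeroE)
    then show ?thesis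
      using P(2) [of c] P(2) [of 0] A by (simp add: sl2_mat_1 [OF ij(1)])
  qed
  moreover have "sl2_mat n j i 1 0 c 1 * sl2_mat n j i 1 0 (- c) 1 = 1\<^sub>m n" "sl2_mat n j i 1 0 (- c) 1 * sl2_mat n j i 1 0 c 1 = 1\<^sub>m n"
    by (simp_all add: mult sl2_mat_1 [OF ij(1)])
  ultimately show ?thesis
    unfolding eq stab_def by (intro conjI exI [of _ "sl2_mat n j i 1 0 (- c) 1"]) auto
qed

text \<open>Such a row matrix is a product of elementary matrices in the same row, added one at a
  time. The values of \<open>r\<close> are confined to indices of equal weight, so that lower
  positions are allowed too.\<close>

lemma stab_transvec_row:
  fixes f :: "'k::field mpoly"
  assumes inf: "infinite (UNIV :: 'k set)" and f: "f \<in> invU_wt n nu"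
    and k: "k < n" and r: "\<And>j. r j \<noteq> 0 \<Longrightarrow> j < n \<and> j \<noteq> k \<and> nu (Suc j) = nu (Suc k)"
  shows "stab n f (transvec n (unit_fun k) r) 1"
proof -
  have "stab n f (transvec n (unit_fun k) (\<lambda>j. if j \<in> F then r j else 0)) 1" if "finite F" for F
    using that
  proof (induction F rule: finite_induct)
    case empty
    show ?case by (simp add: transvec_0 stab_one)
  next
    case (insert a F)
    let ?r = "\<lambda>j. if j \<in> F then r j else 0"
    have "stab n f (transvec n (unit_fun k) (\<lambda>j. r a * unit_fun a j)) 1"
    proof (cases "r a = 0")
      case True
      then show ?thesis by (simp add: transvec_0 stab_one)
    next
      case False
      then show ?thesis using r [OF False] k by (intro stab_transvection [OF inf f]) auto
    qed
    then have "stab n f (transvec n (unit_fun k) ?r * transvec n (unit_fun k) (\<lambda>j. r a * unit_fun a j)) (1 * 1)"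
      using insert.IH by (rule stab_mult [rotated])
    moreover have "(\<Sum>j<n. ?r j * unit_fun k j) = 0"
      using r [of k] k by auto
    then have "transvec n (unit_fun k) ?r * transvec n (unit_fun k) (\<lambda>j. r a * unit_fun a j) = transvec n (unit_fun k) (\<lambda>j. ?r j + r a * unit_fun a j)"
      by (rule transvec_mult_transvec)
    moreover have "(\<lambda>j. ?r j + r a * unit_fun a j) = (\<lambda>j. if j \<in> insert a F then r j else 0)"
      using insert.hyps by auto
    ultimately show ?case by simp
  qed
  from this [of "{..<n}"] have "stab n f (transvec n (unit_fun k) (\<lambda>j. if j < n then r j else 0)) 1" by simp
  moreover have "(\<lambda>j. if j < n then r j else 0) = r"
    using r by (auto simp: fun_eq_iff)
  ultimately show ?thesis by simp
qed

section \<open>Semi-invariance under a parabolic subgroup\<close>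

lemma det_transvec_upper:
  assumes "\<And>i j. i < n \<Longrightarrow> j \<le> i \<Longrightarrow> v i * \<rho> j = 0"
  shows "det (transvec n v \<rho>) = 1"
proof -
  have "det (transvec n v \<rho>) = prod_list (diag_mat (transvec n v \<rho>))"
    by (rule det_upper_triangular [of _ n]) (use assms in \<open>auto simp: transvec_index\<close>)
  also have "diag_mat (transvec n v \<rho>) = map (\<lambda>_. 1) [0..<n]"
    unfolding diag_mat_def by (rule map_cong) (use assms in \<open>auto simp: transvec_index\<close>)
  finally show ?thesis by (simp add: map_replicate_const)
qed

lemma det_transvec_lower:
  assumes "\<And>i j. j < n \<Longrightarrow> i \<le> j \<Longrightarrow> v i * \<rho> j = 0"
  shows "det (transvec n v \<rho>) = 1"
proof -
  have "det (transvec n v \<rho>) = prod_list (diag_mat (transvec n v \<rho>))"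
    by (rule det_lower_triangular [of n]) (use assms in \<open>auto simp: transvec_index\<close>)
  also have "diag_mat (transvec n v \<rho>) = map (\<lambda>_. 1) [0..<n]"
    unfolding diag_mat_def by (rule map_cong) (use assms in \<open>auto simp: transvec_index\<close>)
  finally show ?thesis by (simp add: map_replicate_const)
qed

definition diag_at :: "nat \<Rightarrow> nat \<Rightarrow> 'k::comm_ring_1 \<Rightarrow> 'k mat" where
  "diag_at n k p = diag_fun n (\<lambda>i. if i = k then p else 1)"

lemma diag_at_carrier [simp]: "diag_at n k p \<in> carrier_mat n n" "dim_row (diag_at n k p) = n" "dim_col (diag_at n k p) = n"
  by (simp_all add: diag_at_def)

lemma det_diag_at: "k < n \<Longrightarrow> det (diag_at n k p) = p"
proof -
  assume k: "k < n"
  have "det (diag_at n k p) = prod_list (diag_mat (diag_at n k p))"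
    by (rule det_upper_triangular [of _ n]) (auto simp: diag_at_def diag_fun_def)
  also have "diag_mat (diag_at n k p) = map (\<lambda>i. if i = k then p else 1) [0..<n]"
    unfolding diag_mat_def by (rule map_cong) (auto simp: diag_at_def diag_fun_def)
  also have "prod_list \<dots> = (\<Prod>i<n. if i = k then p else 1)"
    by (subst prod.distinct_set_conv_list [symmetric]) (simp_all add: atLeast0LessThan del: prod.delta)
  finally show ?thesis using k by simp
qed

lemma stab_diag_at:
  assumes f: "f \<in> invU_wt n nu" and k: "k < n" and p: "p \<noteq> 0" and nu: "nu (Suc k) = - int r"
  shows "stab n f (diag_at n k p) (p ^ r)"
proof -
  have "torus_char n nu (\<lambda>i. inverse (if i = k then p else 1)) = (\<Prod>i<n. if i = k then p ^ r else 1)"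
    unfolding torus_char_def by (intro prod.cong) (auto simp: nu power_int_def)
  then show ?thesis
    using stab_diag_fun [OF f, of "\<lambda>i. if i = k then p else 1"] p k by (simp add: diag_at_def)
qed

lemma diag_at_mult_index: "A \<in> carrier_mat n n \<Longrightarrow> i < n \<Longrightarrow> j < n \<Longrightarrow>
    (diag_at n k p * A) $$ (i, j) = (if i = k then p else 1) * A $$ (i, j)"
  by (simp add: diag_at_def diag_fun_mult_index)

lemma mult_diag_at_index: "A \<in> carrier_mat n n \<Longrightarrow> i < n \<Longrightarrow> j < n \<Longrightarrow>
    (A * diag_at n k p) $$ (i, j) = A $$ (i, j) * (if j = k then p else 1)"
  by (simp add: diag_at_def mult_diag_fun_index)

text \<open>Gaussian elimination, with the pivot in the last row of the block.\<close>

lemma stab_block: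
  fixes f :: "'k::field mpoly"
  assumes inf: "infinite (UNIV :: 'k set)" and f: "f \<in> invU_wt n nu"
    and "hi \<le> n" "\<And>i. lo \<le> i \<Longrightarrow> i < hi \<Longrightarrow> nu (Suc i) = - int r"
    and "l \<in> carrier_mat n n" "det l \<noteq> 0"
    and "\<And>i j. i < n \<Longrightarrow> j < n \<Longrightarrow> \<not> (lo \<le> i \<and> i < hi \<and> lo \<le> j \<and> j < hi) \<Longrightarrow>
          l $$ (i, j) = (if i = j then 1 else 0)"
  shows "stab n f l (det l ^ r)"
  using assms(3-)
proof (induction hi arbitrary: l)
  case 0
  then have "l = 1\<^sub>m n" by (intro eq_matI) auto
  then show ?case by (simp add: stab_one)
next
  case (Suc k)
  note IH = Suc.IH and nu = Suc.prems(2)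
  have k: "k < n" using Suc.prems(1) by simp
  show ?case
  proof (cases "lo \<le> k")
    case False
    then show ?thesis using Suc.prems by (intro IH) auto
  next
    case lo: True
    have pivot: "stab n f l (det l ^ r)"
      if l: "l \<in> carrier_mat n n" and det: "det l \<noteq> 0" and piv: "l $$ (k, k) \<noteq> 0"
        and id: "\<And>i j. i < n \<Longrightarrow> j < n \<Longrightarrow> \<not> (lo \<le> i \<and> i < Suc k \<and> lo \<le> j \<and> j < Suc k) \<Longrightarrow>
          l $$ (i, j) = (if i = j then 1 else 0)" for l
    proof -
      define p where "p = l $$ (k, k)"
      define g where "g i = (if lo \<le> i \<and> i < k then l $$ (i, k) / p else 0)" for i
      define h where "h j = (if lo \<le> j \<and> j < k then l $$ (k, j) / p else 0)" for j
      \<comment> \<open>The Schur complement of the pivot p inside the smaller block, extended by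
        the identity. It satisfies l = (1 + g e_k^T) diag(p at k) l' (1 + e_k h^T).\<close>
      define l' where "l' = mat n n (\<lambda>(i, j). if lo \<le> i \<and> i < k \<and> lo \<le> j \<and> j < k
         then l $$ (i, j) - l $$ (i, k) * l $$ (k, j) / p else if i = j then 1 else 0)"
      have p: "p \<noteq> 0" using piv by (simp add: p_def)
      have l': "l' \<in> carrier_mat n n" by (simp add: l'_def)
      have eq: "l = transvec n g (unit_fun k) * (diag_at n k p * l') * transvec n (unit_fun k) h"
      proof (rule eq_matI)
        fix i j assume "i < dim_row (transvec n g (unit_fun k) * (diag_at n k p * l') * transvec n (unit_fun k) h)"
          "j < dim_col (transvec n g (unit_fun k) * (diag_at n k p * l') * transvec n (unit_fun k) h)"
        then have ij: "i < n" "j < n" by auto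
        have out: "l $$ (i, j) = (if i = j then 1 else 0)" if "\<not> (lo \<le> i \<and> i < Suc k \<and> lo \<le> j \<and> j < Suc k)"
          using id ij that by blast
        have l'k: "l' $$ (i, k) = (if i = k then 1 else 0)" "l' $$ (k, j) = (if k = j then 1 else 0)"
          using ij k by (auto simp: l'_def)
        have "(transvec n g (unit_fun k) * (diag_at n k p * l') * transvec n (unit_fun k) h) $$ (i, j)
          = (if i = k then p else 1) * l' $$ (i, j) + g i * (if k = j then p else 0)
            + ((if i = k then p else 0) + g i * p) * h j"
          using ij k l' l'k by (simp add: mult_transvec_index transvec_mult_index diag_at_mult_index l'_def)
        also have "\<dots> = l $$ (i, j)"
        proof -
          have l'ij: "l' $$ (i, j) = (if lo \<le> i \<and> i < k \<and> lo \<le> j \<and> j < k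
             then l $$ (i, j) - l $$ (i, k) * l $$ (k, j) / p else if i = j then 1 else 0)"
            using ij by (simp add: l'_def)
          have i: "i = k \<or> (lo \<le> i \<and> i < k) \<or> \<not> (lo \<le> i \<and> i < Suc k)"
            and j: "j = k \<or> (lo \<le> j \<and> j < k) \<or> \<not> (lo \<le> j \<and> j < Suc k)"
            by linarith+
          consider "\<not> (lo \<le> i \<and> i < Suc k \<and> lo \<le> j \<and> j < Suc k)" | "i = k" "j = k"
            | "i = k" "lo \<le> j" "j < k" | "lo \<le> i" "i < k" "j = k"
            | "lo \<le> i" "i < k" "lo \<le> j" "j < k"
            using i j by blast
          then show ?thesis
          proof cases
            case 1
            then have neq: "i = k \<longrightarrow> j \<noteq> k" using lo by auto
            from 1 have "g i = 0 \<or> j \<noteq> k" "h j = 0 \<or> (i \<noteq> k \<and> g i = 0)"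
              using lo by (auto simp: g_def h_def)
            moreover have "l' $$ (i, j) = l $$ (i, j)"
            proof -
              have "\<not> (lo \<le> i \<and> i < k \<and> lo \<le> j \<and> j < k)" using 1 by linarith
              then show ?thesis by (simp only: l'ij if_False out [OF 1])
            qed
            moreover have "i = k \<longrightarrow> l $$ (i, j) = 0"
              using neq out [OF 1] by auto
            ultimately show ?thesis using neq by auto
          next
            case 2
            then show ?thesis using l'ij by (simp add: g_def h_def flip: p_def)
          next
            case 3
            then show ?thesis using p l'ij by (simp add: g_def h_def)
          next
            case 4
            then show ?thesis using p l'ij by (simp add: g_def h_def)
          next
            case 5
            then show ?thesis using p l'ij by (simp add: g_def h_def)
          qed
        qed
        finally show "l $$ (i, j) = (transvec n g (unit_fun k) * (diag_at n k p * l') * transvec n (unit_fun k) h) $$ (i, j)" ..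
      qed (use l l' in auto)
      have 1: "det (transvec n g (unit_fun k)) = 1"
        by (rule det_transvec_upper) (auto simp: g_def)
      have 2: "det (transvec n (unit_fun k) h) = 1"
        by (rule det_transvec_lower) (auto simp: h_def)
      have det_eq: "det l = p * det l'"
        using l' by (subst eq) (simp add: det_mult [of _ n] 1 2 det_diag_at k)
      have "stab n f l' (det l' ^ r)"
      proof (rule IH)
        show "l' $$ (i, j) = (if i = j then 1 else 0)" if "i < n" "j < n" "\<not> (lo \<le> i \<and> i < k \<and> lo \<le> j \<and> j < k)" for i j
          by (simp only: l'_def index_mat(1) [OF that(1,2)] prod.case that(3) if_False)
        show "nu (Suc i) = - int r" if "lo \<le> i" "i < k" for i using nu [of i] that by simp
        show "det l' \<noteq> 0" using det det_eq by auto
      qed (use Suc.prems(1) l' in auto)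
      then have "stab n f (diag_at n k p * l') (p ^ r * det l' ^ r)"
        using lo p k by (intro stab_mult stab_diag_at [OF f] nu) auto
      moreover have "stab n f (transvec n g (unit_fun k)) 1"
        by (rule stab_transvec_upper [OF f]) (auto simp: g_def)
      \<comment> \<open>This factor is lower triangular: here the equality of the weights within the
        block enters.\<close>
      moreover have "stab n f (transvec n (unit_fun k) h) 1"
      proof (rule stab_transvec_row [OF inf f k])
        fix j assume "h j \<noteq> 0"
        then have "lo \<le> j" "j < k" by (auto simp: h_def split: if_splits)
        then show "j < n \<and> j \<noteq> k \<and> nu (Suc j) = nu (Suc k)"
          using lo k nu [of j] nu [of k] by auto
      qed
      ultimately have "stab n f (transvec n g (unit_fun k) * (diag_at n k p * l') * transvec n (unit_fun k) h) (1 * (p ^ r * det l' ^ r) * 1)"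
        by (intro stab_mult [OF stab_mult])
      then show ?thesis
        unfolding eq [symmetric] by (simp add: det_eq power_mult_distrib)
    qed
    note l = Suc.prems(3) and det = Suc.prems(4) and id = Suc.prems(5)
    show ?thesis
    proof (cases "l $$ (k, k) = 0")
      case False
      then show ?thesis using l det id by (intro pivot) auto
    next
      case True
      have "\<exists>j<n. l $$ (k, j) \<noteq> 0"
      proof (rule ccontr)
        assume "\<not> ?thesis"
        then have "det l = 0"
          by (subst laplace_expansion_row [OF l k]) auto
        then show False using det by simp
      qed
      then obtain j where j: "j < n" "l $$ (k, j) \<noteq> 0" by blast
      have jk: "lo \<le> j" "j < k" "j \<noteq> k"
        using id [OF k j(1)] j True k by (auto split: if_splits) (metis less_SucE)+
      \<comment> \<open>Adds column j to column k, which makes the pivot non-zero. As j < k, the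
        transvection is upper triangular, so it has determinant 1 and stabilises f.\<close>
      define l' where "l' = l * transvec n (unit_fun j) (unit_fun k)"
      have l': "l' \<in> carrier_mat n n" using l by (simp add: l'_def)
      have ind: "l' $$ (x, y) = l $$ (x, y) + l $$ (x, j) * unit_fun k y" if "x < n" "y < n" for x y
        using that l j by (simp add: l'_def mult_transvec_index)
      have det': "det l' = det l"
        using l jk by (simp add: l'_def det_mult [of _ n] det_transvec_upper)
      have "(\<Sum>y<n. unit_fun k y * unit_fun j y :: 'k) = 0"
        using jk by (intro sum.neutral) auto
      note inv = transvec_inverse [OF this]
      have "stab n f l' (det l' ^ r)"
      proof (rule pivot [OF l'])
        show "l' $$ (k, k) \<noteq> 0" using ind [OF k k] True j by simp
        fix x y assume xy: "x < n" "y < n" "\<not> (lo \<le> x \<and> x < Suc k \<and> lo \<le> y \<and> y < Suc k)"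
        have "l $$ (x, j) = 0" if "y = k"
          using id [OF xy(1) j(1)] xy that lo jk by auto
        then show "l' $$ (x, y) = (if x = y then 1 else 0)"
          using id [OF xy] xy by (simp add: ind)
      qed (use det det' in auto)
      moreover have "stab n f (transvec n (unit_fun j) (\<lambda>y. - unit_fun k y)) 1"
        using jk by (intro stab_transvec_upper [OF f]) auto
      ultimately have "stab n f (l' * transvec n (unit_fun j) (\<lambda>y. - unit_fun k y)) (det l' ^ r * 1)"
        by (rule stab_mult)
      moreover have "l' * transvec n (unit_fun j) (\<lambda>y. - unit_fun k y) = l * (transvec n (unit_fun j) (unit_fun k) * transvec n (unit_fun j) (\<lambda>y. - unit_fun k y))"
        using l by (simp add: l'_def assoc_mult_mat [of _ n n _ n _ n])
      ultimately show ?thesis using l det' inv by simp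
    qed
  qed
qed

text \<open>The case t = 1. Apart from strictly upper factors, a is its middle block, because first
  column and last row are normalised. The weight vanishes on that block, so its determinant enters
  with exponent 0.\<close>

lemma stab_parabolic_last_row:
  fixes f :: "'k::field mpoly"
  assumes inf: "infinite (UNIV :: 'k set)" and f: "f \<in> invU_wt n nu" and n: "n \<ge> 2"
    and nu: "\<And>i. 1 \<le> i \<Longrightarrow> i < n - 1 \<Longrightarrow> nu (Suc i) = 0"
    and a: "fixes_e1 n a" "det a \<noteq> 0" and row: "\<And>j. j < n \<Longrightarrow> a $$ (n - 1, j) = (if j = n - 1 then 1 else 0)"
  shows "stab n f a 1"
proof -
  define l where "l = mat n n (\<lambda>(i, j). if 1 \<le> i \<and> i < n - 1 \<and> 1 \<le> j \<and> j < n - 1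
    then a $$ (i, j) else if i = j then 1 else 0)"
  define g where "g i = (if i < n - 1 then a $$ (i, n - 1) else 0)" for i
  define h where "h j = (if 1 \<le> j \<and> j < n - 1 then a $$ (0, j) else 0)" for j
  have l: "l \<in> carrier_mat n n" by (simp add: l_def)
  have col: "a $$ (i, 0) = (if i = 0 then 1 else 0)" if "i < n" for i
    using a(1) that by (simp add: fixes_e1_def)
  have eq: "a = transvec n g (unit_fun (n - 1)) * (l * transvec n (unit_fun 0) h)"
  proof (rule eq_matI)
    fix i j assume "i < dim_row (transvec n g (unit_fun (n - 1)) * (l * transvec n (unit_fun 0) h))"
      "j < dim_col (transvec n g (unit_fun (n - 1)) * (l * transvec n (unit_fun 0) h))"
    then have ij: "i < n" "j < n" by auto
    have 0: "j = 0 \<Longrightarrow> a $$ (i, j) = (if i = 0 then 1 else 0)" and 1: "i = n - 1 \<Longrightarrow> a $$ (i, j) = (if j = n - 1 then 1 else 0)"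
      using col row ij by auto
    have lij: "l $$ (i, 0) = (if i = 0 then 1 else 0)" "l $$ (n - 1, j) = (if n - 1 = j then 1 else 0)"
      "l $$ (n - 1, 0) = 0"
      using ij n by (auto simp: l_def)
    have "(transvec n g (unit_fun (n - 1)) * (l * transvec n (unit_fun 0) h)) $$ (i, j)
      = l $$ (i, j) + (if i = 0 then h j else 0) + g i * (if n - 1 = j then 1 else 0)"
      using ij l n lij by (simp add: mult_transvec_index transvec_mult_index)
    also have "\<dots> = a $$ (i, j)"
    proof -
      consider "j = 0" | "i = n - 1" "j \<noteq> 0" | "j = n - 1" "i < n - 1" "j \<noteq> 0" | "i = 0" "1 \<le> j" "j < n - 1"
        | "1 \<le> i" "i < n - 1" "1 \<le> j" "j < n - 1"
        using ij by linarith
      then show ?thesis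
      proof cases
        case 1
        then show ?thesis using ij n 0 by (simp add: l_def g_def h_def)
      next
        case 2
        then show ?thesis using ij n 1 by (simp add: l_def g_def h_def)
      next
        case 3
        then show ?thesis using ij n by (simp add: l_def g_def h_def)
      next
        case 4
        then show ?thesis using ij n by (simp add: l_def g_def h_def)
      next
        case 5
        then show ?thesis using ij n by (simp add: l_def g_def h_def)
      qed
    qed
    finally show "a $$ (i, j) = (transvec n g (unit_fun (n - 1)) * (l * transvec n (unit_fun 0) h)) $$ (i, j)" ..
  qed (use a l in \<open>auto simp: fixes_e1_def\<close>)
  have "det a = det l"
    using l by (subst eq) (simp add: det_mult [of _ n] det_transvec_upper g_def h_def)
  then have "stab n f l (det l ^ 0)"
  proof (intro stab_block [OF inf f, where lo = 1 and hi = "n - 1"])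
    show "l $$ (i, j) = (if i = j then 1 else 0)" if "i < n" "j < n" "\<not> (1 \<le> i \<and> i < n - 1 \<and> 1 \<le> j \<and> j < n - 1)" for i j
      by (simp only: l_def index_mat(1) [OF that(1,2)] prod.case that(3) if_False)
    show "nu (Suc i) = - int 0" if "1 \<le> i" "i < n - 1" for i using nu [OF that] by simp
    show "det l \<noteq> 0" using a(2) \<open>det a = det l\<close> by metis
  qed (use l in auto)
  moreover have "stab n f (transvec n g (unit_fun (n - 1))) 1"
    by (rule stab_transvec_upper [OF f]) (auto simp: g_def)
  moreover have "stab n f (transvec n (unit_fun 0) h) 1"
    by (rule stab_transvec_upper [OF f]) (auto simp: h_def)
  ultimately have "stab n f (transvec n g (unit_fun (n - 1)) * (l * transvec n (unit_fun 0) h)) (1 * (det l ^ 0 * 1))"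
    by (intro stab_mult)
  then show ?thesis unfolding eq [symmetric] by simp
qed

text \<open>The case t = n-2. The entry p = det a in the second column forces the block on the
  remaining indices to have determinant 1, so this block has multiplier 1 whatever r is. Scaling by
  p at index 1 costs p^0, because the weight is 0 there.\<close>

lemma stab_parabolic_second_col:
  fixes f :: "'k::field mpoly"
  assumes inf: "infinite (UNIV :: 'k set)" and f: "f \<in> invU_wt n nu" and n: "n \<ge> 2"
    and nu: "nu 2 = 0" "\<And>i. 2 \<le> i \<Longrightarrow> i < n \<Longrightarrow> nu (Suc i) = - int r"
    and a: "fixes_e1 n a" "det a \<noteq> 0" and col: "\<And>i. 1 \<le> i \<Longrightarrow> i < n \<Longrightarrow> a $$ (i, 1) = (if i = 1 then det a else 0)"
  shows "stab n f a 1"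
proof -
  define p where "p = det a"
  define l where "l = mat n n (\<lambda>(i, j). if 2 \<le> i \<and> i < n \<and> 2 \<le> j \<and> j < n
    then a $$ (i, j) else if i = j then 1 else 0)"
  define g where "g j = (if 2 \<le> j then a $$ (1, j) / p else 0)" for j
  define h where "h j = (if 1 \<le> j then a $$ (0, j) else 0)" for j
  have p: "p \<noteq> 0" using a by (simp add: p_def)
  have l: "l \<in> carrier_mat n n" by (simp add: l_def)
  have col0: "a $$ (i, 0) = (if i = 0 then 1 else 0)" if "i < n" for i
    using a(1) that by (simp add: fixes_e1_def)
  have eq: "a = l * diag_at n 1 p * transvec n (unit_fun 1) g * transvec n (unit_fun 0) h"
  proof (rule eq_matI)
    fix i j assume "i < dim_row (l * diag_at n 1 p * transvec n (unit_fun 1) g * transvec n (unit_fun 0) h)"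
      "j < dim_col (l * diag_at n 1 p * transvec n (unit_fun 1) g * transvec n (unit_fun 0) h)"
    then have ij: "i < n" "j < n" using l by auto
    have 0: "j = 0 \<Longrightarrow> a $$ (i, j) = (if i = 0 then 1 else 0)"
      and 1: "j = 1 \<Longrightarrow> 1 \<le> i \<Longrightarrow> a $$ (i, j) = (if i = 1 then p else 0)"
      using col0 col ij by (auto simp: p_def)
    have "i = 0 \<or> i = 1 \<or> 2 \<le> i" "j = 0 \<or> j = 1 \<or> 2 \<le> j" by auto
    then show "a $$ (i, j) = (l * diag_at n 1 p * transvec n (unit_fun 1) g * transvec n (unit_fun 0) h) $$ (i, j)"
      using ij l n p 0 1
      by (simp add: mult_transvec_index mult_diag_at_index)
        (auto simp: l_def g_def h_def Suc_le_eq)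
  qed (use a l in \<open>auto simp: fixes_e1_def\<close>)
  have "p = det l * p"
    unfolding p_def using l n by (subst eq) (simp add: det_mult [of _ n] det_transvec_upper g_def h_def det_diag_at p_def)
  then have "det l = 1" using p by simp
  have "stab n f l (det l ^ r)"
  proof (rule stab_block [OF inf f, where lo = 2 and hi = n])
    show "l $$ (i, j) = (if i = j then 1 else 0)" if "i < n" "j < n" "\<not> (2 \<le> i \<and> i < n \<and> 2 \<le> j \<and> j < n)" for i j
      by (simp only: l_def index_mat(1) [OF that(1,2)] prod.case that(3) if_False)
  qed (use l nu \<open>det l = 1\<close> in auto)
  then have "stab n f l (1 ^ r)" by (simp only: \<open>det l = 1\<close>)
  moreover have "stab n f (diag_at n 1 p) (p ^ 0)"
    using n p nu by (intro stab_diag_at [OF f]) (auto simp: numeral_2_eq_2)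
  moreover have "stab n f (transvec n (unit_fun 1) g) 1"
    by (rule stab_transvec_upper [OF f]) (auto simp: g_def)
  moreover have "stab n f (transvec n (unit_fun 0) h) 1"
    by (rule stab_transvec_upper [OF f]) (auto simp: h_def)
  ultimately have "stab n f (l * diag_at n 1 p * transvec n (unit_fun 1) g * transvec n (unit_fun 0) h) (1 ^ r * p ^ 0 * 1 * 1)"
    by (intro stab_mult)
  then show ?thesis unfolding eq [symmetric] by simp
qed

text \<open>The case t = n-1. The weight is constant on all indices but the first, so the whole
  lower right block acts, through a power of its determinant, which is det a.\<close>

lemma stab_parabolic_first_col:
  fixes f :: "'k::field mpoly"
  assumes inf: "infinite (UNIV :: 'k set)" and f: "f \<in> invU_wt n nu"
    and nu: "\<And>i. 1 \<le> i \<Longrightarrow> i < n \<Longrightarrow> nu (Suc i) = - int r"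
    and a: "fixes_e1 n a" "det a \<noteq> 0"
  shows "stab n f a (det a ^ r)"
proof -
  define l where "l = mat n n (\<lambda>(i, j). if 1 \<le> i \<and> i < n \<and> 1 \<le> j \<and> j < n
    then a $$ (i, j) else if i = j then 1 else 0)"
  define h where "h j = (if 1 \<le> j then a $$ (0, j) else 0)" for j
  have l: "l \<in> carrier_mat n n" by (simp add: l_def)
  have col: "a $$ (i, 0) = (if i = 0 then 1 else 0)" if "i < n" for i
    using a(1) that by (simp add: fixes_e1_def)
  have eq: "a = l * transvec n (unit_fun 0) h"
  proof (rule eq_matI)
    fix i j assume "i < dim_row (l * transvec n (unit_fun 0) h)" "j < dim_col (l * transvec n (unit_fun 0) h)"
    then have ij: "i < n" "j < n" using l by auto
    have 0: "j = 0 \<Longrightarrow> a $$ (i, j) = (if i = 0 then 1 else 0)"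
      using col ij by auto
    show "a $$ (i, j) = (l * transvec n (unit_fun 0) h) $$ (i, j)"
      using ij l 0 by (simp add: mult_transvec_index) (auto simp: l_def h_def Suc_le_eq)
  qed (use a l in \<open>auto simp: fixes_e1_def\<close>)
  have det: "det a = det l"
    using l by (subst eq) (simp add: det_mult [of _ n] det_transvec_upper h_def)
  then have "stab n f l (det l ^ r)"
  proof (intro stab_block [OF inf f, where lo = 1 and hi = n])
    show "l $$ (i, j) = (if i = j then 1 else 0)" if "i < n" "j < n" "\<not> (1 \<le> i \<and> i < n \<and> 1 \<le> j \<and> j < n)" for i j
      by (simp only: l_def index_mat(1) [OF that(1,2)] prod.case that(3) if_False)
    show "nu (Suc i) = - int r" if "1 \<le> i" "i < n" for i using nu [OF that] .
    show "det l \<noteq> 0" using a(2) det by metis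
  qed (use l in auto)
  moreover have "stab n f (transvec n (unit_fun 0) h) 1"
    by (rule stab_transvec_upper [OF f]) (auto simp: h_def)
  ultimately have "stab n f (l * transvec n (unit_fun 0) h) (det l ^ r * 1)"
    by (rule stab_mult)
  then show ?thesis unfolding eq [symmetric] by (simp add: det)
qed

section \<open>Algebraic independence and generation from a section\<close>

lemma obtain_inverse_mat:
  fixes A :: "'k::field mat"
  assumes A: "A \<in> carrier_mat n n" and det: "det A \<noteq> 0"
  obtains B where "B \<in> carrier_mat n n" "A * B = 1\<^sub>m n" "B * A = 1\<^sub>m n"
proof
  let ?B = "inverse (det A) \<cdot>\<^sub>m adj_mat A"
  note adj = adj_mat [OF A]
  have 1: "inverse (det A) \<cdot>\<^sub>m (det A \<cdot>\<^sub>m 1\<^sub>m n) = 1\<^sub>m n"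
    using det by (intro eq_matI) auto
  show "?B \<in> carrier_mat n n" using adj by simp
  show "A * ?B = 1\<^sub>m n"
    using A adj det by (simp add: mult_smult_distrib [of _ n n _ n] 1)
  show "?B * A = 1\<^sub>m n"
    using A adj det by (simp add: mult_smult_assoc_mat [of _ n n _ n] 1)
qed

lemma mpeval_detm [simp]: "mpeval x (detm rs cs A) = detm rs cs (\<lambda>i j. mpeval x (A i j))"
  by (simp add: detm_def)

lemma detm_polys:
  assumes "\<And>i j. i \<in> set rs \<Longrightarrow> j \<in> set cs \<Longrightarrow> A i j \<in> polys n" "length rs \<le> length cs"
  shows "detm rs cs A \<in> polys n"
  unfolding detm_def
proof (intro polys_sum polys_mult polys_of_int polys_prod)
  fix p a assume "p \<in> {p. p permutes {..<length rs}}" "a \<in> {..<length rs}"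
  then have "p a < length rs" "a < length rs" using permutes_in_image [of p "{..<length rs}" a] by auto
  then show "A (rs ! a) (cs ! p a) \<in> polys n"
    using assms by (intro assms(1)) auto
qed

abbreviation row_grad :: "nat \<Rightarrow> nat \<Rightarrow> nat \<Rightarrow> 'k::comm_ring_1 mpoly" where
  "row_grad n \<equiv> (\<lambda>i j. pdiff (1, i) (s_inv n j))"

lemma row_grad_polys: "row_grad n i j \<in> polys n"
  by (simp add: polys_pdiff)

lemma krylov_index: "i < n \<Longrightarrow> j < n \<Longrightarrow> krylov n A $$ (i, j) = mev A (row_grad n (Suc i) (Suc j))"
  by (simp add: krylov_def grad_def)

text \<open>Up to sign the determinant with columns e_1, A e_1, ..., A^(n-1) e_1; it does not vanish
  exactly where e_1 is cyclic.\<close>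

definition krylov_det :: "nat \<Rightarrow> 'k::comm_ring_1 mpoly" where
  "krylov_det n = detm [1..<n + 1] [1..<n + 1] (row_grad n)"

lemma mev_krylov_det: "mev A (krylov_det n) = det (krylov n A)"
  unfolding krylov_det_def mpeval_detm
  by (subst detm_eq_det [of _ n])
    (auto simp: krylov_index simp del: upt_Suc intro!: arg_cong [where f = det] eq_matI)

lemma krylov_det_polys: "krylov_det n \<in> polys n"
  unfolding krylov_det_def by (intro detm_polys row_grad_polys) simp

lemma krylov_det_nonzero:
  assumes "infinite (UNIV :: 'k::field set)" "n > 0"
  shows "mev (companion n (\<lambda>_. 0) :: 'k mat) (krylov_det n) = 1"
  using krylov_shift [OF assms] by (simp add: mev_krylov_det)

text \<open>Conjugating a generic A by matrices fixing the first basis vector realises every value w of the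
  generators, while the invariant coefficients keep their values.\<close>

lemma alg_indep_core:
  fixes u :: "'a \<Rightarrow> 'k::field mpoly"
  assumes inf: "infinite (UNIV :: 'k set)" and n: "n > 0" and S: "finite S"
    and mn: "\<And>A s. A \<in> carrier_mat n n \<Longrightarrow> s \<in> S \<Longrightarrow> mev A (u s) = mn s (krylov n A)"
    and Q: "\<And>w. (\<forall>s\<in>S. w s \<noteq> 0) \<Longrightarrow> fixes_e1 n (Q w) \<and> det (Q w) \<noteq> 0 \<and> (\<forall>s\<in>S. mn s (Q w) = w s)"
  shows "alg_indep_over (invG n) S u"
  unfolding alg_indep_over_def
proof (intro allI impI ballI)
  fix E :: "('a \<Rightarrow> nat) set" and c \<alpha>
  assume *: "finite E \<and> E \<subseteq> exps S \<and> (\<forall>\<alpha>\<in>E. c \<alpha> \<in> invG n) \<and> (\<Sum>\<alpha>\<in>E. c \<alpha> * (\<Prod>s\<in>S. u s ^ \<alpha> s)) = 0"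
    and \<alpha>: "\<alpha> \<in> E"
  then have E: "finite E" "E \<subseteq> exps S" and c: "\<And>\<alpha>. \<alpha> \<in> E \<Longrightarrow> c \<alpha> \<in> invG n"
    and rel: "(\<Sum>\<alpha>\<in>E. c \<alpha> * (\<Prod>s\<in>S. u s ^ \<alpha> s)) = 0" by auto
  have cp: "c \<alpha> \<in> polys n" if "\<alpha> \<in> E" for \<alpha> using c [OF that] by (simp add: invG_def)
  show "c \<alpha> = 0"
  proof (rule mpeval_mult_eq_0_imp [OF inf])
    show "mpeval (entries (companion n (\<lambda>_. 0))) (krylov_det n) \<noteq> (0 :: 'k)"
      by (simp add: krylov_det_nonzero inf n)
    fix x :: "nat \<Rightarrow> nat \<Rightarrow> 'k"
    define A where "A = to_mat n x"
    define G where "G = krylov n A"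
    have A: "A \<in> carrier_mat n n" and G: "G \<in> carrier_mat n n" by (simp_all add: A_def G_def)
    assume "mpeval x (krylov_det n) \<noteq> 0"
    then have "det G \<noteq> 0"
      by (simp add: G_def A_def mev_krylov_det [symmetric] mpeval_entries_to_mat krylov_det_polys)
    then obtain Gi where Gi: "Gi \<in> carrier_mat n n" "G * Gi = 1\<^sub>m n" "Gi * G = 1\<^sub>m n"
      using obtain_inverse_mat [OF G] by blast
    have e1G: "fixes_e1 n G"
      unfolding G_def by (rule fixes_e1_krylov [OF inf A n])
    have "mev A (c \<alpha>) = 0"
    proof (rule monomials_lin_indep [OF inf S E _ \<alpha>])
      fix w :: "'a \<Rightarrow> 'k" assume w: "\<forall>s\<in>S. w s \<noteq> 0"
      have q: "fixes_e1 n (Q w)" "det (Q w) \<noteq> 0" "\<And>s. s \<in> S \<Longrightarrow> mn s (Q w) = w s"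
        using Q [OF w] by auto
      have qc: "Q w \<in> carrier_mat n n" using q(1) by (rule fixes_e1_carrier)
      then obtain Qi where Qi: "Qi \<in> carrier_mat n n" "Q w * Qi = 1\<^sub>m n" "Qi * Q w = 1\<^sub>m n"
        using obtain_inverse_mat q(2) by blast
      \<comment> \<open>The matrix that carries the cyclic basis G of A to \<open>Q w\<close>. It
        fixes e_1 because \<open>Q w\<close> and G do, so \<open>krylov_conj\<close>
        applies.\<close>
      define a where "a = Q w * Gi"
      define b where "b = G * Qi"
      have ab: "a \<in> carrier_mat n n" "b \<in> carrier_mat n n" "a * b = 1\<^sub>m n" "b * a = 1\<^sub>m n"
        unfolding a_def b_def using qc Qi G Gi by (auto intro: inverse_mult)
      have e1a: "fixes_e1 n a"
        unfolding a_def using q(1) fixes_e1_inverse [OF e1G Gi(1,3)] by (rule fixes_e1_mult)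
      have "krylov n (a * A * b) = a * G"
        unfolding G_def by (rule krylov_conj [OF inf A e1a ab(2-)])
      also have "\<dots> = Q w * (Gi * G)"
        unfolding a_def using qc Gi(1) G by (simp add: assoc_mult_mat [of _ n n _ n _ n])
      finally have krylov: "krylov n (a * A * b) = Q w" using Gi qc by simp
      have "0 = mev (a * A * b) (\<Sum>\<alpha>\<in>E. c \<alpha> * (\<Prod>s\<in>S. u s ^ \<alpha> s))"
        by (simp only: rel mpeval_0)
      also have "\<dots> = (\<Sum>\<alpha>\<in>E. mev (a * A * b) (c \<alpha>) * (\<Prod>s\<in>S. mev (a * A * b) (u s) ^ \<alpha> s))"
        by simp
      also have "\<dots> = (\<Sum>\<alpha>\<in>E. mev A (c \<alpha>) * (\<Prod>s\<in>S. w s ^ \<alpha> s))"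
      proof (intro sum.cong arg_cong2 [where f = "(*)"] prod.cong refl)
        show "mev (a * A * b) (c \<alpha>) = mev A (c \<alpha>)" if "\<alpha> \<in> E" for \<alpha>
          using c [OF that] A ab unfolding invG_iff by blast
        show "mev (a * A * b) (u s) ^ \<alpha> s = w s ^ \<alpha> s" if "s \<in> S" for s and \<alpha> :: "'a \<Rightarrow> nat"
          using mn [of "a * A * b" s] that A ab krylov q(3) by simp
      qed
      finally show "(\<Sum>\<alpha>\<in>E. mev A (c \<alpha>) * (\<Prod>s\<in>S. w s ^ \<alpha> s)) = 0" ..
    qed
    then show "mpeval x (c \<alpha>) = 0"
      by (simp add: A_def mpeval_entries_to_mat cp [OF \<alpha>])
  qed
qed

section \<open>Weight spaces and generated subalgebras\<close>

lemma invG_imp_polys: "f \<in> invG n \<Longrightarrow> f \<in> polys n"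
  by (simp add: invG_def)

lemma invU_wt_imp_polys: "f \<in> invU_wt n nu \<Longrightarrow> f \<in> polys n"
  by (simp add: invU_wt_def)

lemma diag_fun_inverse:
  assumes "\<forall>i<n. d i \<noteq> (0 :: 'k::field)"
  shows "diag_fun n (\<lambda>i. inverse (d i)) * diag_fun n d = 1\<^sub>m n" "diag_fun n d * diag_fun n (\<lambda>i. inverse (d i)) = 1\<^sub>m n"
  unfolding diag_fun_mult using assms by (auto simp: diag_fun_def intro!: eq_matI)

lemma invG_subset_invU_wt: "invG n \<subseteq> invU_wt n (\<lambda>_. 0)"
proof
  fix f :: "'k::field mpoly" assume f: "f \<in> invG n"
  then have inv: "\<And>a b A. a \<in> carrier_mat n n \<Longrightarrow> b \<in> carrier_mat n n \<Longrightarrow> A \<in> carrier_mat n n \<Longrightarrow>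
     a * b = 1\<^sub>m n \<Longrightarrow> b * a = 1\<^sub>m n \<Longrightarrow> mev (a * A * b) f = mev A f"
    unfolding invG_iff by blast
  show "f \<in> invU_wt n (\<lambda>_. 0)"
    unfolding invU_wt_iff
  proof (intro conjI allI impI)
    fix d :: "nat \<Rightarrow> 'k" and A :: "'k mat" assume "\<forall>i<n. d i \<noteq> 0" "A \<in> carrier_mat n n"
    then show "mev (diag_fun n (\<lambda>i. inverse (d i)) * A * diag_fun n d) f = torus_char n (\<lambda>_. 0) d * mev A f"
      using inv [of "diag_fun n (\<lambda>i. inverse (d i))" "diag_fun n d" A] diag_fun_inverse [of n d]
      by (simp add: torus_char_def)
  qed (use inv f in \<open>auto simp: unitri_def invG_imp_polys\<close>)
qed

lemma invU_wt_mult: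
  assumes "f \<in> invU_wt n nu" "g \<in> invU_wt n nu'"
  shows "f * g \<in> invU_wt n (\<lambda>i. nu i + nu' i)"
proof -
  have "torus_char n (\<lambda>i. nu i + nu' i) d = torus_char n nu d * torus_char n nu' d" if "\<forall>i<n. d i \<noteq> 0" for d :: "nat \<Rightarrow> 'a"
    unfolding torus_char_def prod.distrib [symmetric] using that
    by (intro prod.cong) (auto simp: power_int_add)
  then show ?thesis
    using assms unfolding invU_wt_iff by auto
qed

lemma invU_wt_1: "1 \<in> invU_wt n (\<lambda>_. 0)"
  by (auto simp: invU_wt_iff torus_char_def)

lemma invU_wt_0: "0 \<in> invU_wt n nu"
  by (auto simp: invU_wt_iff)

lemma invU_wt_add:
  assumes "f \<in> invU_wt n nu" "g \<in> invU_wt n nu"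
  shows "f + g \<in> invU_wt n nu"
  using assms unfolding invU_wt_iff by (auto simp: distrib_left)

lemma invU_wt_sum: "(\<And>a. a \<in> A \<Longrightarrow> f a \<in> invU_wt n nu) \<Longrightarrow> sum f A \<in> invU_wt n nu"
  by (induction A rule: infinite_finite_induct) (auto simp: invU_wt_0 intro: invU_wt_add)

lemma invU_wt_power: "f \<in> invU_wt n nu \<Longrightarrow> f ^ k \<in> invU_wt n (\<lambda>i. int k * nu i)"
proof (induction k)
  case (Suc k)
  then have "f * f ^ k \<in> invU_wt n (\<lambda>i. nu i + int k * nu i)" by (intro invU_wt_mult) auto
  then show ?case by (simp add: distrib_right)
qed (simp add: invU_wt_1)

lemma invU_wt_monomial:
  assumes "finite S" "\<And>s. s \<in> S \<Longrightarrow> u s \<in> invU_wt n nu"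
  shows "(\<Prod>s\<in>S. u s ^ \<alpha> s) \<in> invU_wt n (\<lambda>i. int (sum \<alpha> S) * nu i)"
  using assms
proof (induction S rule: finite_induct)
  case (insert a S)
  then have "u a ^ \<alpha> a * (\<Prod>s\<in>S. u s ^ \<alpha> s) \<in> invU_wt n (\<lambda>i. int (\<alpha> a) * nu i + int (sum \<alpha> S) * nu i)"
    by (intro invU_wt_mult invU_wt_power) auto
  then show ?case using insert.hyps by (simp add: distrib_right)
qed (simp add: invU_wt_1)

lemma alg_generated_0: "0 \<in> alg_generated R S u"
  unfolding alg_generated_def by (auto intro!: exI [of _ "{}"])

lemma alg_generated_add:
  assumes R: "0 \<in> R" "\<And>p q. p \<in> R \<Longrightarrow> q \<in> R \<Longrightarrow> p + q \<in> R"
    and "f \<in> alg_generated R S u" "g \<in> alg_generated R S u"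
  shows "f + g \<in> alg_generated R S u"
proof -
  obtain E c where E: "finite E" "E \<subseteq> exps S" "\<And>\<alpha>. \<alpha> \<in> E \<Longrightarrow> c \<alpha> \<in> R" "f = (\<Sum>\<alpha>\<in>E. c \<alpha> * (\<Prod>s\<in>S. u s ^ \<alpha> s))"
    using assms(3) unfolding alg_generated_def by blast
  obtain F d where F: "finite F" "F \<subseteq> exps S" "\<And>\<alpha>. \<alpha> \<in> F \<Longrightarrow> d \<alpha> \<in> R" "g = (\<Sum>\<alpha>\<in>F. d \<alpha> * (\<Prod>s\<in>S. u s ^ \<alpha> s))"
    using assms(4) unfolding alg_generated_def by blast
  define c' where "c' \<alpha> = (if \<alpha> \<in> E then c \<alpha> else 0)" for \<alpha>
  define d' where "d' \<alpha> = (if \<alpha> \<in> F then d \<alpha> else 0)" for \<alpha>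
  have "f = (\<Sum>\<alpha>\<in>E \<union> F. c' \<alpha> * (\<Prod>s\<in>S. u s ^ \<alpha> s))"
    unfolding E(4) using E(1) F(1) by (intro sum.mono_neutral_cong_left) (auto simp: c'_def)
  moreover have "g = (\<Sum>\<alpha>\<in>E \<union> F. d' \<alpha> * (\<Prod>s\<in>S. u s ^ \<alpha> s))"
    unfolding F(4) using E(1) F(1) by (intro sum.mono_neutral_cong_left) (auto simp: d'_def)
  ultimately have "f + g = (\<Sum>\<alpha>\<in>E \<union> F. (c' \<alpha> + d' \<alpha>) * (\<Prod>s\<in>S. u s ^ \<alpha> s))"
    by (simp add: sum.distrib distrib_right)
  moreover have "c' \<alpha> + d' \<alpha> \<in> R" for \<alpha>
    using R E(3) F(3) by (auto simp: c'_def d'_def)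
  ultimately show ?thesis
    unfolding alg_generated_def using E F by (auto intro!: exI [of _ "E \<union> F"])
qed

lemma alg_generated_sum:
  assumes "0 \<in> R" "\<And>p q. p \<in> R \<Longrightarrow> q \<in> R \<Longrightarrow> p + q \<in> R" "\<And>a. a \<in> A \<Longrightarrow> f a \<in> alg_generated R S u"
  shows "sum f A \<in> alg_generated R S u"
  using assms(3) by (induction A rule: infinite_finite_induct)
    (auto simp: alg_generated_0 intro: alg_generated_add assms(1,2))

lemma invG_0: "0 \<in> invG n" and invG_add: "p \<in> invG n \<Longrightarrow> q \<in> invG n \<Longrightarrow> p + q \<in> invG n"
  by (auto simp: invG_def)

text \<open>Collect the terms of each total degree r: the coefficients have weight 0 and each
  generator has weight nu, so these terms have weight r nu.\<close>

lemma alg_generated_subset_wt_algebra: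
  assumes S: "finite S" and u: "\<And>s. s \<in> S \<Longrightarrow> u s \<in> invU_wt n nu"
  shows "alg_generated (invG n) S u \<subseteq> wt_algebra n nu"
proof
  fix f assume "f \<in> alg_generated (invG n) S u"
  then obtain E c where E: "finite E" "\<And>\<alpha>. \<alpha> \<in> E \<Longrightarrow> c \<alpha> \<in> invG n"
    and f: "f = (\<Sum>\<alpha>\<in>E. c \<alpha> * (\<Prod>s\<in>S. u s ^ \<alpha> s))"
    unfolding alg_generated_def by blast
  define F where "F = (\<lambda>\<alpha>. sum \<alpha> S) ` E"
  define g where "g r = (\<Sum>\<alpha> | \<alpha> \<in> E \<and> sum \<alpha> S = r. c \<alpha> * (\<Prod>s\<in>S. u s ^ \<alpha> s))" for r
  have "f = sum g F"
    unfolding f g_def F_def using E(1) by (intro sum.group [symmetric]) auto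
  moreover have "g r \<in> invU_wt n (\<lambda>i. int r * nu i)" for r
    unfolding g_def
  proof (rule invU_wt_sum)
    fix \<alpha> assume "\<alpha> \<in> {\<alpha> \<in> E. sum \<alpha> S = r}"
    then have "c \<alpha> \<in> invU_wt n (\<lambda>_. 0)" "sum \<alpha> S = r" using E(2) invG_subset_invU_wt by blast+
    moreover have "(\<Prod>s\<in>S. u s ^ \<alpha> s) \<in> invU_wt n (\<lambda>i. int (sum \<alpha> S) * nu i)"
      by (rule invU_wt_monomial [OF S u])
    ultimately show "c \<alpha> * (\<Prod>s\<in>S. u s ^ \<alpha> s) \<in> invU_wt n (\<lambda>i. int r * nu i)"
      using invU_wt_mult by fastforce
  qed
  ultimately show "f \<in> wt_algebra n nu"
    unfolding wt_algebra_def using E(1) by (auto simp: F_def)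
qed

section \<open>Restriction to companion matrices\<close>

lemma companion_cong: "(\<And>j. j \<le> n \<Longrightarrow> s j = s' j) \<Longrightarrow> companion n s = companion n s'"
  by (intro eq_matI) (auto simp: companion_def)

text \<open>Restricts p to the companion matrices, a section of the invariants s_1, ..., s_n, and
  pulls the result back to all A. It is the source of all coefficients in
  \<open>invG n\<close>.\<close>

definition companion_subst :: "nat \<Rightarrow> 'k::field mpoly \<Rightarrow> 'k mpoly" where
  "companion_subst n p = mpsubst (\<lambda>i j. (if i = 1 then s_inv n j else 0) - (if i = j + 1 then 1 else 0)) p"

lemma mev_companion_subst:
  assumes "p \<in> polys n"
  shows "mev A (companion_subst n p) = mev (companion n (s_mat n A)) p"
  unfolding companion_subst_def mpeval_mpsubst
  by (rule mpeval_cong [OF assms]) (auto simp: entries_def companion_def)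

lemma companion_subst_invG:
  assumes inf: "infinite (UNIV :: 'k::field set)" and p: "(p :: 'k mpoly) \<in> polys n"
  shows "companion_subst n p \<in> invG n"
  unfolding invG_iff
proof (intro conjI allI impI)
  show "companion_subst n p \<in> polys n"
    unfolding companion_subst_def by (rule polys_mpsubst [OF p]) auto
  fix a b A :: "'k mat" 
  assume "a \<in> carrier_mat n n" "b \<in> carrier_mat n n" "A \<in> carrier_mat n n" "a * b = 1\<^sub>m n" "b * a = 1\<^sub>m n"
  then have "companion n (s_mat n (a * A * b)) = companion n (s_mat n A)"
    by (intro companion_cong s_mat_conj [OF inf])
  then show "mev (a * A * b) (companion_subst n p) = mev A (companion_subst n p)"
    by (simp add: mev_companion_subst [OF p])
qed

text \<open>A generic A equals q C q', where q' is inverse to q, q is its cyclic basis and the entries of C are invariants;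
  hence the coefficients mev C (c \<alpha>) in the last hypothesis become invariants of A.\<close>

lemma alg_generated_core:
  fixes u :: "'a \<Rightarrow> 'k::field mpoly"
  assumes inf: "infinite (UNIV :: 'k set)" and n: "n > 0" and S: "finite S"
    and mn: "\<And>A s. A \<in> carrier_mat n n \<Longrightarrow> s \<in> S \<Longrightarrow> mev A (u s) = mn s (krylov n A)"
    and Q: "\<And>w. (\<forall>s\<in>S. w s \<noteq> 0) \<Longrightarrow> fixes_e1 n (Q w) \<and> det (Q w) \<noteq> 0 \<and> (\<forall>s\<in>S. mn s (Q w) = w s)"
    and u: "\<And>s. s \<in> S \<Longrightarrow> u s \<in> invU_wt n nu"
    and gen: "\<And>r f. f \<in> invU_wt n (\<lambda>i. int r * nu i) \<Longrightarrow>
      \<exists>E c. finite E \<and> E \<subseteq> exps S \<and> (\<forall>\<alpha>. c \<alpha> \<in> polys n) \<and>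
        (\<forall>q qi C. fixes_e1 n q \<longrightarrow> qi \<in> carrier_mat n n \<longrightarrow> q * qi = 1\<^sub>m n \<longrightarrow> qi * q = 1\<^sub>m n \<longrightarrow>
           C \<in> carrier_mat n n \<longrightarrow> (\<forall>s\<in>S. mn s q \<noteq> 0) \<longrightarrow>
           mev (q * C * qi) f = (\<Sum>\<alpha>\<in>E. mev C (c \<alpha>) * (\<Prod>s\<in>S. mn s q ^ \<alpha> s)))"
  shows "alg_generated (invG n) S u = wt_algebra n nu"
proof
  show "alg_generated (invG n) S u \<subseteq> wt_algebra n nu"
    by (rule alg_generated_subset_wt_algebra [OF S u])
  have "f \<in> alg_generated (invG n) S u" if f: "f \<in> invU_wt n (\<lambda>i. int r * nu i)" for f r
  proof -
    obtain E c where E: "finite E" "E \<subseteq> exps S" and c: "\<And>\<alpha>. c \<alpha> \<in> polys n"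
      and fq: "\<And>q qi C. fixes_e1 n q \<Longrightarrow> qi \<in> carrier_mat n n \<Longrightarrow> q * qi = 1\<^sub>m n \<Longrightarrow> qi * q = 1\<^sub>m n \<Longrightarrow>
           C \<in> carrier_mat n n \<Longrightarrow> (\<forall>s\<in>S. mn s q \<noteq> 0) \<Longrightarrow>
           mev (q * C * qi) f = (\<Sum>\<alpha>\<in>E. mev C (c \<alpha>) * (\<Prod>s\<in>S. mn s q ^ \<alpha> s))"
      using gen [OF f] by blast
    define c' where "c' \<alpha> = companion_subst n (c \<alpha>)" for \<alpha>
    define g where "g = (\<Sum>\<alpha>\<in>E. c' \<alpha> * (\<Prod>s\<in>S. u s ^ \<alpha> s))"
    have c': "c' \<alpha> \<in> invG n" for \<alpha>
      unfolding c'_def by (rule companion_subst_invG [OF inf c])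
    have up: "u s \<in> polys n" if "s \<in> S" for s using u [OF that] by (rule invU_wt_imp_polys)
    have gp: "g \<in> polys n"
      unfolding g_def using c' up by (intro polys_sum polys_mult polys_prod polys_power) (auto simp: invG_imp_polys)
    have fp: "f \<in> polys n" using f by (rule invU_wt_imp_polys)
    \<comment> \<open>Non-zero exactly where e_1 is cyclic and every generator is non-zero; the
      expansion of f is available there.\<close>
    let ?d = "krylov_det n * (\<Prod>s\<in>S. u s)"
    have dp: "?d \<in> polys n" using up by (intro polys_mult krylov_det_polys polys_prod) auto
    obtain A0 where "A0 \<in> carrier_mat n n" "mev A0 ?d \<noteq> 0"
    proof -
      have q: "fixes_e1 n (Q (\<lambda>_. 1))" "det (Q (\<lambda>_. 1)) \<noteq> 0" "\<And>s. s \<in> S \<Longrightarrow> mn s (Q (\<lambda>_. 1)) = 1"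
        using Q [of "\<lambda>_. 1"] by auto
      have qc: "Q (\<lambda>_. 1) \<in> carrier_mat n n" using q(1) by (rule fixes_e1_carrier)
      then obtain Qi where Qi: "Qi \<in> carrier_mat n n" "Q (\<lambda>_. 1) * Qi = 1\<^sub>m n" "Qi * Q (\<lambda>_. 1) = 1\<^sub>m n"
        using obtain_inverse_mat q(2) by blast
      \<comment> \<open>Conjugating the nilpotent companion matrix by
        \<open>Q (\<lambda>_. 1)\<close> gives a point with this cyclic basis, where all generators
        take the value 1. So the open set is not empty.\<close>
      define A where "A = Q (\<lambda>_. 1) * companion n (\<lambda>_. 0) * Qi"
      have A: "A \<in> carrier_mat n n" using qc Qi by (auto simp: A_def)
      have "krylov n A = Q (\<lambda>_. 1)"
        unfolding A_def using krylov_conj [OF inf companion_carrier(1) q(1) Qi] krylov_shift [OF inf n] qc by simp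
      then have "mev A ?d \<noteq> 0"
        using q S A by (simp add: mev_krylov_det mn)
      with A that show thesis by blast
    qed
    moreover have "f = g" if nz: "mpeval y ?d \<noteq> 0" for y
    proof (rule mpeval_ext_generic [OF inf _ nz])
      fix x :: "nat \<Rightarrow> nat \<Rightarrow> 'k"
      define A where "A = to_mat n x"
      define G where "G = krylov n A"
      have A: "A \<in> carrier_mat n n" and G: "G \<in> carrier_mat n n" by (simp_all add: A_def G_def)
      assume "mpeval x ?d \<noteq> 0"
      moreover have "mev A ?d = mpeval x ?d" unfolding A_def by (rule mpeval_entries_to_mat [OF dp])
      ultimately have "mev A ?d \<noteq> 0" by (simp only: not_False_eq_True)
      then have "det G \<noteq> 0" and u0: "\<And>s. s \<in> S \<Longrightarrow> mev A (u s) \<noteq> 0"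
        using S by (auto simp: G_def mev_krylov_det)
      then obtain Gi where Gi: "Gi \<in> carrier_mat n n" "G * Gi = 1\<^sub>m n" "Gi * G = 1\<^sub>m n"
        using obtain_inverse_mat [OF G] by blast
      let ?C = "companion n (s_mat n A)"
      have "G * ?C * Gi = A * G * Gi"
        unfolding G_def krylov_companion [OF inf A n] ..
      also have "\<dots> = A" using A G Gi by (simp add: assoc_mult_mat [of _ n n _ n _ n])
      finally have "mev A f = mev (G * ?C * Gi) f" by simp
      also have "\<dots> = (\<Sum>\<alpha>\<in>E. mev ?C (c \<alpha>) * (\<Prod>s\<in>S. mn s G ^ \<alpha> s))"
        using Gi fixes_e1_krylov [OF inf A n] u0 mn [OF A] by (intro fq) (auto simp: G_def)
      also have "\<dots> = mev A g"
        unfolding g_def using mn [OF A] by (simp add: c'_def mev_companion_subst [OF c] G_def)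
      finally show "mpeval x f = mpeval x g"
        by (simp add: A_def mpeval_entries_to_mat fp gp)
    qed
    ultimately have "f = g" by blast
    then show ?thesis
      unfolding alg_generated_def g_def using E c' by blast
  qed
  then show "wt_algebra n nu \<subseteq> alg_generated (invG n) S u"
    unfolding wt_algebra_def by (auto intro!: alg_generated_sum invG_0 invG_add)
qed

text \<open>Along a line \<tau> z the terms of total degree m make up the coefficient of \<tau>^m.
  So a degree bound on the lines with non-zero coordinates kills all terms of total degree above r,
  and w_p^r clears the denominators of what is left, giving a form of degree r in w.\<close>

lemma homogenize:
  fixes \<Phi> :: "('a \<Rightarrow> 'k::field) \<Rightarrow> (nat \<Rightarrow> nat \<Rightarrow> 'k) \<Rightarrow> 'k"
  assumes inf: "infinite (UNIV :: 'k set)" and S: "finite S" and p: "p \<in> S" and \<Phi>: "param_poly (S - {p}) n \<Phi>"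
    and deg: "\<And>z x. (\<forall>s\<in>S - {p}. z s \<noteq> 0) \<Longrightarrow> \<exists>P. degree P \<le> r \<and> (\<forall>\<tau>. \<Phi> (\<lambda>s. \<tau> * z s) x = poly P \<tau>)"
  shows "\<exists>E c. finite E \<and> E \<subseteq> exps S \<and> (\<forall>\<alpha>. c \<alpha> \<in> polys n) \<and> (\<forall>w x. w p \<noteq> 0 \<longrightarrow>
     w p ^ r * \<Phi> (\<lambda>s. w s / w p) x = (\<Sum>\<alpha>\<in>E. mpeval x (c \<alpha>) * (\<Prod>s\<in>S. w s ^ \<alpha> s)))"
proof -
  let ?Z = "S - {p}"
  obtain E c where E: "finite E" "E \<subseteq> exps ?Z" and c: "\<And>\<alpha>. c \<alpha> \<in> polys n"
    and \<Phi>_eq: "\<And>z x. \<Phi> z x = (\<Sum>\<alpha>\<in>E. mpeval x (c \<alpha>) * (\<Prod>s\<in>?Z. z s ^ \<alpha> s))"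
    using \<Phi> unfolding param_poly_def by blast
  have Z: "finite ?Z" using S by simp
  have high: "mpeval x (c \<alpha>) = 0" if \<alpha>: "\<alpha> \<in> E" "sum \<alpha> ?Z > r" for \<alpha> x
  proof -
    let ?E = "{\<beta> \<in> E. sum \<beta> ?Z = sum \<alpha> ?Z}"
    show ?thesis
    proof (rule monomials_lin_indep [OF inf Z, where E = ?E])
      show "finite ?E" "?E \<subseteq> exps ?Z" "\<alpha> \<in> ?E" using E \<alpha> by auto
      fix z :: "'a \<Rightarrow> 'k" assume "\<forall>s\<in>?Z. z s \<noteq> 0"
      then obtain P where P: "degree P \<le> r" "\<And>\<tau>. \<Phi> (\<lambda>s. \<tau> * z s) x = poly P \<tau>"
        using deg by blast
      \<comment> \<open>\<Phi> along the line, with its terms sorted by total degree. A degree above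
        r cannot occur, so the terms of the degree of \<alpha> satisfy a linear relation for all
        such z.\<close>
      let ?R = "\<Sum>\<beta>\<in>E. monom (mpeval x (c \<beta>) * (\<Prod>s\<in>?Z. z s ^ \<beta> s)) (sum \<beta> ?Z)"
      have "?R = P"
      proof (rule poly_eqI_infinite [OF inf])
        fix \<tau>
        show "poly ?R \<tau> = poly P \<tau>"
          by (simp add: P(2) [symmetric] \<Phi>_eq poly_sum poly_monom power_mult_distrib prod.distrib power_sum mult_ac)
      qed
      then have "0 = coeff ?R (sum \<alpha> ?Z)"
        using P(1) \<alpha>(2) by (simp add: coeff_eq_0)
      also have "\<dots> = (\<Sum>\<beta>\<in>E. if sum \<beta> ?Z = sum \<alpha> ?Z then mpeval x (c \<beta>) * (\<Prod>s\<in>?Z. z s ^ \<beta> s) else 0)"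
        by (simp add: coeff_sum)
      also have "\<dots> = (\<Sum>\<beta>\<in>?E. mpeval x (c \<beta>) * (\<Prod>s\<in>?Z. z s ^ \<beta> s))"
        using E(1) by (intro sum.mono_neutral_cong_right) auto
      finally show "(\<Sum>\<beta>\<in>?E. mpeval x (c \<beta>) * (\<Prod>s\<in>?Z. z s ^ \<beta> s)) = 0" ..
    qed
  qed
  define E1 where "E1 = {\<alpha> \<in> E. sum \<alpha> ?Z \<le> r}"
  \<comment> \<open>Fills up the exponent of w_p so that the total degree is r; the truncated
    subtraction is exact on \<open>E1\<close>. Resetting the exponent at p to 0 undoes it, since
    \<alpha> p = 0 for \<alpha> in \<open>E\<close>.\<close>
  define h where "h \<alpha> = \<alpha>(p := r - sum \<alpha> ?Z)" for \<alpha>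
  define c' where "c' \<beta> = c (\<beta>(p := 0))" for \<beta>
  have unh: "(h \<alpha>)(p := 0) = \<alpha>" if "\<alpha> \<in> E1" for \<alpha>
  proof -
    have "\<alpha> p = 0" using that E(2) by (auto simp: E1_def exps_def)
    then show ?thesis by (auto simp: h_def)
  qed
  then have inj: "inj_on h E1" by (rule inj_on_inverseI [of _ "\<lambda>\<alpha>. \<alpha>(p := 0)"])
  have "w p ^ r * \<Phi> (\<lambda>s. w s / w p) x = (\<Sum>\<beta>\<in>h ` E1. mpeval x (c' \<beta>) * (\<Prod>s\<in>S. w s ^ \<beta> s))"
    if w: "w p \<noteq> 0" for w x
  proof -
    have "w p ^ r * \<Phi> (\<lambda>s. w s / w p) x
        = (\<Sum>\<alpha>\<in>E. w p ^ r * (mpeval x (c \<alpha>) * (\<Prod>s\<in>?Z. (w s / w p) ^ \<alpha> s)))"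
      by (simp add: \<Phi>_eq sum_distrib_left)
    also have "\<dots> = (\<Sum>\<alpha>\<in>E1. w p ^ r * (mpeval x (c \<alpha>) * (\<Prod>s\<in>?Z. (w s / w p) ^ \<alpha> s)))"
      using E(1) high by (intro sum.mono_neutral_right) (auto simp: E1_def not_le)
    also have "\<dots> = (\<Sum>\<alpha>\<in>E1. mpeval x (c' (h \<alpha>)) * (\<Prod>s\<in>S. w s ^ h \<alpha> s))"
    proof (rule sum.cong [OF refl])
      fix \<alpha> assume \<alpha>: "\<alpha> \<in> E1"
      have "(\<Prod>s\<in>S. w s ^ h \<alpha> s) = w p ^ (r - sum \<alpha> ?Z) * (\<Prod>s\<in>?Z. w s ^ \<alpha> s)"
        using S p by (subst prod.remove [of _ p]) (auto simp: h_def intro!: prod.cong)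
      moreover have "w p ^ r * (\<Prod>s\<in>?Z. (w s / w p) ^ \<alpha> s) = w p ^ (r - sum \<alpha> ?Z) * (\<Prod>s\<in>?Z. w s ^ \<alpha> s)"
      proof -
        have "(\<Prod>s\<in>?Z. (w s / w p) ^ \<alpha> s) = (\<Prod>s\<in>?Z. w s ^ \<alpha> s) / w p ^ sum \<alpha> ?Z"
          by (simp only: power_divide prod_dividef power_sum)
        moreover have "w p ^ r = w p ^ (r - sum \<alpha> ?Z) * w p ^ sum \<alpha> ?Z"
          using \<alpha> by (simp add: E1_def flip: power_add)
        moreover have "w p ^ sum \<alpha> ?Z \<noteq> 0" using w by simp
        ultimately show ?thesis by (simp only: times_divide_eq_right mult.assoc nonzero_mult_div_cancel_left mult.left_commute simp_thms)
      qed
      ultimately have 1: "w p ^ r * (\<Prod>s\<in>?Z. (w s / w p) ^ \<alpha> s) = (\<Prod>s\<in>S. w s ^ h \<alpha> s)"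
        by simp
      show "w p ^ r * (mpeval x (c \<alpha>) * (\<Prod>s\<in>?Z. (w s / w p) ^ \<alpha> s))
          = mpeval x (c' (h \<alpha>)) * (\<Prod>s\<in>S. w s ^ h \<alpha> s)"
        unfolding c'_def unh [OF \<alpha>] 1 [symmetric] by (rule mult.left_commute)
    qed
    finally show ?thesis by (simp only: sum.reindex [OF inj] o_def)
  qed
  moreover have "h ` E1 \<subseteq> exps S" using E(2) p by (auto simp: E1_def h_def exps_def)
  moreover have "finite (h ` E1)" using E(1) by (simp add: E1_def)
  moreover have "c' \<alpha> \<in> polys n" for \<alpha> by (simp add: c'_def c)
  ultimately show ?thesis
    by (intro exI [of _ "h ` E1"] exI [of _ c'] conjI allI impI)
qed

section \<open>Matrices depending polynomially on parameters\<close>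

lemma param_poly_mev:
  assumes "f \<in> polys n" "\<And>i j. i < n \<Longrightarrow> j < n \<Longrightarrow> param_poly S n (\<lambda>z x. M z x $$ (i, j))"
  shows "param_poly S n (\<lambda>z x. mev (M z x) f)"
  unfolding entries_def using assms by (intro param_poly_mpeval) auto

lemma param_poly_mult_mat:
  assumes "\<And>z x. M z x \<in> carrier_mat n n" "\<And>z x. N z x \<in> carrier_mat n n" "i < n" "j < n"
    and "\<And>i j. i < n \<Longrightarrow> j < n \<Longrightarrow> param_poly S n (\<lambda>z x. M z x $$ (i, j))"
    and "\<And>i j. i < n \<Longrightarrow> j < n \<Longrightarrow> param_poly S n (\<lambda>z x. N z x $$ (i, j))"
  shows "param_poly S n (\<lambda>z x. (M z x * N z x) $$ (i, j))"
  unfolding mult_mat_index [OF assms(1-4)] using assms(3-)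
  by (intro param_poly_sum param_poly_mult) auto

lemma param_poly_transvec:
  assumes "i < n" "j < n" "param_poly S n (\<lambda>z x. v z i)" "param_poly S n (\<lambda>z x. \<rho> z j)"
  shows "param_poly S n (\<lambda>z x. transvec n (v z) (\<rho> z) $$ (i, j))"
  unfolding transvec_index [OF assms(1,2)] using assms(3,4)
  by (intro param_poly_add param_poly_mult param_poly_const)

lemma param_poly_to_mat: "i < n \<Longrightarrow> j < n \<Longrightarrow> param_poly S n (\<lambda>z x. to_mat n x $$ (i, j))"
  using param_poly_coord [of "Suc i" n "Suc j" S] by simp

lemma param_poly_uminus: "param_poly S n \<Phi> \<Longrightarrow> param_poly S n (\<lambda>z x. - \<Phi> z x)"
  using param_poly_mult [OF param_poly_const [of S n "- 1"], of \<Phi>] by simp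

lemma transvec_transvec_index:
  assumes "i < n" "j < n"
  shows "(transvec n v \<rho> * transvec n w \<sigma>) $$ (i, j)
    = (if i = j then 1 else 0) + v i * \<rho> j + w i * \<sigma> j + (\<Sum>k<n. \<rho> k * w k) * (v i * \<sigma> j)"
proof -
  have "(\<Sum>k<n. \<rho> k * transvec n w \<sigma> $$ (k, j)) = (\<Sum>k<n. (if k = j then \<rho> k else 0) + \<rho> k * w k * \<sigma> j)"
    using assms by (intro sum.cong) (auto simp: transvec_index algebra_simps)
  then have "(\<Sum>k<n. \<rho> k * transvec n w \<sigma> $$ (k, j)) = \<rho> j + (\<Sum>k<n. \<rho> k * w k) * \<sigma> j"
    using assms by (simp add: sum.distrib sum_distrib_right)
  then show ?thesis
    using assms by (simp add: transvec_mult_index transvec_index algebra_simps)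
qed

text \<open>T(\<tau>) = a E(\<tau> c) a^{-1} with E a lower elementary matrix. As a stabilises f,
  this reduces to \<open>sl2_degree\<close> at a^{-1} A a, with the parameter rescaled by c. It
  extends the bound from one root subgroup to lines in the unipotent radical.\<close>

lemma sl2_degree_conj:
  fixes f :: "'k::field mpoly"
  assumes inf: "infinite (UNIV :: 'k set)" and f: "f \<in> invU_wt n nu"
    and ij: "j < i" "i < n" and d: "nu (Suc j) - nu (Suc i) = int d" and A: "A \<in> carrier_mat n n"
    and a: "stab n f a 1" and T: "\<And>\<tau>. T \<tau> \<in> carrier_mat n n"
    and Ta: "\<And>\<tau>. T \<tau> * a = a * transvec n (unit_fun i) (\<lambda>k. \<tau> * c * unit_fun j k)"
  shows "\<exists>P. degree P \<le> d \<and> (\<forall>\<tau>. mev (T \<tau> * A * T (- \<tau>)) f = poly P \<tau>)"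
proof -
  obtain b where ac: "a \<in> carrier_mat n n" and b: "b \<in> carrier_mat n n" "a * b = 1\<^sub>m n" "b * a = 1\<^sub>m n"
    using a unfolding stab_def by blast
  have E: "transvec n (unit_fun i) (\<lambda>k. \<tau> * unit_fun j k) = sl2_mat n j i 1 0 \<tau> 1" for \<tau> :: 'k
    using ij by (intro eq_matI) (auto simp: sl2_mat_def transvec_index)
  let ?E = "\<lambda>\<tau>. sl2_mat n j i 1 0 \<tau> 1"
  have Teq: "T \<tau> = a * ?E (\<tau> * c) * b" for \<tau>
  proof -
    have "T \<tau> = T \<tau> * (a * b)" using T [of \<tau>] b(2) by simp
    also have "\<dots> = (T \<tau> * a) * b" using T ac b(1) by (simp add: assoc_mult_mat [of _ n n _ n _ n])
    finally show ?thesis by (simp add: Ta E)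
  qed
  obtain P where P: "degree P \<le> d" "\<And>\<tau>. mev (?E \<tau> * (b * A * a) * ?E (- \<tau>)) f = poly P \<tau>"
    using sl2_degree [OF inf f ij d, of "b * A * a"] A ac b by blast
  have "mev (T \<tau> * A * T (- \<tau>)) f = poly (pcompose P [:0, c:]) \<tau>" for \<tau>
  proof -
    have eq: "T \<tau> * A * T (- \<tau>) = a * (?E (\<tau> * c) * (b * A * a) * ?E (- (\<tau> * c))) * b"
      using ac b A by (simp add: Teq assoc_mult_mat [of _ n n _ n _ n])
    have "mev (T \<tau> * A * T (- \<tau>)) f = mev (?E (\<tau> * c) * (b * A * a) * ?E (- (\<tau> * c))) f"
      unfolding eq using stabD [OF a b(1,2)] A ac b by simp
    then show ?thesis by (simp add: P(2) poly_pcompose)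
  qed
  moreover have "degree (pcompose P [:0, c:]) \<le> d"
    using P(1) by (rule order_trans [rotated]) (simp add: degree_pcompose)
  ultimately show ?thesis by blast
qed

text \<open>Up to the multiplier, f(q C q^{-1}) depends only on the coset of q modulo the stabiliser
  of f, so q may be replaced by the representative T.\<close>

lemma stab_factor:
  assumes W: "stab n f W c" and T: "T \<in> carrier_mat n n" "T' \<in> carrier_mat n n" "T * T' = 1\<^sub>m n" "T' * T = 1\<^sub>m n"
    and q: "q = W * T" "qi \<in> carrier_mat n n" "q * qi = 1\<^sub>m n" and C: "C \<in> carrier_mat n n"
  shows "mev (q * C * qi) f = c * mev (T * C * T') f"
proof -
  have Wc: "W \<in> carrier_mat n n" using W by (rule stab_carrier)
  have "qi = (T' * T) * qi" using T(4) q(2) by simp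
  also have "\<dots> = T' * (T * qi)" using T(2,1) q(2) by (rule assoc_mult_mat)
  finally have eq: "qi = T' * (T * qi)" .
  have "q * C * qi = W * (T * C * T') * (T * qi)"
  proof -
    have "q * C * qi = (W * T) * C * (T' * (T * qi))"
      by (simp only: q(1) eq [symmetric])
    also have "\<dots> = W * (T * C * T') * (T * qi)"
      using Wc T(1,2) q(2) C by (simp add: assoc_mult_mat [of _ n n _ n _ n])
    finally show ?thesis .
  qed
  moreover have "W * (T * qi) = 1\<^sub>m n"
    using q Wc T by (simp add: assoc_mult_mat [of _ n n _ n _ n])
  ultimately show ?thesis
    using stabD [OF W, of "T * qi" "T * C * T'"] T q C by simp
qed

text \<open>The parabolic lemmas treat normalised matrices with multiplier 1. Undoing the
  normalisation scales index k by c, and weight -r there produces the factor c^r.\<close>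

lemma semi_invariance_rescaled:
  assumes f: "f \<in> invU_wt n nu" and k: "k < n" "nu (Suc k) = - int r" and c: "c \<noteq> 0"
    and T: "T \<in> carrier_mat n n" "T' \<in> carrier_mat n n" "T * T' = 1\<^sub>m n" "T' * T = 1\<^sub>m n"
    and q: "q \<in> carrier_mat n n" "qi \<in> carrier_mat n n" "q * qi = 1\<^sub>m n" and C: "C \<in> carrier_mat n n"
    and stab: "stab n f (q * T' * diag_at n k (1 / c)) 1"
  shows "mev (q * C * qi) f = c ^ r * mev (T * C * T') f"
proof -
  have W: "q * T' \<in> carrier_mat n n" using q T by auto
  have "stab n f (q * T' * diag_at n k (1 / c) * diag_at n k c) (1 * c ^ r)"
    using stab stab_diag_at [OF f k(1) c k(2)] by (rule stab_mult)
  moreover have "q * T' * diag_at n k (1 / c) * diag_at n k c = q * T'"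
  proof (rule eq_matI)
    fix i j assume "i < dim_row (q * T')" "j < dim_col (q * T')"
    then have "i < n" "j < n" using q(1) T(2) by auto
    then show "(q * T' * diag_at n k (1 / c) * diag_at n k c) $$ (i, j) = (q * T') $$ (i, j)"
      using W c by (simp add: mult_diag_at_index)
  qed (use W in auto)
  ultimately have "stab n f (q * T') (c ^ r)" by simp
  moreover have "q = q * T' * T"
    using q T by (simp add: assoc_mult_mat [of _ n n _ n _ n])
  ultimately show ?thesis using stab_factor [OF _ T _ q(2,3) C] by blast
qed

section \<open>The three coordinate systems: last row, determinant, cofactors\<close>

lemma fixes_e1_diag_at: "k \<noteq> 0 \<Longrightarrow> fixes_e1 n (diag_at n k c)"
  by (auto simp: fixes_e1_def diag_at_def diag_fun_def)

lemma fixes_e1_transvec: "\<rho> 0 = 0 \<Longrightarrow> fixes_e1 n (transvec n v \<rho>)"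
  by (auto simp: fixes_e1_def transvec_index)

text \<open>For t = 1 the generators are the entries of the last row of the cyclic basis other than
  its first entry, which is 0. T(z) is a unipotent matrix with last row (0, z, 1). Right
  multiplication of q by its inverse at z = w/w_p clears the last row except for w_p, and the
  remaining factor is in the parabolic subgroup that stabilises f up to scaling.\<close>

lemma generators_last_row:
  fixes u :: "'a \<Rightarrow> 'k::field mpoly"
  assumes inf: "infinite (UNIV :: 'k set)" and n: "n \<ge> 3" and S: "finite S" and cl: "bij_betw cl S {1..<n}"
    and u: "\<And>s. s \<in> S \<Longrightarrow> u s \<in> invU_wt n nu"
    and mn: "\<And>A s. A \<in> carrier_mat n n \<Longrightarrow> s \<in> S \<Longrightarrow> mev A (u s) = krylov n A $$ (n - 1, cl s)"
    and nu: "\<And>i. 1 \<le> i \<Longrightarrow> i < n - 1 \<Longrightarrow> nu (Suc i) = 0" "nu n = - 1"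
  shows "alg_indep_over (invG n) S u" "alg_generated (invG n) S u = wt_algebra n nu"
proof -
  define ic where "ic = inv_into S cl"
  have ic: "ic j \<in> S" "cl (ic j) = j" if "1 \<le> j" "j < n" for j
    using cl that unfolding ic_def by (auto simp: bij_betw_def inv_into_into f_inv_into_f)
  have ci: "ic (cl s) = s" "1 \<le> cl s" "cl s < n" if "s \<in> S" for s
    using cl that unfolding ic_def by (auto simp: bij_betw_def inv_into_f_f)
  \<comment> \<open>The generator at the last diagonal position serves as the denominator
    w_p.\<close>
  define p where "p = ic (n - 1)"
  have p: "p \<in> S" "cl p = n - 1" using ic [of "n - 1"] n by (auto simp: p_def)
  have n0: "n > 0" "n - 1 < n" using n by auto
  define \<rho> where "\<rho> z j = (if 1 \<le> j \<and> j < n - 1 then z (ic j) else 0)" for z :: "'a \<Rightarrow> 'k" and j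
  define T where "T z = transvec n (unit_fun (n - 1)) (\<rho> z)" for z
  define T' where "T' z = transvec n (unit_fun (n - 1)) (\<lambda>j. - \<rho> z j)" for z
  \<comment> \<open>Scaling the last row (0, w/w_p, 1) of T by w_p gives the prescribed row, with
    determinant w_p.\<close>
  define Q where "Q w = diag_at n (n - 1) (w p) * T (\<lambda>s. w s / w p)" for w
  have Tc: "T z \<in> carrier_mat n n" "T' z \<in> carrier_mat n n" for z by (simp_all add: T_def T'_def)
  have \<rho>0: "(\<Sum>k<n. \<rho> z k * unit_fun (n - 1) k) = 0" for z
    using n by (simp add: \<rho>_def)
  have TT: "T z * T' z = 1\<^sub>m n" "T' z * T z = 1\<^sub>m n" for z
    unfolding T_def T'_def by (rule transvec_inverse [OF \<rho>0])+
  have \<rho>_low: "unit_fun (n - 1) i * \<rho> z j = 0" if "j < n" "i \<le> j" for i j z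
  proof (cases "j < n - 1")
    case True
    then have "i \<noteq> n - 1" using that by simp
    then show ?thesis by simp
  qed (simp add: \<rho>_def)
  have det_T: "det (T z) = 1" "det (T' z) = 1" for z
    unfolding T_def T'_def by (rule det_transvec_lower, use \<rho>_low in auto)+
  have Q: "fixes_e1 n (Q w) \<and> det (Q w) \<noteq> 0 \<and> (\<forall>s\<in>S. Q w $$ (n - 1, cl s) = w s)"
    if w: "\<forall>s\<in>S. w s \<noteq> 0" for w
  proof (intro conjI ballI)
    show "fixes_e1 n (Q w)"
      unfolding Q_def T_def using n by (intro fixes_e1_mult fixes_e1_diag_at fixes_e1_transvec) (auto simp: \<rho>_def)
    show "det (Q w) \<noteq> 0"
      unfolding Q_def using w p Tc n0 by (simp add: det_mult [of _ n] det_T det_diag_at)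
    fix s assume s: "s \<in> S"
    have "cl s = n - 1 \<longrightarrow> s = p" using ci [OF s] by (auto simp: p_def)
    moreover have "w p \<noteq> 0" using w p by simp
    ultimately show "Q w $$ (n - 1, cl s) = w s"
      unfolding Q_def using Tc n0 ci [OF s] p by (simp add: diag_at_mult_index) (auto simp: T_def transvec_index \<rho>_def)
  qed
  show "alg_indep_over (invG n) S u"
    by (rule alg_indep_core [OF inf n0(1) S, where mn = "\<lambda>s q. q $$ (n - 1, cl s)", OF mn Q])
  show "alg_generated (invG n) S u = wt_algebra n nu"
  proof (rule alg_generated_core [OF inf n0(1) S, where mn = "\<lambda>s q. q $$ (n - 1, cl s)", OF mn Q u])
    fix r and f :: "'k mpoly" assume f: "f \<in> invU_wt n (\<lambda>i. int r * nu i)"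
    have fp: "f \<in> polys n" using f by (rule invU_wt_imp_polys)
    define \<Phi> where "\<Phi> z x = mev (T z * to_mat n x * T' z) f" for z x
    have \<rho>_param: "param_poly (S - {p}) n (\<lambda>z x. \<rho> z j)" if "j < n" for j
    proof (cases "1 \<le> j \<and> j < n - 1")
      case True
      then have "ic j \<in> S - {p}" using ic [of j] p that by auto
      then show ?thesis using True S by (simp add: \<rho>_def param_poly_param)
    next
      case False
      show ?thesis unfolding \<rho>_def if_not_P [OF False] by (rule param_poly_const)
    qed
    have "\<exists>E c. finite E \<and> E \<subseteq> exps S \<and> (\<forall>\<alpha>. c \<alpha> \<in> polys n) \<and> (\<forall>w x. w p \<noteq> 0 \<longrightarrow>
       w p ^ r * \<Phi> (\<lambda>s. w s / w p) x = (\<Sum>\<alpha>\<in>E. mpeval x (c \<alpha>) * (\<Prod>s\<in>S. w s ^ \<alpha> s)))"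
    proof (rule homogenize [OF inf S p(1)])
      show "param_poly (S - {p}) n \<Phi>"
        unfolding \<Phi>_def T_def T'_def
        by (intro param_poly_mev [OF fp] param_poly_mult_mat param_poly_transvec param_poly_to_mat param_poly_const param_poly_uminus \<rho>_param) auto
      fix z :: "'a \<Rightarrow> 'k" and x assume z: "\<forall>s\<in>S - {p}. z s \<noteq> 0"
      \<comment> \<open>The row \<rho> of T(z) is c (e_1 + \<zeta>)^T in 0-based notation. The upper
        unitriangular \<open>?a\<close> = 1 - e_1 \<zeta>^T satisfies \<rho>^T a = c e_1^T and fixes
        e_{n-1}, so it conjugates the line T(\<tau> z) into the root subgroup at (n-1, 1). The
        weight difference there is r, as n \<ge> 3.\<close>
      define c where "c = z (ic 1)"
      define \<zeta> where "\<zeta> j = (if 2 \<le> j \<and> j < n - 1 then z (ic j) / c else 0)" for j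
      have "ic 1 \<in> S - {p}" using ic [of 1] p n by auto
      then have c: "c \<noteq> 0" using z by (simp add: c_def)
      let ?a = "transvec n (unit_fun 1) (\<lambda>j. - \<zeta> j)"
      have "\<exists>P. degree P \<le> r \<and> (\<forall>\<tau>. mev (T (\<lambda>s. \<tau> * z s) * to_mat n x * T (\<lambda>s. - \<tau> * z s)) f = poly P \<tau>)"
      proof (rule sl2_degree_conj [OF inf f, where j = 1 and i = "n - 1" and a = ?a and c = c])
        show "stab n f ?a 1" by (rule stab_transvec_upper [OF f]) (auto simp: \<zeta>_def)
        show "T (\<lambda>s. \<tau> * z s) * ?a = ?a * transvec n (unit_fun (n - 1)) (\<lambda>k. \<tau> * c * unit_fun 1 k)" for \<tau>
        proof (rule eq_matI)
          fix i j assume "i < dim_row (?a * transvec n (unit_fun (n - 1)) (\<lambda>k. \<tau> * c * unit_fun 1 k))"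
            "j < dim_col (?a * transvec n (unit_fun (n - 1)) (\<lambda>k. \<tau> * c * unit_fun 1 k))"
          then have ij: "i < n" "j < n" by auto
          have \<rho>j: "\<rho> (\<lambda>s. \<tau> * z s) j = \<tau> * c * (unit_fun 1 j + \<zeta> j)"
          proof -
            consider "j = 1" | "2 \<le> j" "j < n - 1" | "j = 0 \<or> j = n - 1" using ij by linarith
            then show ?thesis
              using n c by cases (auto simp: \<rho>_def \<zeta>_def c_def)
          qed
          have s1: "(\<Sum>k<n. \<rho> (\<lambda>s. \<tau> * z s) k * unit_fun 1 k) = \<tau> * c"
            using n by (simp add: \<rho>_def c_def)
          have sl2_mat: "(\<Sum>k<n. - \<zeta> k * unit_fun (n - 1) k) = 0"
            by (rule sum.neutral) (simp add: \<zeta>_def)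
          show "(T (\<lambda>s. \<tau> * z s) * ?a) $$ (i, j) = (?a * transvec n (unit_fun (n - 1)) (\<lambda>k. \<tau> * c * unit_fun 1 k)) $$ (i, j)"
            unfolding T_def transvec_transvec_index [OF ij] \<rho>j s1 sl2_mat by (simp add: algebra_simps)
        qed (auto simp: Tc(1) [THEN carrier_matD(1)])
        show "int r * nu (Suc 1) - int r * nu (Suc (n - 1)) = int r"
          using nu(1) [of 1] nu(2) n by simp
      qed (use n Tc in auto)
      moreover have "T' (\<lambda>s. \<tau> * z s) = T (\<lambda>s. - \<tau> * z s)" for \<tau>
        unfolding T_def T'_def \<rho>_def by (intro arg_cong [where f = "transvec n (unit_fun (n - 1))"]) auto
      ultimately show "\<exists>P. degree P \<le> r \<and> (\<forall>\<tau>. \<Phi> (\<lambda>s. \<tau> * z s) x = poly P \<tau>)"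
        by (simp add: \<Phi>_def)
    qed
    then obtain E c where Ec: "finite E" "E \<subseteq> exps S" "\<forall>\<alpha>. c \<alpha> \<in> polys n"
      "\<And>w x. w p \<noteq> 0 \<Longrightarrow> w p ^ r * \<Phi> (\<lambda>s. w s / w p) x = (\<Sum>\<alpha>\<in>E. mpeval x (c \<alpha>) * (\<Prod>s\<in>S. w s ^ \<alpha> s))"
      by blast
    have "mev (q * C * qi) f = (\<Sum>\<alpha>\<in>E. mev C (c \<alpha>) * (\<Prod>s\<in>S. (q $$ (n - 1, cl s)) ^ \<alpha> s))"
      if q: "fixes_e1 n q" "qi \<in> carrier_mat n n" "q * qi = 1\<^sub>m n" "qi * q = 1\<^sub>m n" and C: "C \<in> carrier_mat n n"
        and nz: "\<forall>s\<in>S. q $$ (n - 1, cl s) \<noteq> 0" for q qi C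
    proof -
      define w where "w s = q $$ (n - 1, cl s)" for s
      define z where "z s = w s / w p" for s
      have wp: "w p \<noteq> 0" unfolding w_def by (rule bspec [OF nz p(1)])
      have qc: "q \<in> carrier_mat n n" using q(1) by (rule fixes_e1_carrier)
      \<comment> \<open>Its last row is zero except for w_p in the last column; dividing that column
        by w_p gives a matrix a covered by \<open>stab_parabolic_last_row\<close>.\<close>
      define W where "W = q * T' z"
      define a where "a = W * diag_at n (n - 1) (1 / w p)"
      have Wc: "W \<in> carrier_mat n n" using qc Tc by (auto simp: W_def)
      have "det q * det qi = 1"
        using det_mult [OF qc q(2)] q(3) by simp
      then have "det q \<noteq> 0" by auto
      have "stab n f a 1"
      proof (rule stab_parabolic_last_row [OF inf f])
        show "fixes_e1 n a"
          unfolding a_def W_def T'_def using q(1) n by (intro fixes_e1_mult fixes_e1_diag_at fixes_e1_transvec) (auto simp: \<rho>_def)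
        show "det a \<noteq> 0"
          unfolding a_def W_def using qc Tc n0 wp \<open>det q \<noteq> 0\<close> by (simp add: det_mult [of _ n] det_T det_diag_at)
        fix j assume j: "j < n"
        have "W $$ (n - 1, j) = q $$ (n - 1, j) - q $$ (n - 1, n - 1) * \<rho> z j"
          unfolding W_def T'_def using qc n0 j by (simp add: mult_transvec_index)
        also have "\<dots> = (if j = n - 1 then w p else 0)"
        proof -
          have "q $$ (n - 1, n - 1) = w p" using p by (simp add: w_def)
          moreover have "q $$ (n - 1, 0) = 0" using q(1) n by (simp add: fixes_e1_def)
          moreover have "q $$ (n - 1, j) = w (ic j)" if "1 \<le> j"
            using ic [OF that j] by (simp add: w_def)
          moreover have "j = 0 \<or> 1 \<le> j \<and> j < n - 1 \<or> j = n - 1" using j by auto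
          ultimately show ?thesis using wp n by (auto simp: \<rho>_def z_def)
        qed
        finally show "a $$ (n - 1, j) = (if j = n - 1 then 1 else 0)"
          unfolding a_def using Wc n0 j wp by (simp add: mult_diag_at_index)
      next
        show "int r * nu (Suc i) = 0" if "1 \<le> i" "i < n - 1" for i using nu(1) [OF that] by simp
      qed (use n in auto)
      then have "mev (q * C * qi) f = w p ^ r * mev (T z * C * T' z) f"
        unfolding a_def W_def using qc q C Tc TT wp n0 nu(2) n
        by (intro semi_invariance_rescaled [OF f, where k = "n - 1"]) auto
      also have "\<dots> = w p ^ r * \<Phi> (\<lambda>s. w s / w p) (entries C)"
        using C by (simp add: \<Phi>_def z_def [abs_def])
      also have "\<dots> = (\<Sum>\<alpha>\<in>E. mev C (c \<alpha>) * (\<Prod>s\<in>S. w s ^ \<alpha> s))"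
        by (rule Ec(4) [of w, OF wp])
      finally show ?thesis by (simp add: w_def)
    qed
    then show "\<exists>E c. finite E \<and> E \<subseteq> exps S \<and> (\<forall>\<alpha>. c \<alpha> \<in> polys n) \<and>
        (\<forall>q qi C. fixes_e1 n q \<longrightarrow> qi \<in> carrier_mat n n \<longrightarrow> q * qi = 1\<^sub>m n \<longrightarrow> qi * q = 1\<^sub>m n \<longrightarrow>
           C \<in> carrier_mat n n \<longrightarrow> (\<forall>s\<in>S. q $$ (n - 1, cl s) \<noteq> 0) \<longrightarrow>
           mev (q * C * qi) f = (\<Sum>\<alpha>\<in>E. mev C (c \<alpha>) * (\<Prod>s\<in>S. (q $$ (n - 1, cl s)) ^ \<alpha> s)))"
      using Ec(1-3) by blast
  qed
qed

text \<open>For t = n-1 the only generator is det q, and f(q C q^{-1}) = (det q)^r f(C) by full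
  semi-invariance. A single monomial suffices and no degree bound enters.\<close>

lemma generators_det:
  fixes u :: "'a \<Rightarrow> 'k::field mpoly"
  assumes inf: "infinite (UNIV :: 'k set)" and n: "n \<ge> 2" and S: "S = {s0}"
    and u: "\<And>s. s \<in> S \<Longrightarrow> u s \<in> invU_wt n nu"
    and mn: "\<And>A s. A \<in> carrier_mat n n \<Longrightarrow> s \<in> S \<Longrightarrow> mev A (u s) = det (krylov n A)"
    and nu: "\<And>i. 1 \<le> i \<Longrightarrow> i < n \<Longrightarrow> nu (Suc i) = - 1"
  shows "alg_indep_over (invG n) S u" "alg_generated (invG n) S u = wt_algebra n nu"
proof -
  have n0: "n > 0" "n - 1 < n" using n by auto
  have fin: "finite S" using S by simp
  define Q where "Q w = diag_at n (n - 1) (w s0)" for w :: "'a \<Rightarrow> 'k"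
  have Q: "fixes_e1 n (Q w) \<and> det (Q w) \<noteq> 0 \<and> (\<forall>s\<in>S. det (Q w) = w s)"
    if w: "\<forall>s\<in>S. w s \<noteq> 0" for w
    using w n n0 S by (auto simp: Q_def fixes_e1_diag_at det_diag_at)
  show "alg_indep_over (invG n) S u"
    by (rule alg_indep_core [OF inf n0(1) fin, where mn = "\<lambda>s q. det q", OF mn Q])
  show "alg_generated (invG n) S u = wt_algebra n nu"
  proof (rule alg_generated_core [OF inf n0(1) fin, where mn = "\<lambda>s q. det q", OF mn Q u])
    fix r and f :: "'k mpoly" assume f: "f \<in> invU_wt n (\<lambda>i. int r * nu i)"
    define \<alpha> where "\<alpha> s = (if s = s0 then r else 0)" for s
    have "mev (q * C * qi) f = (\<Sum>\<alpha>\<in>{\<alpha>}. mev C f * (\<Prod>s\<in>S. det q ^ \<alpha> s))"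
      if q: "fixes_e1 n q" "qi \<in> carrier_mat n n" "q * qi = 1\<^sub>m n" "qi * q = 1\<^sub>m n" and C: "C \<in> carrier_mat n n"
        and nz: "\<forall>s\<in>S. det q \<noteq> 0" for q qi C
    proof -
      have "stab n f q (det q ^ r)"
      proof (rule stab_parabolic_first_col [OF inf f _ q(1)])
        show "int r * nu (Suc i) = - int r" if "1 \<le> i" "i < n" for i using nu [OF that] by simp
      qed (use nz S in auto)
      from stabD [OF this q(2,3) C] show ?thesis
        using S by (simp add: \<alpha>_def mult.commute)
    qed
    moreover have "\<alpha> \<in> exps S" using S by (simp add: \<alpha>_def exps_def)
    ultimately show "\<exists>E c. finite E \<and> E \<subseteq> exps S \<and> (\<forall>\<alpha>. c \<alpha> \<in> polys n) \<and>
        (\<forall>q qi C. fixes_e1 n q \<longrightarrow> qi \<in> carrier_mat n n \<longrightarrow> q * qi = 1\<^sub>m n \<longrightarrow> qi * q = 1\<^sub>m n \<longrightarrow>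
           C \<in> carrier_mat n n \<longrightarrow> (\<forall>s\<in>S. det q \<noteq> 0) \<longrightarrow>
           mev (q * C * qi) f = (\<Sum>\<alpha>\<in>E. mev C (c \<alpha>) * (\<Prod>s\<in>S. det q ^ \<alpha> s)))"
      using invU_wt_imp_polys [OF f]
      by (intro exI [of _ "{\<alpha>}"] exI [of _ "\<lambda>_. f"] conjI allI impI) simp_all
  qed
qed

text \<open>For t = n-2 the coordinates are entries of column 1 of adj q, the (n-2)-minors up to
  sign. By q adj q = det q, the vector w is mapped by q to (det q) e_1 outside row 0, in 0-based
  notation. So making w/w_p column 1 of the unipotent T'(z) brings q T'(z) into the shape required
  by \<open>stab_parabolic_second_col\<close>, up to scaling.\<close>

lemma generators_cofactors:
  fixes u :: "'a \<Rightarrow> 'k::field mpoly"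
  assumes inf: "infinite (UNIV :: 'k set)" and n: "n \<ge> 3" and S: "finite S" and cl: "bij_betw cl S {1..<n}"
    and u: "\<And>s. s \<in> S \<Longrightarrow> u s \<in> invU_wt n nu"
    and mn: "\<And>A s. A \<in> carrier_mat n n \<Longrightarrow> s \<in> S \<Longrightarrow> mev A (u s) = adj_mat (krylov n A) $$ (cl s, 1)"
    and nu: "nu 2 = 0" "\<And>i. 2 \<le> i \<Longrightarrow> i < n \<Longrightarrow> nu (Suc i) = - 1"
  shows "alg_indep_over (invG n) S u" "alg_generated (invG n) S u = wt_algebra n nu"
proof -
  define ic where "ic = inv_into S cl"
  have ic: "ic j \<in> S" "cl (ic j) = j" if "1 \<le> j" "j < n" for j
    using cl that unfolding ic_def by (auto simp: bij_betw_def inv_into_into f_inv_into_f)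
  have ci: "ic (cl s) = s" "1 \<le> cl s" "cl s < n" if "s \<in> S" for s
    using cl that unfolding ic_def by (auto simp: bij_betw_def inv_into_f_f)
  define p where "p = ic 1"
  have p: "p \<in> S" "cl p = 1" using ic [of 1] n by (auto simp: p_def)
  have n0: "n > 0" "n - 1 < n" "1 < n" "n - 1 \<noteq> 0" "n - 1 \<noteq> 1" using n by auto
  \<comment> \<open>The minus sign makes the inverse T'(z), not T(z), carry z in column 1. Index 1
    itself is the denominator w_p.\<close>
  define \<rho> where "\<rho> z j = (if 2 \<le> j \<and> j < n then - z (ic j) else 0)" for z :: "'a \<Rightarrow> 'k" and j
  define T where "T z = transvec n (\<rho> z) (unit_fun 1)" for z
  define T' where "T' z = transvec n (\<rho> z) (\<lambda>j. - unit_fun 1 j)" for z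
  define Q where "Q w = diag_at n (n - 1) (w p) * T (\<lambda>s. w s / w p)" for w
  have Tc: "T z \<in> carrier_mat n n" "T' z \<in> carrier_mat n n" for z by (simp_all add: T_def T'_def)
  have \<rho>0: "(\<Sum>k<n. unit_fun 1 k * \<rho> z k) = 0" for z
    by (intro sum.neutral) (simp add: \<rho>_def)
  have TT: "T z * T' z = 1\<^sub>m n" "T' z * T z = 1\<^sub>m n" for z
    unfolding T_def T'_def by (rule transvec_inverse [OF \<rho>0])+
  have \<rho>_low: "\<rho> z i * unit_fun 1 j = 0" if "i \<le> j" for i j z
    using that by (simp add: \<rho>_def)
  have det_T: "det (T z) = 1" "det (T' z) = 1" for z
    unfolding T_def T'_def by (rule det_transvec_lower, use \<rho>_low in auto)+
  have Q: "fixes_e1 n (Q w) \<and> det (Q w) \<noteq> 0 \<and> (\<forall>s\<in>S. adj_mat (Q w) $$ (cl s, 1) = w s)"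
    if w: "\<forall>s\<in>S. w s \<noteq> 0" for w
  proof (intro conjI ballI)
    let ?z = "\<lambda>s. w s / w p"
    have wp: "w p \<noteq> 0" using w p by simp
    show "fixes_e1 n (Q w)"
      unfolding Q_def T_def using n by (intro fixes_e1_mult fixes_e1_diag_at fixes_e1_transvec) auto
    have det: "det (Q w) = w p"
      unfolding Q_def using Tc n0 by (simp add: det_mult [of _ n] det_T det_diag_at)
    then show "det (Q w) \<noteq> 0" using wp by simp
    have Qc: "Q w \<in> carrier_mat n n" using Tc by (auto simp: Q_def)
    \<comment> \<open>The inverse of \<open>Q w\<close>. As det (Q w) = w_p, the adjugate is w_p R,
      whose column 1 can be read off directly.\<close>
    define R where "R = T' ?z * diag_at n (n - 1) (1 / w p)"
    have Rc: "R \<in> carrier_mat n n" using Tc by (auto simp: R_def)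
    have "diag_at n (n - 1) (w p) * diag_at n (n - 1) (1 / w p) = 1\<^sub>m n"
      using wp by (intro eq_matI) (auto simp: diag_at_mult_index, auto simp: diag_at_def diag_fun_def)
    then have QR: "Q w * R = 1\<^sub>m n"
      unfolding Q_def R_def by (intro inverse_mult Tc TT) auto
    have "adj_mat (Q w) = adj_mat (Q w) * (Q w * R)"
      using QR adj_mat(1) [OF Qc] by simp
    also have "\<dots> = (adj_mat (Q w) * Q w) * R"
      using adj_mat(1) [OF Qc] Qc Rc by (simp add: assoc_mult_mat [of _ n n _ n _ n])
    also have "\<dots> = w p \<cdot>\<^sub>m R"
      using adj_mat(3) [OF Qc] Rc by (simp add: det mult_smult_assoc_mat [of _ n n _ n])
    finally have adj: "adj_mat (Q w) = w p \<cdot>\<^sub>m R" .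
    fix s assume s: "s \<in> S"
    have "cl s = 1 \<longrightarrow> s = p" using ci [OF s] by (auto simp: p_def)
    moreover have "R $$ (cl s, 1) = T' ?z $$ (cl s, 1)"
      unfolding R_def using Tc ci [OF s] n0 by (simp add: mult_diag_at_index)
    moreover have "T' ?z $$ (cl s, 1) = (if cl s = 1 then 1 else ?z s)"
      unfolding T'_def using ci [OF s] n0 by (simp add: transvec_index \<rho>_def)
    ultimately show "adj_mat (Q w) $$ (cl s, 1) = w s"
      unfolding adj using Rc ci [OF s] n0 wp by auto
  qed
  show "alg_indep_over (invG n) S u"
    by (rule alg_indep_core [OF inf n0(1) S, where mn = "\<lambda>s q. adj_mat q $$ (cl s, 1)", OF mn Q])
  show "alg_generated (invG n) S u = wt_algebra n nu"
  proof (rule alg_generated_core [OF inf n0(1) S, where mn = "\<lambda>s q. adj_mat q $$ (cl s, 1)", OF mn Q u])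
    fix r and f :: "'k mpoly" assume f: "f \<in> invU_wt n (\<lambda>i. int r * nu i)"
    have fp: "f \<in> polys n" using f by (rule invU_wt_imp_polys)
    define \<Phi> where "\<Phi> z x = mev (T z * to_mat n x * T' z) f" for z x
    have \<rho>_param: "param_poly (S - {p}) n (\<lambda>z x. \<rho> z j)" for j
    proof (cases "2 \<le> j \<and> j < n")
      case True
      then have "ic j \<in> S - {p}" using ic [of j] p by auto
      then show ?thesis using True S by (simp add: \<rho>_def param_poly_param param_poly_uminus)
    next
      case False
      show ?thesis unfolding \<rho>_def if_not_P [OF False] by (rule param_poly_const)
    qed
    have "\<exists>E c. finite E \<and> E \<subseteq> exps S \<and> (\<forall>\<alpha>. c \<alpha> \<in> polys n) \<and> (\<forall>w x. w p \<noteq> 0 \<longrightarrow>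
       w p ^ r * \<Phi> (\<lambda>s. w s / w p) x = (\<Sum>\<alpha>\<in>E. mpeval x (c \<alpha>) * (\<Prod>s\<in>S. w s ^ \<alpha> s)))"
    proof (rule homogenize [OF inf S p(1)])
      show "param_poly (S - {p}) n \<Phi>"
        unfolding \<Phi>_def T_def T'_def
        by (intro param_poly_mev [OF fp] param_poly_mult_mat param_poly_transvec param_poly_to_mat param_poly_const \<rho>_param) auto
      fix z :: "'a \<Rightarrow> 'k" and x assume z: "\<forall>s\<in>S - {p}. z s \<noteq> 0"
      \<comment> \<open>Dual to the row case: the column is \<rho> = c (e_{n-1} + \<zeta>), and the
        upper unitriangular \<open>?a\<close> = 1 + \<zeta> e_{n-1}^T maps e_{n-1} to e_{n-1} +
        \<zeta> and leaves e_1^T alone. So the line T(\<tau> z) is again conjugate to the root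
        subgroup at (n-1, 1).\<close>
      define c where "c = - z (ic (n - 1))"
      define \<zeta> where "\<zeta> j = (if 2 \<le> j \<and> j < n - 1 then - z (ic j) / c else 0)" for j
      have "1 \<le> n - 1" using n by simp
      note icn = ic [OF this n0(2)]
      have "ic (n - 1) \<noteq> p" using icn(2) p(2) n0(5) by metis
      then have "ic (n - 1) \<in> S - {p}" using icn(1) by simp
      then have c: "c \<noteq> 0" using z by (simp add: c_def)
      let ?a = "transvec n \<zeta> (unit_fun (n - 1))"
      have "\<exists>P. degree P \<le> r \<and> (\<forall>\<tau>. mev (T (\<lambda>s. \<tau> * z s) * to_mat n x * T (\<lambda>s. - \<tau> * z s)) f = poly P \<tau>)"
      proof (rule sl2_degree_conj [OF inf f, where j = 1 and i = "n - 1" and a = ?a and c = c])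
        show "stab n f ?a 1" by (rule stab_transvec_upper [OF f]) (auto simp: \<zeta>_def)
        show "T (\<lambda>s. \<tau> * z s) * ?a = ?a * transvec n (unit_fun (n - 1)) (\<lambda>k. \<tau> * c * unit_fun 1 k)" for \<tau>
        proof (rule eq_matI)
          fix i j assume "i < dim_row (?a * transvec n (unit_fun (n - 1)) (\<lambda>k. \<tau> * c * unit_fun 1 k))"
            "j < dim_col (?a * transvec n (unit_fun (n - 1)) (\<lambda>k. \<tau> * c * unit_fun 1 k))"
          then have ij: "i < n" "j < n" by auto
          have \<rho>i: "\<rho> (\<lambda>s. \<tau> * z s) i = \<tau> * c * (unit_fun (n - 1) i + \<zeta> i)"
          proof -
            consider "i = n - 1" | "2 \<le> i" "i < n - 1" | "i < 2" using ij by linarith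
            then show ?thesis
              using n c by cases (simp_all add: \<rho>_def \<zeta>_def c_def)
          qed
          have s1: "(\<Sum>k<n. unit_fun 1 k * \<zeta> k) = 0"
            by (rule sum.neutral) (simp add: \<zeta>_def)
          have sl2_mat: "(\<Sum>k<n. unit_fun (n - 1) k * unit_fun (n - 1) k) = (1 :: 'k)"
            using n0 by simp
          show "(T (\<lambda>s. \<tau> * z s) * ?a) $$ (i, j) = (?a * transvec n (unit_fun (n - 1)) (\<lambda>k. \<tau> * c * unit_fun 1 k)) $$ (i, j)"
            unfolding T_def transvec_transvec_index [OF ij] \<rho>i s1 sl2_mat by (simp add: algebra_simps)
        qed (auto simp: Tc(1) [THEN carrier_matD(1)])
        show "int r * nu (Suc 1) - int r * nu (Suc (n - 1)) = int r"
          using nu(1) nu(2) [of "n - 1"] n by (simp add: numeral_2_eq_2)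
      qed (use n Tc in auto)
      moreover have "T' (\<lambda>s. \<tau> * z s) = T (\<lambda>s. - \<tau> * z s)" for \<tau>
        unfolding T_def T'_def \<rho>_def by (intro eq_matI) (auto simp: transvec_index)
      ultimately show "\<exists>P. degree P \<le> r \<and> (\<forall>\<tau>. \<Phi> (\<lambda>s. \<tau> * z s) x = poly P \<tau>)"
        by (simp add: \<Phi>_def)
    qed
    then obtain E c where Ec: "finite E" "E \<subseteq> exps S" "\<forall>\<alpha>. c \<alpha> \<in> polys n"
      "\<And>w x. w p \<noteq> 0 \<Longrightarrow> w p ^ r * \<Phi> (\<lambda>s. w s / w p) x = (\<Sum>\<alpha>\<in>E. mpeval x (c \<alpha>) * (\<Prod>s\<in>S. w s ^ \<alpha> s))"
      by blast
    have "mev (q * C * qi) f = (\<Sum>\<alpha>\<in>E. mev C (c \<alpha>) * (\<Prod>s\<in>S. (adj_mat q $$ (cl s, 1)) ^ \<alpha> s))"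
      if q: "fixes_e1 n q" "qi \<in> carrier_mat n n" "q * qi = 1\<^sub>m n" "qi * q = 1\<^sub>m n" and C: "C \<in> carrier_mat n n"
        and nz: "\<forall>s\<in>S. adj_mat q $$ (cl s, 1) \<noteq> 0" for q qi C
    proof -
      define w where "w s = adj_mat q $$ (cl s, 1)" for s
      define z where "z s = w s / w p" for s
      have wp: "w p \<noteq> 0" unfolding w_def by (rule bspec [OF nz p(1)])
      have qc: "q \<in> carrier_mat n n" using q(1) by (rule fixes_e1_carrier)
      define W where "W = q * T' z"
      define a where "a = W * diag_at n (n - 1) (1 / w p)"
      have Wc: "W \<in> carrier_mat n n" using qc Tc by (auto simp: W_def)
      have "det q * det qi = 1"
        using det_mult [OF qc q(2)] q(3) by simp
      then have "det q \<noteq> 0" by auto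
      have det_a: "det a = det q / w p"
        unfolding a_def W_def using qc Tc n0 by (simp add: det_mult [of _ n] det_T det_diag_at)
      have "stab n f a 1"
      proof (rule stab_parabolic_second_col [OF inf f, where r = r])
        show "fixes_e1 n a"
          unfolding a_def W_def T'_def using q(1) n by (intro fixes_e1_mult fixes_e1_diag_at fixes_e1_transvec) auto
        show "det a \<noteq> 0"
          unfolding det_a using wp \<open>det q \<noteq> 0\<close> by simp
        fix i assume i: "1 \<le> i" "i < n"
        have "W $$ (i, 1) = q $$ (i, 1) - (\<Sum>k<n. q $$ (i, k) * \<rho> z k)"
          unfolding W_def T'_def using qc n0 i by (simp add: mult_transvec_index)
        also have "\<dots> = (\<Sum>k<n. (if k = 1 then q $$ (i, k) else 0) - q $$ (i, k) * \<rho> z k)"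
          using n0 by (simp add: sum_subtractf)
        \<comment> \<open>Column 1 of T'(z) agrees with that of (adj q)/w_p except possibly in row
          0, and this row meets q(i, 0) = 0 because i \<ge> 1.\<close>
        also have "\<dots> = (\<Sum>k<n. q $$ (i, k) * adj_mat q $$ (k, 1)) / w p"
          unfolding sum_divide_distrib
        proof (rule sum.cong [OF refl])
          fix k assume "k \<in> {..<n}"
          then have k: "k < n" by simp
          consider "k = 0" | "k = 1" | "2 \<le> k" by linarith
          then show "(if k = 1 then q $$ (i, k) else 0) - q $$ (i, k) * \<rho> z k = q $$ (i, k) * adj_mat q $$ (k, 1) / w p"
          proof cases
            case 1
            then have "q $$ (i, k) = 0" using q(1) i by (simp add: fixes_e1_def)
            then show ?thesis using 1 by simp
          next
            case 2
            then have "adj_mat q $$ (k, 1) = w p" using p by (simp add: w_def)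
            then show ?thesis using 2 wp by (simp add: \<rho>_def)
          next
            case 3
            then have "adj_mat q $$ (k, 1) = w (ic k)" using ic [of k] k by (simp add: w_def)
            then show ?thesis using 3 k by (simp add: \<rho>_def z_def)
          qed
        qed
        also have "(\<Sum>k<n. q $$ (i, k) * adj_mat q $$ (k, 1)) = (q * adj_mat q) $$ (i, 1)"
          using qc adj_mat(1) [OF qc] i n0 by (simp add: mult_mat_index)
        also have "\<dots> = (if i = 1 then det q else 0)"
          using adj_mat(2) [OF qc] i n0 by simp
        finally have "W $$ (i, 1) = (if i = 1 then det a else 0)"
          by (simp add: det_a)
        then show "a $$ (i, 1) = (if i = 1 then det a else 0)"
          unfolding a_def using Wc n0 i by (simp add: mult_diag_at_index)
      next
        show "int r * nu 2 = 0" using nu(1) by simp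
        show "int r * nu (Suc i) = - int r" if "2 \<le> i" "i < n" for i using nu(2) [OF that] by simp
      qed (use n in auto)
      then have "mev (q * C * qi) f = w p ^ r * mev (T z * C * T' z) f"
        unfolding a_def W_def using qc q C Tc TT wp n0 nu(2) [of "n - 1"] n
        by (intro semi_invariance_rescaled [OF f, where k = "n - 1"]) auto
      also have "\<dots> = w p ^ r * \<Phi> (\<lambda>s. w s / w p) (entries C)"
        using C by (simp add: \<Phi>_def z_def [abs_def])
      also have "\<dots> = (\<Sum>\<alpha>\<in>E. mev C (c \<alpha>) * (\<Prod>s\<in>S. w s ^ \<alpha> s))"
        by (rule Ec(4) [of w, OF wp])
      finally show ?thesis by (simp add: w_def)
    qed
    then show "\<exists>E c. finite E \<and> E \<subseteq> exps S \<and> (\<forall>\<alpha>. c \<alpha> \<in> polys n) \<and>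
        (\<forall>q qi C. fixes_e1 n q \<longrightarrow> qi \<in> carrier_mat n n \<longrightarrow> q * qi = 1\<^sub>m n \<longrightarrow> qi * q = 1\<^sub>m n \<longrightarrow>
           C \<in> carrier_mat n n \<longrightarrow> (\<forall>s\<in>S. adj_mat q $$ (cl s, 1) \<noteq> 0) \<longrightarrow>
           mev (q * C * qi) f = (\<Sum>\<alpha>\<in>E. mev C (c \<alpha>) * (\<Prod>s\<in>S. (adj_mat q $$ (cl s, 1)) ^ \<alpha> s)))"
      using Ec(1-3) by blast
  qed
qed

section \<open>The maximal minors as highest weight vectors\<close>

lemma sorted_list_of_set_nth_mem: "finite I \<Longrightarrow> j < card I \<Longrightarrow> sorted_list_of_set I ! j \<in> I"
  using nth_mem [of j "sorted_list_of_set I"] by simp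

lemma mev_u_tI:
  assumes I: "I \<subseteq> {1..n}" "card I = t" and t: "t \<le> n"
  shows "mev A (u_tI n t I) = det (mat t t (\<lambda>(i, j). krylov n A $$ (n - t + i, sorted_list_of_set I ! j - 1)))"
proof -
  have fin: "finite I" using I(1) by (rule finite_subset) simp
  have "mev A (u_tI n t I) = det (mat t t (\<lambda>(i, j). mev A (row_grad n ([n - t + 1..<n + 1] ! i) (sorted_list_of_set I ! j))))"
    unfolding u_tI_def mpeval_detm by (rule detm_eq_det) (use t in \<open>simp del: upt_Suc\<close>)
  also have "mat t t (\<lambda>(i, j). mev A (row_grad n ([n - t + 1..<n + 1] ! i) (sorted_list_of_set I ! j)))
     = mat t t (\<lambda>(i, j). krylov n A $$ (n - t + i, sorted_list_of_set I ! j - 1))"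
  proof (rule eq_matI)
    fix i j assume "i < dim_row (mat t t (\<lambda>(i, j). krylov n A $$ (n - t + i, sorted_list_of_set I ! j - 1)))"
      "j < dim_col (mat t t (\<lambda>(i, j). krylov n A $$ (n - t + i, sorted_list_of_set I ! j - 1)))"
    then have ij: "i < t" "j < t" by auto
    have "sorted_list_of_set I ! j \<in> I"
      using fin I(2) ij by (simp add: sorted_list_of_set_nth_mem)
    then have c: "sorted_list_of_set I ! j \<in> {1..n}" using I(1) by blast
    have r: "[n - t + 1..<n + 1] ! i = Suc (n - t + i)" "n - t + i < n"
      using ij t by (auto simp: nth_upt simp del: upt_Suc)
    have "krylov n A $$ (n - t + i, sorted_list_of_set I ! j - 1) = mev A (row_grad n (Suc (n - t + i)) (sorted_list_of_set I ! j))"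
      using c r by (subst krylov_index) auto
    then show "mat t t (\<lambda>(i, j). mev A (row_grad n ([n - t + 1..<n + 1] ! i) (sorted_list_of_set I ! j))) $$ (i, j)
       = mat t t (\<lambda>(i, j). krylov n A $$ (n - t + i, sorted_list_of_set I ! j - 1)) $$ (i, j)"
      unfolding index_mat(1) [OF ij] prod.case r(1) by (rule sym)
  qed auto
  finally show ?thesis .
qed

lemma u_tI_polys:
  assumes "I \<subseteq> {1..n}" "card I = t" "t \<le> n"
  shows "u_tI n t I \<in> polys n"
  unfolding u_tI_def using assms by (intro detm_polys row_grad_polys) simp

lemma unitri_fixes_e1: "n > 0 \<Longrightarrow> unitri n a \<Longrightarrow> fixes_e1 n a"
  by (auto simp: unitri_def fixes_e1_def)

text \<open>The torus only scales e_1, so \<open>krylov_conj\<close> does not apply. The right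
  factor acts on e_1 by d_0, and this produces the entry t in front of \<lambda>^t.\<close>

lemma krylov_diag_fun_conj:
  fixes A :: "'k::field mat"
  assumes inf: "infinite (UNIV :: 'k set)" and A: "A \<in> carrier_mat n n" and d: "\<forall>i<n. d i \<noteq> 0" and ij: "i < n" "j < n"
  shows "krylov n (diag_fun n (\<lambda>i. inverse (d i)) * A * diag_fun n d) $$ (i, j) = inverse (d i) * d 0 * krylov n A $$ (i, j)"
proof -
  have "grad n (diag_fun n (\<lambda>i. inverse (d i)) * A * diag_fun n d) (Suc j) = diag_fun n (\<lambda>i. inverse (d i)) * grad n A (Suc j) * diag_fun n d"
    using A d ij by (intro grad_conj [OF inf] diag_fun_inverse) auto
  then show ?thesis
    using ij by (simp add: krylov_def mult_diag_fun_index diag_fun_mult_index)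
qed

lemma det_scale_rows:
  "det (mat t t (\<lambda>(i, j). c i * X i j)) = (\<Prod>i<t. c i) * det (mat t t (\<lambda>(i, j). X i j :: 'k::comm_ring_1))"
proof -
  have "mat t t (\<lambda>(i, j). c i * X i j) = diag_fun t c * mat t t (\<lambda>(i, j). X i j)"
    by (rule eq_matI) (auto simp: diag_fun_mult_index)
  moreover have "det (diag_fun t c) = (\<Prod>i<t. c i)"
  proof -
    have "det (diag_fun t c) = prod_list (diag_mat (diag_fun t c))"
      by (rule det_upper_triangular [of _ t]) (auto simp: diag_fun_def)
    also have "diag_mat (diag_fun t c) = map c [0..<t]"
      unfolding diag_mat_def by (rule map_cong) (auto simp: diag_fun_def)
    also have "prod_list \<dots> = prod c (set [0..<t])"
      by (rule prod.distinct_set_conv_list [symmetric]) simp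
    finally show ?thesis by (simp add: atLeast0LessThan)
  qed
  ultimately show ?thesis by (simp add: det_mult [of _ t])
qed

lemma torus_char_lam_t:
  assumes t: "t < n" and d: "\<forall>i<n. d i \<noteq> (0 :: 'k::field)"
  shows "torus_char n (lam_t n t) d = (\<Prod>i<t. inverse (d (n - t + i)) * d 0)"
proof -
  have "torus_char n (lam_t n t) d = (\<Prod>i<n. (if i = 0 then d 0 ^ t else 1) * (if n - t \<le> i then inverse (d i) else 1))"
    unfolding torus_char_def using t
    by (intro prod.cong refl) (auto simp: lam_t_def power_int_minus Suc_diff_Suc)
  also have "\<dots> = d 0 ^ t * (\<Prod>i<n. if n - t \<le> i then inverse (d i) else 1)"
    unfolding prod.distrib using t by simp
  also have "(\<Prod>i<n. if n - t \<le> i then inverse (d i) else 1) = (\<Prod>i\<in>{n - t..<n}. inverse (d i))"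
    by (rule prod.mono_neutral_cong_right) auto
  also have "\<dots> = (\<Prod>i<t. inverse (d (n - t + i)))"
    by (rule prod.reindex_bij_witness [of _ "\<lambda>i. n - t + i" "\<lambda>i. i - (n - t)"]) (use t in auto)
  finally show ?thesis by (simp add: prod.distrib mult.commute)
qed

text \<open>Left multiplication by an upper unitriangular a mixes the last t rows of the cyclic
  basis only among themselves, through a unitriangular block, so their minors do not change. The
  torus multiplies row i by d_0/d_i, and the product over the last t rows is the character
  \<lambda>^t.\<close>

lemma u_tI_invU_wt:
  assumes inf: "infinite (UNIV :: 'k::field set)" and I: "I \<subseteq> {2..n}" "card I = t" and t: "t < n"
  shows "(u_tI n t I :: 'k mpoly) \<in> invU_wt n (lam_t n t)"
  unfolding invU_wt_iff
proof (intro conjI allI impI)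
  have I1: "I \<subseteq> {1..n}" using I(1) by auto
  have fin: "finite I" using I1 by (rule finite_subset) simp
  have tn: "t \<le> n" and n0: "n > 0" using t by auto
  note mev_u = mev_u_tI [OF I1 I(2) tn]
  define c where "c j = sorted_list_of_set I ! j - 1" for j
  have c: "c j < n" if "j < t" for j
  proof -
    have "sorted_list_of_set I ! j \<in> I"
      using fin I(2) that by (simp add: sorted_list_of_set_nth_mem)
    then have "sorted_list_of_set I ! j \<in> {1..n}" using I1 by blast
    then show ?thesis by (auto simp: c_def)
  qed
  show "u_tI n t I \<in> polys n" by (rule u_tI_polys [OF I1 I(2) tn])
  fix a b A :: "'k mat"
  assume a: "unitri n a" and b: "b \<in> carrier_mat n n" and A: "A \<in> carrier_mat n n" and ab: "a * b = 1\<^sub>m n" "b * a = 1\<^sub>m n"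
  have ac: "a \<in> carrier_mat n n" using a by (simp add: unitri_def)
  define U where "U = mat t t (\<lambda>(i, j). a $$ (n - t + i, n - t + j))"
  define M where "M = mat t t (\<lambda>(i, j). krylov n A $$ (n - t + i, c j))"
  have "krylov n (a * A * b) = a * krylov n A"
    by (rule krylov_conj [OF inf A unitri_fixes_e1 [OF n0 a] b ab])
  then have "mev (a * A * b) (u_tI n t I) = det (mat t t (\<lambda>(i, j). (a * krylov n A) $$ (n - t + i, c j)))"
    unfolding mev_u c_def by simp
  also have "mat t t (\<lambda>(i, j). (a * krylov n A) $$ (n - t + i, c j)) = U * M"
  proof (rule eq_matI)
    fix i j assume "i < dim_row (U * M)" "j < dim_col (U * M)"
    then have ij: "i < t" "j < t" by (auto simp: U_def M_def)
    have r: "n - t + i < n" using ij t by simp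
    have "(a * krylov n A) $$ (n - t + i, c j) = (\<Sum>k<n. a $$ (n - t + i, k) * krylov n A $$ (k, c j))"
      using ac r c [OF ij(2)] by (intro mult_mat_index) auto
    also have "\<dots> = (\<Sum>k\<in>{n - t..<n}. a $$ (n - t + i, k) * krylov n A $$ (k, c j))"
    proof (rule sum.mono_neutral_right)
      show "\<forall>k\<in>{..<n} - {n - t..<n}. a $$ (n - t + i, k) * krylov n A $$ (k, c j) = 0"
      proof
        fix k assume "k \<in> {..<n} - {n - t..<n}"
        then have "k < n" "k \<le> n - t + i" "n - t + i \<noteq> k" by auto
        then have "a $$ (n - t + i, k) = 0" using a r unfolding unitri_def by auto
        then show "a $$ (n - t + i, k) * krylov n A $$ (k, c j) = 0" by simp
      qed
    qed auto
    also have "\<dots> = (\<Sum>k<t. a $$ (n - t + i, n - t + k) * krylov n A $$ (n - t + k, c j))"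
      by (rule sum.reindex_bij_witness [of _ "\<lambda>k. n - t + k" "\<lambda>k. k - (n - t)"]) (use t in auto)
    also have "\<dots> = (U * M) $$ (i, j)"
      using ij by (subst mult_mat_index [of _ t]) (auto simp: U_def M_def)
    finally show "mat t t (\<lambda>(i, j). (a * krylov n A) $$ (n - t + i, c j)) $$ (i, j) = (U * M) $$ (i, j)"
      using ij by simp
  qed (auto simp: U_def M_def)
  also have "det (U * M) = det U * det M"
    by (rule det_mult [of _ t]) (auto simp: U_def M_def)
  also have "det U = 1"
  proof -
    have entries: "a $$ (n - t + i, n - t + j) = (if i = j then 1 else 0)" if "i < t" "j \<le> i" for i j
    proof -
      have "n - t + i < n" "n - t + j < n" "n - t + j \<le> n - t + i" using that t by auto
      then show ?thesis using a unfolding unitri_def by auto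
    qed
    have "det U = prod_list (diag_mat U)"
      by (rule det_upper_triangular [of _ t]) (auto simp: U_def entries)
    also have "diag_mat U = map (\<lambda>_. 1) [0..<t]"
      unfolding diag_mat_def by (rule map_cong) (auto simp: U_def entries)
    finally show ?thesis by (simp add: map_replicate_const)
  qed
  finally show "mev (a * A * b) (u_tI n t I) = mev A (u_tI n t I)"
    by (simp add: mev_u M_def c_def)
next
  have I1: "I \<subseteq> {1..n}" using I(1) by auto
  have fin: "finite I" using I1 by (rule finite_subset) simp
  have tn: "t \<le> n" and n0: "n > 0" using t by auto
  note mev_u = mev_u_tI [OF I1 I(2) tn]
  fix d :: "nat \<Rightarrow> 'k" and A :: "'k mat" assume d: "\<forall>i<n. d i \<noteq> 0" and A: "A \<in> carrier_mat n n"
  have "mat t t (\<lambda>(i, j). krylov n (diag_fun n (\<lambda>i. inverse (d i)) * A * diag_fun n d) $$ (n - t + i, sorted_list_of_set I ! j - 1))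
    = mat t t (\<lambda>(i, j). (inverse (d (n - t + i)) * d 0) * krylov n A $$ (n - t + i, sorted_list_of_set I ! j - 1))"
  proof (rule cong_mat [OF refl refl])
    fix i j assume ij: "i < t" "j < t"
    have "sorted_list_of_set I ! j \<in> I"
      using fin I(2) ij by (simp add: sorted_list_of_set_nth_mem)
    then have "sorted_list_of_set I ! j \<in> {1..n}" using I1 by blast
    then have "sorted_list_of_set I ! j - 1 < n" "n - t + i < n" using ij t by auto
    then show "(case (i, j) of (i, j) \<Rightarrow> krylov n (diag_fun n (\<lambda>i. inverse (d i)) * A * diag_fun n d) $$ (n - t + i, sorted_list_of_set I ! j - 1))
      = (case (i, j) of (i, j) \<Rightarrow> (inverse (d (n - t + i)) * d 0) * krylov n A $$ (n - t + i, sorted_list_of_set I ! j - 1))"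
      unfolding prod.case by (intro krylov_diag_fun_conj [OF inf A d])
  qed
  then show "mev (diag_fun n (\<lambda>i. inverse (d i)) * A * diag_fun n d) (u_tI n t I) = torus_char n (lam_t n t) d * mev A (u_tI n t I)"
    unfolding mev_u by (simp add: det_scale_rows torus_char_lam_t [OF t d])
qed

section \<open>Changing generators by signs\<close>

lemma mult_monomial_closed:
  fixes \<epsilon> :: "'a \<Rightarrow> 'b::comm_monoid_mult"
  assumes R: "\<And>c s. c \<in> R \<Longrightarrow> s \<in> S \<Longrightarrow> c * \<epsilon> s \<in> R" and "finite A" "A \<subseteq> S" "c \<in> R"
  shows "c * (\<Prod>s\<in>A. \<epsilon> s ^ \<alpha> s) \<in> R"
proof -
  have pow: "c * \<epsilon> s ^ k \<in> R" if "c \<in> R" "s \<in> S" for c s k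
    by (induction k) (use that R [of _ s] in \<open>auto simp: mult.assoc [symmetric] power_Suc2 simp del: power_Suc\<close>)
  show ?thesis using assms(2-)
    by (induction A arbitrary: c rule: finite_induct) (auto simp: mult.assoc [symmetric] pow)
qed

lemma alg_generated_unit_subset:
  assumes "finite S" "\<And>s. s \<in> S \<Longrightarrow> u' s = \<epsilon> s * u s" "\<And>c s. c \<in> R \<Longrightarrow> s \<in> S \<Longrightarrow> c * \<epsilon> s \<in> R"
  shows "alg_generated R S u' \<subseteq> alg_generated R S u"
proof
  fix f assume "f \<in> alg_generated R S u'"
  then obtain E c where E: "finite E" "E \<subseteq> exps S" "\<And>\<alpha>. \<alpha> \<in> E \<Longrightarrow> c \<alpha> \<in> R" "f = (\<Sum>\<alpha>\<in>E. c \<alpha> * (\<Prod>s\<in>S. u' s ^ \<alpha> s))"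
    unfolding alg_generated_def by blast
  have prod: "c * (\<Prod>s\<in>S. \<epsilon> s ^ \<alpha> s) \<in> R" if "c \<in> R" for c and \<alpha> :: "'a \<Rightarrow> nat"
    using mult_monomial_closed [of R S \<epsilon> S c \<alpha>] assms(1,3) that by blast
  have "f = (\<Sum>\<alpha>\<in>E. (c \<alpha> * (\<Prod>s\<in>S. \<epsilon> s ^ \<alpha> s)) * (\<Prod>s\<in>S. u s ^ \<alpha> s))"
    unfolding E(4) by (intro sum.cong refl)
      (simp add: assms(2) power_mult_distrib prod.distrib mult.assoc cong: prod.cong)
  then show "f \<in> alg_generated R S u"
    unfolding alg_generated_def using E(1-3) prod
    by (intro CollectI exI [of _ E] exI [of _ "\<lambda>\<alpha>. c \<alpha> * (\<Prod>s\<in>S. \<epsilon> s ^ \<alpha> s)"]) auto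
qed

lemma alg_generated_unit:
  assumes "finite S" "\<And>s. s \<in> S \<Longrightarrow> u' s = \<epsilon> s * u s" "\<And>c s. c \<in> R \<Longrightarrow> s \<in> S \<Longrightarrow> c * \<epsilon> s \<in> R"
    and unit: "\<And>s. s \<in> S \<Longrightarrow> \<epsilon> s * \<epsilon> s = 1"
  shows "alg_generated R S u' = alg_generated R S u"
proof
  show "alg_generated R S u' \<subseteq> alg_generated R S u"
    by (rule alg_generated_unit_subset [OF assms(1-3)])
  have "u s = \<epsilon> s * u' s" if "s \<in> S" for s
    using assms(2) [OF that] unit [OF that] by (simp add: mult.assoc [symmetric])
  then show "alg_generated R S u \<subseteq> alg_generated R S u'"
    by (rule alg_generated_unit_subset [OF assms(1) _ assms(3)])
qed

text \<open>The factors move into the coefficients, where they form an invertible element with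
  square 1. This absorbs the cofactor signs for t = n-2 and the sign of a row reversal for the
  v_{t,I}.\<close>

lemma alg_indep_over_unit:
  assumes "finite S" "\<And>s. s \<in> S \<Longrightarrow> u' s = \<epsilon> s * u s" "\<And>c s. c \<in> R \<Longrightarrow> s \<in> S \<Longrightarrow> c * \<epsilon> s \<in> R"
    and unit: "\<And>s. s \<in> S \<Longrightarrow> \<epsilon> s * \<epsilon> s = 1" and indep: "alg_indep_over R S u"
  shows "alg_indep_over R S u'"
  unfolding alg_indep_over_def
proof (intro allI impI ballI)
  fix E :: "('a \<Rightarrow> nat) set" and c \<alpha>
  assume *: "finite E \<and> E \<subseteq> exps S \<and> (\<forall>\<alpha>\<in>E. c \<alpha> \<in> R) \<and> (\<Sum>\<alpha>\<in>E. c \<alpha> * (\<Prod>s\<in>S. u' s ^ \<alpha> s)) = 0"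
    and \<alpha>: "\<alpha> \<in> E"
  have prod: "c * (\<Prod>s\<in>S. \<epsilon> s ^ \<alpha> s) \<in> R" if "c \<in> R" for c and \<alpha> :: "'a \<Rightarrow> nat"
    using mult_monomial_closed [of R S \<epsilon> S c \<alpha>] assms(1,3) that by blast
  let ?c = "\<lambda>\<alpha>. c \<alpha> * (\<Prod>s\<in>S. \<epsilon> s ^ \<alpha> s)"
  have "(\<Sum>\<alpha>\<in>E. c \<alpha> * (\<Prod>s\<in>S. u' s ^ \<alpha> s)) = (\<Sum>\<alpha>\<in>E. ?c \<alpha> * (\<Prod>s\<in>S. u s ^ \<alpha> s))"
    by (intro sum.cong refl)
      (simp add: assms(2) power_mult_distrib prod.distrib mult.assoc cong: prod.cong)
  then have "?c \<alpha> = 0"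
    using indep [unfolded alg_indep_over_def, rule_format, of E ?c \<alpha>] * \<alpha> prod by auto
  then have "?c \<alpha> * (\<Prod>s\<in>S. \<epsilon> s ^ \<alpha> s) = 0" by simp
  moreover have "(\<Prod>s\<in>S. \<epsilon> s ^ \<alpha> s) * (\<Prod>s\<in>S. \<epsilon> s ^ \<alpha> s) = 1"
    unfolding prod.distrib [symmetric] power_mult_distrib [symmetric] using unit by simp
  ultimately show "c \<alpha> = 0" by (simp add: mult.assoc)
qed

text \<open>Expansion along the first column e_1. It lets a minor that omits the first row and
  column stand for a full determinant.\<close>

lemma det_fixes_e1:
  assumes "fixes_e1 n G" "n > 0"
  shows "det G = det (mat_delete G 0 0)"
proof -
  have G: "G \<in> carrier_mat n n" using assms(1) by (rule fixes_e1_carrier)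
  have "det G = (\<Sum>i<n. G $$ (i, 0) * cofactor G i 0)"
    by (rule laplace_expansion_column [OF G assms(2)])
  also have "\<dots> = (\<Sum>i<n. if i = 0 then cofactor G i 0 else 0)"
    using assms(1) by (intro sum.cong) (auto simp: fixes_e1_def)
  finally show ?thesis using assms(2) by (simp add: cofactor_def)
qed

lemma sorted_list_of_set_remove_interval:
  assumes "1 \<le> c" "c < n"
  shows "sorted_list_of_set ({2..n} - {Suc c}) = [2..<Suc c] @ [c + 2..<Suc n]"
proof -
  have "{2..n} - {Suc c} = set ([2..<Suc c] @ [c + 2..<Suc n])"
    using assms by auto
  moreover have "sorted ([2..<Suc c] @ [c + 2..<Suc n])" "distinct ([2..<Suc c] @ [c + 2..<Suc n])"
    using assms by (auto simp: sorted_append simp del: upt_Suc)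
  ultimately show ?thesis
    using sorted_list_of_set.idem_if_sorted_distinct by metis
qed

lemma u_tI_generators:
  fixes n t :: nat
  assumes inf: "infinite (UNIV :: 'k::field set)" and n: "n \<ge> 2" and t: "t = 1 \<or> (n \<ge> 3 \<and> t \<in> {1, n - 2, n - 1})"
  defines "\<I> \<equiv> {I. I \<subseteq> {2..n} \<and> card I = t}"
  shows "alg_indep_over (invG n :: 'k mpoly set) \<I> (u_tI n t)
       \<and> alg_generated (invG n :: 'k mpoly set) \<I> (u_tI n t) = wt_algebra n (lam_t n t)"
proof -
  have fin: "finite \<I>" unfolding \<I>_def by (rule finite_subset [of _ "Pow {2..n}"]) auto
  have tn: "t < n" "1 \<le> t" using n t by auto
  have n0: "n > 0" using n by simp
  have u: "(u_tI n t I :: 'k mpoly) \<in> invU_wt n (lam_t n t)" if "I \<in> \<I>" for I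
    using that tn by (intro u_tI_invU_wt [OF inf]) (auto simp: \<I>_def)
  have mev_u: "mev A (u_tI n t I) = det (mat t t (\<lambda>(i, j). krylov n A $$ (n - t + i, sorted_list_of_set I ! j - 1)))"
    if "I \<in> \<I>" for I and A :: "'k mat"
    using that tn by (intro mev_u_tI) (auto simp: \<I>_def)
  \<comment> \<open>The ranges overlap for small n. For n = 2 the value t = 1 is n - 1, so the first
    case takes it and the other two may assume n \<ge> 3.\<close>
  consider (max) "t = n - 1" | (one) "t = 1" "n \<ge> 3" | (codim) "t = n - 2" "n \<ge> 3"
    using n t by force
  then show ?thesis
  proof cases
    case max
    have "\<I> = {{2..n}}"
      using max n card_subset_eq [of "{2..n}"] by (auto simp: \<I>_def)
    moreover have "mev A (u_tI n t I) = det (krylov n A)" if A: "A \<in> carrier_mat n n" and I: "I \<in> \<I>" for A :: "'k mat" and I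
    proof -
      have I2: "I = {2..n}" using I calculation by simp
      have s: "sorted_list_of_set I = [2..<Suc n]"
        unfolding I2 by (metis atLeastLessThanSuc_atLeastAtMost sorted_list_of_set_range)
      have "mat t t (\<lambda>(i, j). krylov n A $$ (n - t + i, sorted_list_of_set I ! j - 1)) = mat_delete (krylov n A) 0 0"
        unfolding s using max n by (intro eq_matI) (auto simp: mat_delete_def nth_upt simp del: upt_Suc)
      then show ?thesis
        using mev_u [OF I] det_fixes_e1 [OF fixes_e1_krylov [OF inf A n0] n0] by simp
    qed
    moreover have "lam_t n t (Suc i) = - 1" if "1 \<le> i" "i < n" for i
      using that max n by (simp add: lam_t_def)
    ultimately show ?thesis
      using generators_det [OF inf n, of \<I> "{2..n}" "u_tI n t" "lam_t n t"] u by blast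
  next
    case one
    define cl where "cl I = the_elem I - 1" for I :: "nat set"
    have bij: "bij_betw cl \<I> {1..<n}"
      by (rule bij_betw_byWitness [of _ "\<lambda>c. {Suc c}"])
        (auto simp: \<I>_def one card_1_singleton_iff cl_def)
    have mn: "mev A (u_tI n t I) = krylov n A $$ (n - 1, cl I)" if A: "A \<in> carrier_mat n n" and I: "I \<in> \<I>" for A :: "'k mat" and I
    proof -
      obtain j where "I = {j}" using I one by (auto simp: \<I>_def card_1_singleton_iff)
      then show ?thesis
        using mev_u [OF I] one by (simp add: cl_def det_single)
    qed
    have nu: "\<And>i. 1 \<le> i \<Longrightarrow> i < n - 1 \<Longrightarrow> lam_t n t (Suc i) = 0" "lam_t n t n = - 1"
      using one by (auto simp: lam_t_def)
    show ?thesis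
      using generators_last_row [OF inf one(2) fin bij u mn nu] by blast
  next
    case codim
    define cl where "cl I = the_elem ({2..n} - I) - 1" for I :: "nat set"
    have compl: "\<exists>c. 1 \<le> c \<and> c < n \<and> I = {2..n} - {Suc c} \<and> cl I = c" if "I \<in> \<I>" for I
    proof -
      have "I \<subseteq> {2..n}" "card I = n - 2" using that codim by (auto simp: \<I>_def)
      then have "card ({2..n} - I) = 1"
        using codim by (subst card_Diff_subset) (auto intro: finite_subset)
      then obtain j where j: "{2..n} - I = {j}" by (auto simp: card_1_singleton_iff)
      then have "j \<in> {2..n}" "I = {2..n} - {j}" using \<open>I \<subseteq> {2..n}\<close> by auto
      then show ?thesis using j by (intro exI [of _ "j - 1"]) (auto simp: cl_def)
    qed
    have inI: "{2..n} - {Suc c} \<in> \<I>" "cl ({2..n} - {Suc c}) = c" if "1 \<le> c" "c < n" for c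
    proof -
      have "Suc c \<in> {2..n}" using that by simp
      then show "{2..n} - {Suc c} \<in> \<I>" using codim by (simp add: \<I>_def)
      have "{2..n} - ({2..n} - {Suc c}) = {Suc c}" using that by auto
      then show "cl ({2..n} - {Suc c}) = c" by (simp add: cl_def)
    qed
    have bij: "bij_betw cl \<I> {1..<n}"
      by (rule bij_betw_byWitness [of _ "\<lambda>c. {2..n} - {Suc c}"]) (use compl inI in auto)
    \<comment> \<open>The cofactor sign of position (1, c) in 0-based indexing, where c + 1 is the
      one index that I omits from \<open>{2..n}\<close>.\<close>
    define \<epsilon> where "\<epsilon> I = ((- 1) ^ (1 + cl I) :: 'k mpoly)" for I
    define u' where "u' I = \<epsilon> I * u_tI n t I" for I
    have mev_\<epsilon>: "mev A (\<epsilon> I) = (- 1) ^ (1 + cl I)" for A I by (simp add: \<epsilon>_def)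
    have mn: "mev A (u' I) = adj_mat (krylov n A) $$ (cl I, 1)" if A: "A \<in> carrier_mat n n" and I: "I \<in> \<I>" for A :: "'k mat" and I
    proof -
      obtain c where c: "1 \<le> c" "c < n" "I = {2..n} - {Suc c}" "cl I = c" using compl [OF I] by blast
      define G where "G = krylov n A"
      have G: "fixes_e1 n G" unfolding G_def by (rule fixes_e1_krylov [OF inf A n0])
      have Gc: "G \<in> carrier_mat n n" by (simp add: G_def)
      have s: "sorted_list_of_set I = [2..<Suc c] @ [c + 2..<Suc n]"
        unfolding c(3) by (rule sorted_list_of_set_remove_interval [OF c(1,2)])
      have sj: "sorted_list_of_set I ! j - 1 = (if Suc j < c then Suc j else Suc (Suc j))" if "j < t" for j
        using that c codim unfolding s by (auto simp: nth_append nth_upt simp del: upt_Suc)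
      \<comment> \<open>The rows 2, ..., n-1 and the columns other than 0 and c remain after
        deleting row 1 and column c, then the first row and column. The second deletion does not
        change the determinant by \<open>det_fixes_e1\<close>.\<close>
      have "mat t t (\<lambda>(i, j). G $$ (n - t + i, sorted_list_of_set I ! j - 1)) = mat_delete (mat_delete G 1 c) 0 0"
      proof (rule eq_matI)
        fix i j assume "i < dim_row (mat_delete (mat_delete G 1 c) 0 0)" "j < dim_col (mat_delete (mat_delete G 1 c) 0 0)"
        then have ij: "i < t" "j < t" using Gc codim by (auto simp: mat_delete_def)
        have "n - t + i = Suc (Suc i)" using codim by simp
        then show "mat t t (\<lambda>(i, j). G $$ (n - t + i, sorted_list_of_set I ! j - 1)) $$ (i, j)
            = mat_delete (mat_delete G 1 c) 0 0 $$ (i, j)"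
          unfolding index_mat(1) [OF ij] prod.case sj [OF ij(2)]
          using ij Gc codim by (auto simp: mat_delete_def)
      qed (use codim Gc in \<open>auto simp: mat_delete_def\<close>)
      moreover have "fixes_e1 (n - 1) (mat_delete G 1 c)"
        using G c unfolding fixes_e1_def by (auto simp: mat_delete_def)
      ultimately have "mev A (u_tI n t I) = det (mat_delete G 1 c)"
        using mev_u [OF I, of A] det_fixes_e1 [of "n - 1" "mat_delete G 1 c"] n by (simp add: G_def)
      then show ?thesis
        using c Gc n by (simp add: u'_def mev_\<epsilon> adj_mat_def cofactor_def G_def)
    qed
    have \<epsilon>2: "\<epsilon> I * \<epsilon> I = 1" for I
      by (simp add: \<epsilon>_def power_mult_distrib [symmetric])
    have \<epsilon>1: "\<epsilon> I = 1 \<or> \<epsilon> I = - 1" for I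
      by (cases "even (cl I)") (simp_all add: \<epsilon>_def)
    have neg: "- c \<in> invU_wt n nu" if "c \<in> invU_wt n nu" for c :: "'k mpoly" and nu
      using that by (auto simp: invU_wt_iff)
    have negG: "- c \<in> invG n" if "c \<in> invG n" for c :: "'k mpoly"
      using that by (auto simp: invG_iff)
    have R\<epsilon>: "c * \<epsilon> I \<in> invG n" if "c \<in> invG n" for c I
      using \<epsilon>1 [of I] that negG by auto
    have u'w: "u' I \<in> invU_wt n (lam_t n t)" if "I \<in> \<I>" for I
      using \<epsilon>1 [of I] u [OF that] neg [OF u [OF that]] by (auto simp: u'_def)
    have nu: "lam_t n t 2 = 0" "\<And>i. 2 \<le> i \<Longrightarrow> i < n \<Longrightarrow> lam_t n t (Suc i) = - 1"
      using codim by (auto simp: lam_t_def)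
    note main = generators_cofactors [OF inf codim(2) fin bij u'w mn nu]
    have uu': "u_tI n t I = \<epsilon> I * u' I" for I
      by (simp add: u'_def mult.assoc [symmetric] \<epsilon>2)
    have "alg_indep_over (invG n) \<I> (u_tI n t :: _ \<Rightarrow> 'k mpoly)"
      by (rule alg_indep_over_unit [OF fin uu' R\<epsilon> \<epsilon>2 main(1)])
    moreover have "alg_generated (invG n) \<I> (u_tI n t :: _ \<Rightarrow> 'k mpoly) = wt_algebra n (lam_t n t)"
      using alg_generated_unit [OF fin uu' R\<epsilon> \<epsilon>2] main(2) by simp
    ultimately show ?thesis by blast
  qed
qed

section \<open>Reflection in the antidiagonal\<close>

definition mreflect :: "nat \<Rightarrow> 'k::comm_ring_1 mpoly \<Rightarrow> 'k mpoly" where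
  "mreflect n p = mpsubst (\<lambda>i j. Var (n + 1 - j) (n + 1 - i)) p"

text \<open>Unlike the ordinary transpose, this one maps upper unitriangular matrices to upper
  unitriangular ones. It also exchanges the first row with the last column, hence the two families
  of derivatives.\<close>

definition anti_transpose :: "nat \<Rightarrow> 'k mat \<Rightarrow> 'k mat" where
  "anti_transpose n A = mat n n (\<lambda>(i, j). A $$ (n - 1 - j, n - 1 - i))"

lemma anti_transpose_carrier [simp]: "anti_transpose n A \<in> carrier_mat n n" "dim_row (anti_transpose n A) = n" "dim_col (anti_transpose n A) = n"
  by (simp_all add: anti_transpose_def)

lemma anti_transpose_index: "i < n \<Longrightarrow> j < n \<Longrightarrow> anti_transpose n A $$ (i, j) = A $$ (n - 1 - j, n - 1 - i)"
  by (simp add: anti_transpose_def)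

lemma mpeval_mreflect: "mpeval x (mreflect n p) = mpeval (\<lambda>i j. x (n + 1 - j) (n + 1 - i)) p"
  by (simp add: mreflect_def mpeval_mpsubst)

lemma mev_mreflect: "p \<in> polys n \<Longrightarrow> mev A (mreflect n p) = mev (anti_transpose n A) p"
  unfolding mpeval_mreflect by (rule mpeval_cong) (auto simp: entries_def anti_transpose_def)

lemma mreflect_polys: "p \<in> polys n \<Longrightarrow> mreflect n p \<in> polys n"
  unfolding mreflect_def by (rule polys_mpsubst) (auto intro!: polys_Var)

lemma anti_transpose_mult:
  assumes "A \<in> carrier_mat n n" "B \<in> carrier_mat n n"
  shows "anti_transpose n (A * B) = anti_transpose n B * anti_transpose n (A :: 'k::comm_ring_1 mat)"
proof (rule eq_matI)
  fix i j assume "i < dim_row (anti_transpose n B * anti_transpose n A)" "j < dim_col (anti_transpose n B * anti_transpose n A)"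
  then have ij: "i < n" "j < n" by auto
  have "anti_transpose n (A * B) $$ (i, j) = (\<Sum>k<n. A $$ (n - 1 - j, k) * B $$ (k, n - 1 - i))"
    using ij assms by (simp add: anti_transpose_index) (subst mult_mat_index [of _ n], auto)
  also have "\<dots> = (\<Sum>k<n. B $$ (n - 1 - k, n - 1 - i) * A $$ (n - 1 - j, n - 1 - k))"
    by (rule sum.reindex_bij_witness [of _ "\<lambda>k. n - 1 - k" "\<lambda>k. n - 1 - k"]) (auto simp: mult.commute)
  also have "\<dots> = (anti_transpose n B * anti_transpose n A) $$ (i, j)"
    using ij by (subst mult_mat_index [of _ n]) (auto simp: anti_transpose_index intro!: sum.cong)
  finally show "anti_transpose n (A * B) $$ (i, j) = (anti_transpose n B * anti_transpose n A) $$ (i, j)" .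
qed auto

lemma anti_transpose_1 [simp]: "anti_transpose n (1\<^sub>m n) = 1\<^sub>m n"
  by (intro eq_matI) (auto simp: anti_transpose_def)

lemma anti_transpose_diag_fun: "anti_transpose n (diag_fun n d) = diag_fun n (\<lambda>i. d (n - 1 - i))"
  by (intro eq_matI) (auto simp: anti_transpose_def diag_fun_def)

lemma anti_transpose_unitri:
  assumes "unitri n a"
  shows "unitri n (anti_transpose n a)"
  unfolding unitri_def
proof (intro conjI allI impI)
  fix i j assume ij: "i < n" "j < n" "j \<le> i"
  have "n - 1 - j < n" "n - 1 - i < n" "n - 1 - i \<le> n - 1 - j" using ij by auto
  then have "a $$ (n - 1 - j, n - 1 - i) = (if n - 1 - j = n - 1 - i then 1 else 0)"
    using assms unfolding unitri_def by blast
  then show "anti_transpose n a $$ (i, j) = (if i = j then 1 else 0)"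
    using ij by (auto simp: anti_transpose_index)
qed simp

definition exch :: "nat \<Rightarrow> 'k::comm_ring_1 mat" where
  "exch n = mat n n (\<lambda>(i, j). if j = n - 1 - i then 1 else 0)"

lemma exch_carrier [simp]: "exch n \<in> carrier_mat n n" "dim_row (exch n) = n" "dim_col (exch n) = n"
  by (simp_all add: exch_def)

lemma exch_mult_index:
  assumes "M \<in> carrier_mat n n" "i < n" "j < n"
  shows "(exch n * M) $$ (i, j) = M $$ (n - 1 - i, j)"
proof -
  have "(exch n * M) $$ (i, j) = (\<Sum>k<n. if k = n - 1 - i then M $$ (k, j) else 0)"
    using assms by (subst mult_mat_index [of _ n]) (auto simp: exch_def intro!: sum.cong)
  then show ?thesis using assms by simp
qed

lemma mult_exch_index:
  assumes "M \<in> carrier_mat n n" "i < n" "j < n"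
  shows "(M * exch n) $$ (i, j) = M $$ (i, n - 1 - j)"
proof -
  have J: "exch n $$ (k, j) = (if k = n - 1 - j then 1 else 0 :: 'a)" if "k < n" for k
    using that assms(3) by (auto simp: exch_def)
  have "(M * exch n) $$ (i, j) = (\<Sum>k<n. M $$ (i, k) * exch n $$ (k, j))"
    using assms by (intro mult_mat_index) auto
  also have "\<dots> = (\<Sum>k<n. if k = n - 1 - j then M $$ (i, k) else 0)"
    using J by (intro sum.cong) auto
  finally show ?thesis using assms by simp
qed

lemma exch_exch: "exch n * exch n = 1\<^sub>m n"
  by (intro eq_matI) (auto simp: exch_mult_index, auto simp: exch_def)

text \<open>The antitranspose is J A^T J with J the exchange matrix, and J^2 = 1.\<close>

lemma det_anti_transpose:
  fixes A :: "'k::comm_ring_1 mat"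
  assumes A: "A \<in> carrier_mat n n"
  shows "det (anti_transpose n A) = det A"
proof -
  let ?J = "exch n :: 'k mat"
  have "anti_transpose n A = ?J * transpose_mat A * ?J"
    using A by (intro eq_matI) (auto simp: mult_exch_index exch_mult_index anti_transpose_index)
  then show ?thesis
    using det_conj [OF _ exch_carrier(1) exch_carrier(1) exch_exch, of "transpose_mat A"] A det_transpose [OF A]
    by simp
qed

lemma s_mat_anti_transpose:
  fixes A :: "'k::field mat"
  assumes inf: "infinite (UNIV :: 'k set)" and A: "A \<in> carrier_mat n n" and j: "j \<le> n"
  shows "s_mat n (anti_transpose n A) j = s_mat n A j"
proof (rule s_mat_eqI [OF inf _ A _ j])
  fix l
  have "shifted n (anti_transpose n A) l = anti_transpose n (shifted n A l)"
    using A by (intro eq_matI) (auto simp: shifted_index anti_transpose_index)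
  then show "det (shifted n (anti_transpose n A) l) = det (shifted n A l)"
    using A by (simp add: det_anti_transpose)
qed simp

text \<open>Both sides are differences of values of s_j, by \<open>s_val_shift\<close>. Reflection
  moves the unit added at (i, n) to (1, n+1-i), and s_j is invariant under it.\<close>

lemma mev_pdiff_reflect:
  fixes A :: "'k::field mat"
  assumes inf: "infinite (UNIV :: 'k set)" and A: "A \<in> carrier_mat n n" and ij: "1 \<le> i" "i \<le> n" "j \<le> n"
  shows "mev A (pdiff (i, n) (s_inv n j)) = mev (anti_transpose n A) (row_grad n (n + 1 - i) j)"
proof -
  define B where "B = to_mat n (\<lambda>a b. entries A a b + (if (a, b) = (i, n) then 1 else 0))"
  define B' where "B' = to_mat n (\<lambda>a b. entries (anti_transpose n A) a b + (if (a, b) = (1, n + 1 - i) then 1 else 0))"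
  have B: "B \<in> carrier_mat n n" by (simp add: B_def)
  have "anti_transpose n B = B'"
    using ij by (intro eq_matI) (auto simp: B_def B'_def anti_transpose_index entries_def)
  then have "s_mat n B' j = s_mat n B j"
    using s_mat_anti_transpose [OF inf B ij(3)] by simp
  then show ?thesis
    unfolding s_val_shift using s_mat_anti_transpose [OF inf A ij(3)] by (simp add: B_def B'_def mpeval_entries_to_mat)
qed

lemma mreflect_hom:
  fixes p q :: "'k::field mpoly"
  assumes inf: "infinite (UNIV :: 'k set)"
  shows "mreflect n (sum f A) = (\<Sum>a\<in>A. mreflect n (f a :: 'k mpoly))" "mreflect n (p * q) = mreflect n p * mreflect n q"
    "mreflect n (prod f A) = (\<Prod>a\<in>A. mreflect n (f a))" "mreflect n (p ^ k) = mreflect n p ^ k" "mreflect n (0 :: 'k mpoly) = 0"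
  by (rule mpeval_ext [OF inf], simp add: mpeval_mreflect)+

lemma mreflect_refl:
  fixes p :: "'k::field mpoly"
  assumes inf: "infinite (UNIV :: 'k set)" and p: "p \<in> polys n"
  shows "mreflect n (mreflect n p) = p"
  by (rule mpeval_ext [OF inf], unfold mpeval_mreflect, rule mpeval_cong [OF p]) auto

lemma mreflect_invG:
  fixes f :: "'k::field mpoly"
  assumes f: "f \<in> invG n"
  shows "mreflect n f \<in> invG n"
  unfolding invG_iff
proof (intro conjI allI impI)
  have fp: "f \<in> polys n" using f by (rule invG_imp_polys)
  then show "mreflect n f \<in> polys n" by (rule mreflect_polys)
  fix a b A :: "'k mat"
  assume *: "a \<in> carrier_mat n n" "b \<in> carrier_mat n n" "A \<in> carrier_mat n n" "a * b = 1\<^sub>m n" "b * a = 1\<^sub>m n"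
  have "anti_transpose n b * anti_transpose n a = 1\<^sub>m n" "anti_transpose n a * anti_transpose n b = 1\<^sub>m n"
    using * by (metis anti_transpose_mult anti_transpose_1)+
  moreover have "anti_transpose n (a * A * b) = anti_transpose n b * anti_transpose n A * anti_transpose n a"
    using * by (simp add: anti_transpose_mult assoc_mult_mat [of _ n n _ n _ n])
  ultimately show "mev (a * A * b) (mreflect n f) = mev A (mreflect n f)"
    using f unfolding invG_iff mev_mreflect [OF fp] by simp
qed

text \<open>Reversing products turns conjugation by a into conjugation by the inverse of its
  antitranspose. On the torus this inverts the entries and reverses their order, which changes nu_i
  into -nu_{n+1-i}.\<close>

lemma mreflect_invU_wt:
  fixes f :: "'k::field mpoly"
  assumes f: "f \<in> invU_wt n nu" and nu': "\<And>i. i \<in> {1..n} \<Longrightarrow> nu' i = - nu (n + 1 - i)"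
  shows "mreflect n f \<in> invU_wt n nu'"
  unfolding invU_wt_iff
proof (intro conjI allI impI)
  have fp: "f \<in> polys n" using f by (rule invU_wt_imp_polys)
  then show "mreflect n f \<in> polys n" by (rule mreflect_polys)
  fix a b A :: "'k mat"
  assume a: "unitri n a" and *: "b \<in> carrier_mat n n" "A \<in> carrier_mat n n" "a * b = 1\<^sub>m n" "b * a = 1\<^sub>m n"
  have ac: "a \<in> carrier_mat n n" using a by (simp add: unitri_def)
  let ?a = "anti_transpose n a" let ?b = "anti_transpose n b" let ?A = "anti_transpose n A"
  have ab: "?b * ?a = 1\<^sub>m n" "?a * ?b = 1\<^sub>m n"
    using * ac by (metis anti_transpose_mult anti_transpose_1)+
  \<comment> \<open>U-invariance is applied at ?b ?A ?a, because only \<open>?a\<close>, and not its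
    inverse \<open>?b\<close>, is known to be unitriangular.\<close>
  have "mev (?a * (?b * ?A * ?a) * ?b) f = mev (?b * ?A * ?a) f"
    using f anti_transpose_unitri [OF a] ab unfolding invU_wt_iff by simp
  moreover have "?a * (?b * ?A * ?a) * ?b = (?a * ?b) * ?A * (?a * ?b)"
    by (simp add: assoc_mult_mat [of _ n n _ n _ n])
  moreover have "anti_transpose n (a * A * b) = ?b * ?A * ?a"
    using * ac by (simp add: anti_transpose_mult assoc_mult_mat [of _ n n _ n _ n])
  ultimately show "mev (a * A * b) (mreflect n f) = mev A (mreflect n f)"
    unfolding mev_mreflect [OF fp] using ab by simp
next
  have fp: "f \<in> polys n" using f by (rule invU_wt_imp_polys)
  fix d :: "nat \<Rightarrow> 'k" and A :: "'k mat" assume d: "\<forall>i<n. d i \<noteq> 0" and A: "A \<in> carrier_mat n n"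
  define d' where "d' i = inverse (d (n - 1 - i))" for i
  have "anti_transpose n (diag_fun n (\<lambda>i. inverse (d i)) * A * diag_fun n d) = diag_fun n (\<lambda>i. inverse (d' i)) * anti_transpose n A * diag_fun n d'"
    unfolding d'_def [abs_def] using A by (simp add: anti_transpose_mult anti_transpose_diag_fun assoc_mult_mat [of _ n n _ n _ n])
  moreover have "\<forall>i<n. d' i \<noteq> 0" using d by (auto simp: d'_def)
  moreover have "torus_char n nu d' = torus_char n nu' d"
  proof -
    have "torus_char n nu' d = (\<Prod>i<n. d i powi (- nu (n - i)))"
      unfolding torus_char_def by (intro prod.cong refl) (simp add: nu')
    also have "\<dots> = torus_char n nu d'"
      unfolding torus_char_def
      by (rule prod.reindex_bij_witness [of _ "\<lambda>i. n - 1 - i" "\<lambda>i. n - 1 - i"])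
        (auto simp: d'_def power_int_minus power_int_inverse Suc_diff_Suc)
    finally show ?thesis by simp
  qed
  ultimately show "mev (diag_fun n (\<lambda>i. inverse (d i)) * A * diag_fun n d) (mreflect n f) = torus_char n nu' d * mev A (mreflect n f)"
    unfolding mev_mreflect [OF fp] using f unfolding invU_wt_iff by simp
qed

lemma mreflect_alg_indep:
  fixes u :: "'a \<Rightarrow> 'k::field mpoly"
  assumes inf: "infinite (UNIV :: 'k set)" and S: "finite S" and u: "\<And>s. s \<in> S \<Longrightarrow> u s \<in> polys n"
    and indep: "alg_indep_over (invG n) S u"
  shows "alg_indep_over (invG n) S (\<lambda>s. mreflect n (u s))"
  unfolding alg_indep_over_def
proof (intro allI impI ballI)
  fix E :: "('a \<Rightarrow> nat) set" and c \<alpha>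
  assume *: "finite E \<and> E \<subseteq> exps S \<and> (\<forall>\<alpha>\<in>E. c \<alpha> \<in> invG n) \<and> (\<Sum>\<alpha>\<in>E. c \<alpha> * (\<Prod>s\<in>S. mreflect n (u s) ^ \<alpha> s)) = 0"
    and \<alpha>: "\<alpha> \<in> E"
  have "0 = mreflect n (\<Sum>\<alpha>\<in>E. c \<alpha> * (\<Prod>s\<in>S. mreflect n (u s) ^ \<alpha> s))"
    using * by (simp add: mreflect_hom [OF inf])
  also have "\<dots> = (\<Sum>\<alpha>\<in>E. mreflect n (c \<alpha>) * (\<Prod>s\<in>S. u s ^ \<alpha> s))"
    unfolding mreflect_hom [OF inf] by (intro sum.cong arg_cong2 [where f = "(*)"] prod.cong refl)
      (simp add: mreflect_refl [OF inf] u)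
  finally have "mreflect n (c \<alpha>) = 0"
    using indep [unfolded alg_indep_over_def, rule_format, of E "\<lambda>\<alpha>. mreflect n (c \<alpha>)" \<alpha>] * \<alpha> mreflect_invG by auto
  then have "mreflect n (mreflect n (c \<alpha>)) = 0" by (simp add: mreflect_hom [OF inf])
  then show "c \<alpha> = 0" using * \<alpha> by (simp add: mreflect_refl [OF inf] invG_imp_polys)
qed

text \<open>For the harder inclusion, reflect an element back to weight nu, expand it there, and
  reflect the expansion; reflection is an involution that preserves the invariants.\<close>

lemma mreflect_alg_generated:
  fixes u :: "'a \<Rightarrow> 'k::field mpoly"
  assumes inf: "infinite (UNIV :: 'k set)" and S: "finite S" and u: "\<And>s. s \<in> S \<Longrightarrow> u s \<in> invU_wt n nu"
    and gen: "alg_generated (invG n) S u = wt_algebra n nu"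
    and nu': "\<And>i. i \<in> {1..n} \<Longrightarrow> nu' i = - nu (n + 1 - i)"
  shows "alg_generated (invG n) S (\<lambda>s. mreflect n (u s)) = wt_algebra n nu'"
proof
  show "alg_generated (invG n) S (\<lambda>s. mreflect n (u s)) \<subseteq> wt_algebra n nu'"
    by (intro alg_generated_subset_wt_algebra S mreflect_invU_wt [OF u nu'])
  show "wt_algebra n nu' \<subseteq> alg_generated (invG n) S (\<lambda>s. mreflect n (u s))"
  proof
    fix f :: "'k mpoly" assume "f \<in> wt_algebra n nu'"
    then obtain F g where F: "finite F" "\<And>r. r \<in> F \<Longrightarrow> g r \<in> invU_wt n (\<lambda>i. int r * nu' i)" "f = (\<Sum>r\<in>F. g r)"
      unfolding wt_algebra_def by blast
    have nu: "int r * nu i = - (int r * nu' (n + 1 - i))" if "i \<in> {1..n}" for r i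
    proof -
      have "n + 1 - i \<in> {1..n}" "n + 1 - (n + 1 - i) = i" using that by auto
      then show ?thesis using nu' [of "n + 1 - i"] by simp
    qed
    have "mreflect n f = (\<Sum>r\<in>F. mreflect n (g r))" unfolding F(3) by (rule mreflect_hom(1) [OF inf])
    moreover have "mreflect n (g r) \<in> invU_wt n (\<lambda>i. int r * nu i)" if "r \<in> F" for r
      by (rule mreflect_invU_wt [OF F(2) [OF that] nu])
    ultimately have "mreflect n f \<in> wt_algebra n nu"
      unfolding wt_algebra_def using F(1) by blast
    then obtain E c where E: "finite E" "E \<subseteq> exps S" "\<And>\<alpha>. \<alpha> \<in> E \<Longrightarrow> c \<alpha> \<in> invG n"
      and rf: "mreflect n f = (\<Sum>\<alpha>\<in>E. c \<alpha> * (\<Prod>s\<in>S. u s ^ \<alpha> s))"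
      unfolding gen [symmetric] alg_generated_def by blast
    have "f \<in> polys n" unfolding F(3) using F(2) by (intro polys_sum) (rule invU_wt_imp_polys)
    then have "f = mreflect n (mreflect n f)" by (simp add: mreflect_refl [OF inf])
    also have "\<dots> = (\<Sum>\<alpha>\<in>E. mreflect n (c \<alpha>) * (\<Prod>s\<in>S. mreflect n (u s) ^ \<alpha> s))"
      by (simp add: rf mreflect_hom [OF inf])
    finally show "f \<in> alg_generated (invG n) S (\<lambda>s. mreflect n (u s))"
      unfolding alg_generated_def using E mreflect_invG
      by (intro CollectI exI [of _ E] exI [of _ "\<lambda>\<alpha>. mreflect n (c \<alpha>)"]) auto
  qed
qed

text \<open>Reflection sends row i of v_{t,I} to the derivatives with index (1, n+1-i), so the rows
  appear in reverse order. Undoing this is left multiplication by \<open>exch t\<close>, whose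
  determinant has square 1 and is the same for all I.\<close>

lemma v_tI_eq:
  assumes inf: "infinite (UNIV :: 'k::field set)" and t: "t < n"
  shows "\<exists>\<epsilon>::'k. \<epsilon> * \<epsilon> = 1 \<and> (\<forall>I. I \<subseteq> {2..n} \<longrightarrow> card I = t \<longrightarrow> v_tI n t I = Cst \<epsilon> * mreflect n (u_tI n t I))"
proof -
  define J where "J = (exch t :: 'k mat)"
  have J: "J \<in> carrier_mat t t" by (simp add: J_def)
  have "det J * det J = 1"
    using det_mult [OF J J] by (simp add: J_def exch_exch)
  moreover have "v_tI n t I = Cst (det J) * mreflect n (u_tI n t I)" if I: "I \<subseteq> {2..n}" "card I = t" for I
  proof (rule mpeval_ext [OF inf])
    fix x :: "nat \<Rightarrow> nat \<Rightarrow> 'k"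
    have I1: "I \<subseteq> {1..n}" and tn: "t \<le> n" using I t by auto
    have fin: "finite I" using I1 by (rule finite_subset) simp
    have cs: "sorted_list_of_set I ! j \<in> {1..n}" if "j < t" for j
    proof -
      have "sorted_list_of_set I ! j \<in> I"
        using fin I(2) that by (simp add: sorted_list_of_set_nth_mem)
      then show ?thesis using I1 by blast
    qed
    define A where "A = to_mat n x"
    have A: "A \<in> carrier_mat n n" by (simp add: A_def)
    define M where "M = mat t t (\<lambda>(i, j). krylov n (anti_transpose n A) $$ (n - t + i, sorted_list_of_set I ! j - 1))"
    have "(v_tI n t I :: 'k mpoly) \<in> polys n"
      unfolding v_tI_def using I by (intro detm_polys polys_pdiff s_inv_polys) simp
    then have "mpeval x (v_tI n t I) = mev A (v_tI n t I)" by (simp add: A_def mpeval_entries_to_mat)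
    also have "\<dots> = det (mat t t (\<lambda>(i, j). mev A (pdiff ([1..<t + 1] ! i, n) (s_inv n (sorted_list_of_set I ! j)))))"
      unfolding v_tI_def mpeval_detm by (rule detm_eq_det) simp
    also have "mat t t (\<lambda>(i, j). mev A (pdiff ([1..<t + 1] ! i, n) (s_inv n (sorted_list_of_set I ! j)))) = J * M"
    proof (rule eq_matI)
      fix i j assume "i < dim_row (J * M)" "j < dim_col (J * M)"
      then have ij: "i < t" "j < t" by (auto simp: J_def M_def)
      have c: "sorted_list_of_set I ! j \<in> {1..n}" by (rule cs [OF ij(2)])
      have r: "[1..<t + 1] ! i = Suc i" using ij by (auto simp: nth_upt simp del: upt_Suc)
      have "mev A (pdiff (Suc i, n) (s_inv n (sorted_list_of_set I ! j)))
          = mev (anti_transpose n A) (row_grad n (n + 1 - Suc i) (sorted_list_of_set I ! j))"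
        using ij t c by (intro mev_pdiff_reflect [OF inf A]) auto
      also have "\<dots> = krylov n (anti_transpose n A) $$ (n - 1 - i, sorted_list_of_set I ! j - 1)"
        using ij t c by (subst krylov_index) (auto simp: Suc_diff_Suc)
      also have "\<dots> = (J * M) $$ (i, j)"
      proof -
        have "n - t + (t - 1 - i) = n - 1 - i" using ij t by simp
        then show ?thesis using ij unfolding J_def by (subst exch_mult_index) (auto simp: M_def)
      qed
      finally show "mat t t (\<lambda>(i, j). mev A (pdiff ([1..<t + 1] ! i, n) (s_inv n (sorted_list_of_set I ! j)))) $$ (i, j) = (J * M) $$ (i, j)"
        unfolding index_mat(1) [OF ij] prod.case r .
    qed (auto simp: J_def M_def)
    also have "det (J * M) = det J * det M"
      by (rule det_mult [OF J]) (simp add: M_def)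
    also have "det M = mev (anti_transpose n A) (u_tI n t I)"
      unfolding M_def by (rule mev_u_tI [OF I1 I(2) tn, symmetric])
    also have "\<dots> = mpeval x (mreflect n (u_tI n t I))"
    proof -
      have "(u_tI n t I :: 'k mpoly) \<in> polys n" by (rule u_tI_polys [OF I1 I(2) tn])
      then show ?thesis by (simp add: mev_mreflect [symmetric] A_def mpeval_entries_to_mat mreflect_polys)
    qed
    finally show "mpeval x (v_tI n t I) = mpeval x (Cst (det J) * mreflect n (u_tI n t I))" by simp
  qed
  ultimately show ?thesis by blast
qed

theorem theorem2p4:
  fixes n t :: nat
  assumes "n \<ge> 2"
    and "t = 1 \<or> (n \<ge> 3 \<and> t \<in> {1, n - 2, n - 1})"
  defines "\<I> \<equiv> {I. I \<subseteq> {2..n} \<and> card I = t}"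
  shows "alg_indep_over (invG n :: 'k::alg_closed_field mpoly set) \<I> (u_tI n t)
       \<and> alg_generated (invG n :: 'k mpoly set) \<I> (u_tI n t) = wt_algebra n (lam_t n t)
       \<and> alg_indep_over (invG n :: 'k mpoly set) \<I> (v_tI n t)
       \<and> alg_generated (invG n :: 'k mpoly set) \<I> (v_tI n t) = wt_algebra n (mu_t n t)"
proof -
  note inf = infinite_UNIV_alg_closed [where 'k = 'k]
  have U: "alg_indep_over (invG n :: 'k mpoly set) \<I> (u_tI n t)"
    "alg_generated (invG n :: 'k mpoly set) \<I> (u_tI n t) = wt_algebra n (lam_t n t)"
    using u_tI_generators [OF inf assms(1,2)] by (auto simp: \<I>_def)
  have fin: "finite \<I>" unfolding \<I>_def by (rule finite_subset [of _ "Pow {2..n}"]) auto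
  have tn: "t < n" using assms(1,2) by auto
  have u: "(u_tI n t I :: 'k mpoly) \<in> invU_wt n (lam_t n t)" if "I \<in> \<I>" for I
    using that tn by (intro u_tI_invU_wt [OF inf]) (auto simp: \<I>_def)
  obtain \<epsilon> :: 'k where \<epsilon>: "\<epsilon> * \<epsilon> = 1" and v: "\<And>I. I \<in> \<I> \<Longrightarrow> v_tI n t I = Cst \<epsilon> * mreflect n (u_tI n t I)"
    using v_tI_eq [OF inf tn] unfolding \<I>_def by blast
  \<comment> \<open>\<mu>^t is the negative of \<lambda>^t read backwards, which is precisely the
    change of weight under reflection.\<close>
  have mu: "mu_t n t i = - lam_t n t (n + 1 - i)" if "i \<in> {1..n}" for i
    using that tn by (auto simp: mu_t_def lam_t_def)
  have R: "c * Cst \<epsilon> \<in> invG n" if "c \<in> invG n" for c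
    using that unfolding invG_iff by (auto intro!: polys_mult)
  have unit: "Cst \<epsilon> * Cst \<epsilon> = 1"
    by (simp add: mult_single \<epsilon>)
  have "alg_indep_over (invG n :: 'k mpoly set) \<I> (\<lambda>I. mreflect n (u_tI n t I))"
    using u by (intro mreflect_alg_indep [OF inf fin _ U(1)]) (rule invU_wt_imp_polys)
  note alg_indep_over_unit [OF fin v R unit this]
  then have "alg_indep_over (invG n :: 'k mpoly set) \<I> (v_tI n t)" by simp
  moreover have "alg_generated (invG n :: 'k mpoly set) \<I> (\<lambda>I. mreflect n (u_tI n t I)) = wt_algebra n (mu_t n t)"
    by (rule mreflect_alg_generated [OF inf fin u U(2) mu])
  then have "alg_generated (invG n :: 'k mpoly set) \<I> (v_tI n t) = wt_algebra n (mu_t n t)"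
    using alg_generated_unit [OF fin v R unit] by simp
  ultimately show ?thesis using U by blast
qed

end
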